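(* Assume that (1) the best alternative $\pi^*(c)=\arg\max_{k\in\mathcal K}F(k,c)$ is unique for all $c\in\mathcal C$; (2) the observation noise satisfies $\epsilon^n(k,c)\sim\mathcal N(0,\sigma^2(k,c))$ with known $\sigma^2(k,c)$, independent across $n,k,c$; (3) the GP prior is fixed across iterations; (4) for every $k\in\mathcal K$ the prior covariance matrix $\Sigma_0(\mathcal C,\mathcal C;k)$ is strictly positive definite. Then the GP-C-OCBA policy is strongly consistent: almost surely, $\pi^B(c)\to\pi^*(c)$ for all $c\in\mathcal C$ as the observation budget $B\to\infty$.
   Context: Setting. $\mathcal K$ is a finite set of alternatives ($|\mathcal K|\ge 2$), $\mathcal C\subset\mathbb R^d$ is a finite nonempty set of contexts, $F:\mathcal K\times\mathcal C\to\mathbb R$ is a fixed unknown reward function. Sampling $(k,c)$ returns $F(k,c)+\epsilon^n(k,c)$ with noise variance $\sigma^2(k,c)>0$. Probabilities are with respect to the observation noise (with $F$ fixed). $N_n(k,c)$ is the number of the first $n$ samples allocated to $(k,c)$. Gaussian process (GP) model. For each alternative $k$ separately, a GP prior over contexts with mean $\mu_0(k,\cdot)$ and covariance $\Sigma_0(\cdot,\cdot;k)$ is used. Let $D_n(k)$ be the list (with repetitions) of contexts sampled for alternative $k$ among the first $n$ samples and $Y_n(k)$ the corresponding column vector of observations. With $A_n(k)=\Sigma_0(D_n(k),D_n(k);k)+\mathrm{diag}(\sigma^2(k,D_n(k)))$, the posterior mean and covariance are $$\mu_n(k,c)=\mu_0(k,c)+\Sigma_0(c,D_n(k);k)A_n(k)^{-1}(Y_n(k)-\mu_0(k,D_n(k))),$$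 $$\Sigma_n(c,c';k)=\Sigma_0(c,c';k)-\Sigma_0(c,D_n(k);k)A_n(k)^{-1}\Sigma_0(D_n(k),c';k),$$ and $\Sigma_n(k,c):=\Sigma_n(c,c;k)$. The predicted best alternative after $n$ samples is $\pi^n(c)=\arg\max_{k}\mu_n(k,c)$. GP-C-OCBA policy. Use a pre-determined rule to allocate $N_0$ initial samples to the alternatives. Then for $n=N_0,N_0+1,\dots$ (until the budget $B$ is exhausted): compute $\mu_n,\Sigma_n,\pi^n$ and let $\hat p_n(k,c)=N_n(k,c)/n$. For all $c$ and $k\ne\pi^n(c)$ set $$\zeta(k,c)=\frac{(\mu_n(\pi^n(c),c)-\mu_n(k,c))^2}{\Sigma_n(\pi^n(c),c)+\Sigma_n(k,c)},\quad \psi^{(1)}(c)=\frac{\hat p_n(\pi^n(c),c)}{\Sigma_n(\pi^n(c),c)},\quad \psi^{(2)}(c)=\sum_{k\ne\pi^n(c)}\frac{\hat p_n(k,c)}{\Sigma_n(k,c)}.$$ Let $(\tilde k^*,\tilde c^* )$ minimize $\zeta(k,c)$ over $c\in\mathcal C$, $k\ne\pi^n(c)$. The next sample is drawn from $(\pi^n(\tilde c^* ),\tilde c^* )$ if $\psi^{(1)}(\tilde c^* )<\psi^{(2)}(\tilde c^* )$ and from $(\tilde k^*,\tilde c^* )$ otherwise. After $B$ samples, the policy returns $\pi^B(c)$, $c\in\mathcal C$. *)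

theory Defs
  imports
    "HOL-Probability.Probability"
    "Jordan_Normal_Form.Gauss_Jordan_Elimination"
begin

section \<open>Gaussian process posterior for one alternative\<close>

text \<open>
  Here \<open>m\<close> and \<open>S\<close> are the prior mean and covariance function over contexts, \<open>v\<close> is the noise
  variance, \<open>D\<close> is the list (with repetitions) of sampled contexts and \<open>Y\<close> the list of
  corresponding observations.
\<close>

definition gp_noisy_cov :: "('c \<Rightarrow> 'c \<Rightarrow> real) \<Rightarrow> ('c \<Rightarrow> real) \<Rightarrow> 'c list \<Rightarrow> real mat" where
  "gp_noisy_cov S v D =
     mat (length D) (length D) (\<lambda>(i, j). S (D ! i) (D ! j) + (if i = j then v (D ! i) else 0))"

definition gp_noisy_cov_inv :: "('c \<Rightarrow> 'c \<Rightarrow> real) \<Rightarrow> ('c \<Rightarrow> real) \<Rightarrow> 'c list \<Rightarrow> real mat" where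
  "gp_noisy_cov_inv S v D = the (mat_inverse (gp_noisy_cov S v D))"

definition gp_post_mean ::
  "('c \<Rightarrow> real) \<Rightarrow> ('c \<Rightarrow> 'c \<Rightarrow> real) \<Rightarrow> ('c \<Rightarrow> real) \<Rightarrow> 'c list \<Rightarrow> real list \<Rightarrow> 'c \<Rightarrow> real" where
  "gp_post_mean m S v D Y c =
     m c + scalar_prod (vec (length D) (\<lambda>i. S c (D ! i)))
             (gp_noisy_cov_inv S v D *\<^sub>v vec (length D) (\<lambda>i. Y ! i - m (D ! i)))"

definition gp_post_cov ::
  "('c \<Rightarrow> 'c \<Rightarrow> real) \<Rightarrow> ('c \<Rightarrow> real) \<Rightarrow> 'c list \<Rightarrow> 'c \<Rightarrow> 'c \<Rightarrow> real" where
  "gp_post_cov S v D c c' =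
     S c c' - scalar_prod (vec (length D) (\<lambda>i. S c (D ! i)))
                (gp_noisy_cov_inv S v D *\<^sub>v vec (length D) (\<lambda>i. S (D ! i) c'))"

text \<open>Strict positive definiteness of the matrix \<open>S(C, C)\<close>; symmetry is part of the notion.\<close>

definition strictly_pos_def_on :: "'c set \<Rightarrow> ('c \<Rightarrow> 'c \<Rightarrow> real) \<Rightarrow> bool" where
  "strictly_pos_def_on C S \<longleftrightarrow>
     (\<forall>c\<in>C. \<forall>c'\<in>C. S c c' = S c' c) \<and>
     (\<forall>v :: 'c \<Rightarrow> real. (\<exists>c\<in>C. v c \<noteq> 0) \<longrightarrow> 0 < (\<Sum>c\<in>C. \<Sum>c'\<in>C. v c * S c c' * v c'))"

section \<open>The GP-C-OCBA policy\<close>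

text \<open>
  A history is the chronological list of the samples taken so far, each consisting of the sampled
  pair (alternative, context) and the observed value; its length is the number \<open>n\<close> of samples.
\<close>

type_synonym ('k, 'c) history = "(('k \<times> 'c) \<times> real) list"

definition samples_of :: "('k, 'c) history \<Rightarrow> 'k \<Rightarrow> ('k, 'c) history" where
  "samples_of h k = filter (\<lambda>s. fst (fst s) = k) h"

definition num_samples :: "('k, 'c) history \<Rightarrow> 'k \<Rightarrow> 'c \<Rightarrow> nat" where
  "num_samples h k c = count_list (map fst h) (k, c)"

definition frac_samples :: "('k, 'c) history \<Rightarrow> 'k \<Rightarrow> 'c \<Rightarrow> real" where
  "frac_samples h k c = real (num_samples h k c) / real (length h)"

text \<open>
  Parameters: alternatives \<open>K\<close>, contexts \<open>C\<close>, reward \<open>F\<close>, noise variances \<open>s2\<close>, prior means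
  \<open>mu0 k\<close> and prior covariances \<open>S0 k\<close>, and the pre-determined initial allocation
  \<open>init 0, \<dots>, init (N0 - 1)\<close>.

  The functions \<open>tie_alt\<close> and \<open>tie_pair\<close> resolve ties in the argmax defining the predicted best
  alternative and in the argmin over pairs: they pick an element of the set of optimisers, and
  the pick may depend on the number of samples (and, for the former, on the context).
\<close>

locale gp_c_ocba =
  fixes K :: "'k set" and C :: "'c set"
    and F :: "'k \<Rightarrow> 'c \<Rightarrow> real" and s2 :: "'k \<Rightarrow> 'c \<Rightarrow> real"
    and mu0 :: "'k \<Rightarrow> 'c \<Rightarrow> real" and S0 :: "'k \<Rightarrow> 'c \<Rightarrow> 'c \<Rightarrow> real"
    and N0 :: nat and init :: "nat \<Rightarrow> 'k \<times> 'c"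
    and tie_alt :: "nat \<Rightarrow> 'c \<Rightarrow> 'k set \<Rightarrow> 'k"
    and tie_pair :: "nat \<Rightarrow> ('k \<times> 'c) set \<Rightarrow> 'k \<times> 'c"
begin

definition post_mean :: "('k, 'c) history \<Rightarrow> 'k \<Rightarrow> 'c \<Rightarrow> real" where
  "post_mean h k c =
     gp_post_mean (mu0 k) (S0 k) (s2 k)
       (map (snd \<circ> fst) (samples_of h k)) (map snd (samples_of h k)) c"

definition post_var :: "('k, 'c) history \<Rightarrow> 'k \<Rightarrow> 'c \<Rightarrow> real" where
  "post_var h k c = gp_post_cov (S0 k) (s2 k) (map (snd \<circ> fst) (samples_of h k)) c c"

definition predicted_best :: "('k, 'c) history \<Rightarrow> 'c \<Rightarrow> 'k" where
  "predicted_best h c =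
     tie_alt (length h) c {k. is_arg_max (\<lambda>k. post_mean h k c) (\<lambda>k. k \<in> K) k}"

definition zeta :: "('k, 'c) history \<Rightarrow> 'k \<Rightarrow> 'c \<Rightarrow> real" where
  "zeta h k c =
     (post_mean h (predicted_best h c) c - post_mean h k c)\<^sup>2
       / (post_var h (predicted_best h c) c + post_var h k c)"

definition psi1 :: "('k, 'c) history \<Rightarrow> 'c \<Rightarrow> real" where
  "psi1 h c = frac_samples h (predicted_best h c) c / post_var h (predicted_best h c) c"

definition psi2 :: "('k, 'c) history \<Rightarrow> 'c \<Rightarrow> real" where
  "psi2 h c = (\<Sum>k \<in> K - {predicted_best h c}. frac_samples h k c / post_var h k c)"

definition next_sample :: "('k, 'c) history \<Rightarrow> 'k \<times> 'c" where
  "next_sample h =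
     (let (k, c) = tie_pair (length h)
            {p. is_arg_min (\<lambda>(k, c). zeta h k c)
                  (\<lambda>(k, c). c \<in> C \<and> k \<in> K \<and> k \<noteq> predicted_best h c) p}
      in if psi1 h c < psi2 h c then (predicted_best h c, c) else (k, c))"

text \<open>
  The history of the first \<open>n\<close> samples for a realisation \<open>e\<close> of the noise. The noise is indexed
  by replication: \<open>e j k c\<close> is the noise of the sample of \<open>(k, c)\<close> that is preceded by \<open>j\<close>
  samples of \<open>(k, c)\<close>. For independent noise, identically distributed over \<open>j\<close>, the law of the
  histories is the same as when \<open>j\<close> is the overall sample number.
\<close>

primrec history :: "(nat \<Rightarrow> 'k \<Rightarrow> 'c \<Rightarrow> real) \<Rightarrow> nat \<Rightarrow> ('k, 'c) history" where
  "history e 0 = []"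
| "history e (Suc n) =
     (let h = history e n;
          (k, c) = (if n < N0 then init n else next_sample h)
      in h @ [((k, c), F k c + e (num_samples h k c) k c)])"

end

end

theory Submission
  imports Defs "Jordan_Normal_Form.Determinant"
begin

text \<open>
  The posterior of an alternative depends on its data only through the counts \<open>n\<^sub>c\<close> and the sample
  means; it satisfies \<open>\<Sigma>\<^sub>n(c) \<le> \<sigma>\<^sup>2(c) / n\<^sub>c\<close>, \<open>\<Sigma>\<^sub>n(c) \<ge> const / (n\<^sub>c + 1)\<close>, and the posterior mean
  differs from the sample mean by \<open>O(1 / n\<^sub>c)\<close>. By the strong law it therefore suffices that every pair
  is sampled infinitely often.

  If some pair is starved, the minimum of \<open>\<zeta>\<close> stays bounded. Take a context \<open>c\<close> that is visited
  infinitely often and the set \<open>I\<close> of alternatives sampled infinitely often there. The comparison of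
  \<open>\<psi>\<^sup>1\<close> and \<open>\<psi>\<^sup>2\<close> forces \<open>|I| \<ge> 2\<close>, and boundedness of \<open>\<zeta>\<close> forces all of \<open>I\<close> to have the same
  reward and an alternative to be sampled only while its sample mean is within \<open>O(1 / sqrt \<nu>)\<close> of the
  best one, \<open>\<nu>\<close> being the smallest count. The rewards of \<open>I\<close> may really be tied, so a limit argument
  does not exclude this. But whenever the last arm of \<open>I\<close> reaches level \<open>\<nu>\<close>, with probability bounded
  away from 0 its mean drops by a large multiple of \<open>1 / sqrt \<nu>\<close> before it has \<open>2 \<nu>\<close> samples while the
  other means stay put forever; it is then never sampled again. A zero-one argument shows that
  the situation has probability 0.
\<close>

section \<open>Events depending on finitely many coordinates\<close>

text \<open>Uniqueness of the best alternative does not rule out ties among the others: if the best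
  one is itself starved at \<open>c\<close>, the alternatives still sampled there may have equal
  rewards, and the law of large numbers is silent. Only fluctuations can separate them, and these
  have the order \<open>1 / sqrt \<nu>\<close> of the tolerance that a bounded \<zeta> allows. Hence
  the scale of the drop: the sum of \<nu> fresh noises divided by \<open>sqrt \<nu>\<close> has a
  law that does not involve \<nu>, so any prescribed multiple is exceeded with a fixed positive
  probability. As noise is indexed by replication, the noises \<nu>, ..., 2\<nu> - 1 of an arm are a
  fixed block of coordinates although they are observed at random times, and that this arm is the
  last to reach level \<nu> is decided without reading the block. The remaining obstacle is that the
  bad event depends on all noises; replacing it by a nearby event of finitely many noises restores
  independence from every later block. This takes the place of a conditional zero-one law along
  stopping times.\<close>

text \<open>Membership in \<open>X\<close>, for points of \<open>\<Omega>\<close>, is determined by the coordinates in \<open>A\<close>.\<close>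

definition depends_on :: "'i set \<Rightarrow> ('i \<Rightarrow> 'a) set \<Rightarrow> ('i \<Rightarrow> 'a) set \<Rightarrow> bool" where
  "depends_on A \<Omega> X \<longleftrightarrow> (\<forall>x\<in>\<Omega>. \<forall>y\<in>\<Omega>. (\<forall>i\<in>A. x i = y i) \<longrightarrow> x \<in> X \<longrightarrow> y \<in> X)"

lemma depends_onD: "depends_on A \<Omega> X \<Longrightarrow> x \<in> X \<Longrightarrow> x \<in> \<Omega> \<Longrightarrow> y \<in> \<Omega> \<Longrightarrow> (\<And>i. i \<in> A \<Longrightarrow> x i = y i) \<Longrightarrow> y \<in> X"
  unfolding depends_on_def by blast

lemma depends_on_mono: "depends_on A \<Omega> X \<Longrightarrow> A \<subseteq> B \<Longrightarrow> depends_on B \<Omega> X"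
  by (auto intro: depends_onD simp: subset_iff depends_on_def[of B])

lemma depends_on_Diff: "depends_on A \<Omega> X \<Longrightarrow> depends_on A \<Omega> (\<Omega> - X)"
  unfolding depends_on_def by (intro ballI impI) (metis DiffD2 DiffI)

lemma depends_on_UN:
  assumes "\<And>i. i \<in> J \<Longrightarrow> depends_on A \<Omega> (X i)"
  shows "depends_on A \<Omega> (\<Union>i\<in>J. X i)"
  unfolding depends_on_def
proof (intro ballI impI)
  fix x y assume xy: "x \<in> \<Omega>" "y \<in> \<Omega>" "\<forall>i\<in>A. x i = y i" "x \<in> (\<Union>i\<in>J. X i)"
  then obtain i where i: "i \<in> J" "x \<in> X i" by blast
  then have "y \<in> X i" using depends_onD[OF assms[OF i(1)] i(2)] xy by blast
  then show "y \<in> (\<Union>i\<in>J. X i)" using i by blast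
qed

lemma depends_on_Int: "depends_on A \<Omega> X \<Longrightarrow> depends_on A \<Omega> Y \<Longrightarrow> depends_on A \<Omega> (X \<inter> Y)"
  unfolding depends_on_def by blast

lemma depends_on_Collect:
  assumes "\<And>x y. x \<in> \<Omega> \<Longrightarrow> y \<in> \<Omega> \<Longrightarrow> (\<And>i. i \<in> A \<Longrightarrow> x i = y i) \<Longrightarrow> P x \<Longrightarrow> P y"
  shows "depends_on A \<Omega> {x \<in> \<Omega>. P x}"
  using assms unfolding depends_on_def by blast

section \<open>Independence of events on disjoint sets of coordinates\<close>

context product_prob_space
begin

lemma indep_vars_coordinates:
  assumes "I \<noteq> {}"
  shows "P.indep_vars M (\<lambda>i x. x i) I"
proof -
  have "distr (PiM I M) (PiM I M) (\<lambda>x. \<lambda>i\<in>I. x i) = distr (PiM I M) (PiM I M) (\<lambda>x. x)"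
    by (rule distr_cong) (simp_all add: space_PiM PiE_restrict)
  also have "\<dots> = PiM I M"
    by (rule distr_id2) simp
  also have "\<dots> = PiM I (\<lambda>i. distr (PiM I M) (M i) (\<lambda>x. x i))"
    by (rule PiM_cong) (simp_all add: PiM_component)
  finally show ?thesis
    using P.indep_vars_iff_distr_eq_PiM'[OF assms, of "\<lambda>i x. x i" M] by simp
qed

text \<open>Coordinates outside \<open>A\<close> are filled in from a fixed point \<open>z\<close>;
  since \<open>X\<close> does not look at them, the preimage of \<open>X\<close> under this
  extension is a measurable set over \<open>A\<close> that pulls back to \<open>X\<close>.\<close>

lemma depends_on_restrict:
  assumes X: "X \<in> sets (PiM I M)" and A: "A \<subseteq> I" and dep: "depends_on A (space (PiM I M)) X"
  obtains X' where "X' \<in> sets (PiM A M)"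
    "\<And>x. x \<in> space (PiM I M) \<Longrightarrow> x \<in> X \<longleftrightarrow> restrict x A \<in> X'"
proof -
  obtain z where z: "z \<in> space (PiM I M)"
    using P.not_empty by blast
  define f where "f u = (\<lambda>i\<in>I. if i \<in> A then u i else z i)" for u
  have f: "f \<in> measurable (PiM A M) (PiM I M)"
    unfolding f_def
  proof (rule measurable_restrict)
    fix i assume "i \<in> I"
    then show "(\<lambda>u. if i \<in> A then u i else z i) \<in> measurable (PiM A M) (M i)"
      using z by (cases "i \<in> A") (auto simp: space_PiM PiE_iff intro!: measurable_const)
  qed
  show thesis
  proof
    show "f -` X \<inter> space (PiM A M) \<in> sets (PiM A M)"
      using f X by (rule measurable_sets)
    fix x assume x: "x \<in> space (PiM I M)"
    then have r: "restrict x A \<in> space (PiM A M)"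
      by (rule measurable_space[OF measurable_restrict_subset[OF A]])
    then have fx: "f (restrict x A) \<in> space (PiM I M)"
      by (rule measurable_space[OF f])
    have "\<And>i. i \<in> A \<Longrightarrow> x i = f (restrict x A) i"
      using A by (auto simp: f_def)
    then have "x \<in> X \<longleftrightarrow> f (restrict x A) \<in> X"
      using depends_onD[OF dep _ x fx] depends_onD[OF dep _ fx x] by auto
    with r show "x \<in> X \<longleftrightarrow> restrict x A \<in> f -` X \<inter> space (PiM A M)"
      by auto
  qed
qed

text \<open>Both events are pullbacks along the restrictions to \<open>A\<close> and
  \<open>B\<close>, which are independent random elements. The sets may be infinite: later one of
  them is the complement of a finite block.\<close>

lemma measure_Int_disjoint_coordinates:
  assumes X: "X \<in> sets (PiM I M)" "depends_on A (space (PiM I M)) X"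
    and Y: "Y \<in> sets (PiM I M)" "depends_on B (space (PiM I M)) Y"
    and AB: "A \<inter> B = {}" "A \<subseteq> I" "B \<subseteq> I" and "I \<noteq> {}"
  shows "P.prob (X \<inter> Y) = P.prob X * P.prob Y"
proof -
  obtain X' where X': "X' \<in> sets (PiM A M)" "\<And>x. x \<in> space (PiM I M) \<Longrightarrow> x \<in> X \<longleftrightarrow> restrict x A \<in> X'"
    using depends_on_restrict[OF X(1) AB(2) X(2)] by blast
  obtain Y' where Y': "Y' \<in> sets (PiM B M)" "\<And>x. x \<in> space (PiM I M) \<Longrightarrow> x \<in> Y \<longleftrightarrow> restrict x B \<in> Y'"
    using depends_on_restrict[OF Y(1) AB(3) Y(2)] by blast
  have iv: "P.indep_var (PiM A M) (\<lambda>x. restrict (\<lambda>i. x i) A) (PiM B M) (\<lambda>x. restrict (\<lambda>i. x i) B)"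
    by (rule P.indep_var_restrict[OF indep_vars_coordinates]) (use assms in auto)
  have XY: "X = (\<lambda>x. restrict x A) -` X' \<inter> space (PiM I M)" "Y = (\<lambda>x. restrict x B) -` Y' \<inter> space (PiM I M)"
    using X' Y' sets.sets_into_space[OF X(1)] sets.sets_into_space[OF Y(1)] by auto
  have "P.prob ((\<lambda>x. (restrict x A, restrict x B)) -` (X' \<times> Y') \<inter> space (PiM I M))
     = P.prob ((\<lambda>x. restrict x A) -` X' \<inter> space (PiM I M)) * P.prob ((\<lambda>x. restrict x B) -` Y' \<inter> space (PiM I M))"
    using P.indep_varD[OF iv X'(1) Y'(1)] by simp
  moreover have "(\<lambda>x. (restrict x A, restrict x B)) -` (X' \<times> Y') \<inter> space (PiM I M) = X \<inter> Y"
    using XY by auto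
  ultimately show ?thesis by (simp only: XY(1)[symmetric] XY(2)[symmetric])
qed

section \<open>Approximation in probability by finite-dimensional events\<close>

definition finitely_approximable :: "('i \<Rightarrow> 'a) set \<Rightarrow> bool" where
  "finitely_approximable B \<longleftrightarrow> (\<forall>\<epsilon>>0. \<exists>J B'. finite J \<and> J \<subseteq> I \<and> B' \<in> sets (PiM I M) \<and>
     depends_on J (space (PiM I M)) B' \<and> P.prob ((B - B') \<union> (B' - B)) < \<epsilon>)"

lemma finitely_approximable_compl:
  assumes "finitely_approximable B" and B: "B \<in> sets (PiM I M)"
  shows "finitely_approximable (space (PiM I M) - B)"
  unfolding finitely_approximable_def
proof (intro allI impI)
  fix \<epsilon> :: real assume "\<epsilon> > 0"
  then obtain J B' where J: "finite J" "J \<subseteq> I" "B' \<in> sets (PiM I M)"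
    "depends_on J (space (PiM I M)) B'" "P.prob ((B - B') \<union> (B' - B)) < \<epsilon>"
    using assms(1) unfolding finitely_approximable_def by metis
  have sub: "B \<subseteq> space (PiM I M)" "B' \<subseteq> space (PiM I M)"
    by (rule sets.sets_into_space[OF B], rule sets.sets_into_space[OF J(3)])
  have "(space (PiM I M) - B - (space (PiM I M) - B')) \<union> (space (PiM I M) - B' - (space (PiM I M) - B))
     = (B - B') \<union> (B' - B)"
    using sub by blast
  moreover have "depends_on J (space (PiM I M)) (space (PiM I M) - B')"
    using J(4) by (rule depends_on_Diff)
  ultimately show "\<exists>J B'. finite J \<and> J \<subseteq> I \<and> B' \<in> sets (PiM I M) \<and>
     depends_on J (space (PiM I M)) B' \<and> P.prob ((space (PiM I M) - B - B') \<union> (B' - (space (PiM I M) - B))) < \<epsilon>"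
    using J by (intro exI[of _ J] exI[of _ "space (PiM I M) - B'"] conjI) simp_all
qed

lemma finitely_approximable_UN:
  assumes ap: "\<And>n::nat. finitely_approximable (B n)" and B: "\<And>n. B n \<in> sets (PiM I M)"
  shows "finitely_approximable (\<Union>n. B n)"
  unfolding finitely_approximable_def
proof (intro allI impI)
  fix \<epsilon> :: real assume eps: "\<epsilon> > 0"
  let ?U = "\<Union>n. B n"
  define U where "U n = (\<Union>i<n. B i)" for n
  have Um: "U n \<in> sets (PiM I M)" for n
    unfolding U_def using B by auto
  have Us: "?U \<in> sets (PiM I M)"
    using B by auto
  have "(\<lambda>n. P.prob (U n)) \<longlonglongrightarrow> P.prob (\<Union>n. U n)"
    by (rule P.finite_Lim_measure_incseq) (use Um in \<open>auto simp: incseq_def U_def intro: less_le_trans\<close>)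
  moreover have "(\<Union>n. U n) = ?U"
    unfolding U_def by auto
  ultimately have "\<forall>\<^sub>F n in sequentially. P.prob (U n) > P.prob ?U - \<epsilon> / 2"
    using eps by (intro order_tendstoD(1)[of _ "P.prob ?U"]) auto
  then obtain n where n: "P.prob (U n) > P.prob ?U - \<epsilon> / 2"
    by (auto simp: eventually_sequentially)
  \<comment> \<open>Half of \<epsilon> pays for the tail of the union, the other half for
    \<open>n\<close> approximations of cost \<open>d\<close>; the \<open>+ 1\<close> covers
    \<open>n = 0\<close>.\<close>
  define d where "d = \<epsilon> / (2 * (real n + 1))"
  have d: "d > 0" using eps by (simp add: d_def)
  have "\<forall>i. \<exists>J B'. finite J \<and> J \<subseteq> I \<and> B' \<in> sets (PiM I M) \<and>
     depends_on J (space (PiM I M)) B' \<and> P.prob ((B i - B') \<union> (B' - B i)) < d"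
    using ap d unfolding finitely_approximable_def by blast
  then obtain J B' where J: "\<And>i. finite (J i)" "\<And>i. J i \<subseteq> I" "\<And>i. B' i \<in> sets (PiM I M)"
     "\<And>i. depends_on (J i) (space (PiM I M)) (B' i)" "\<And>i. P.prob ((B i - B' i) \<union> (B' i - B i)) < d"
    by metis
  let ?J = "\<Union>i<n. J i" and ?B = "\<Union>i<n. B' i"
  have "P.prob ((?U - ?B) \<union> (?B - ?U)) \<le> P.prob ((?U - U n) \<union> (\<Union>i<n. (B i - B' i) \<union> (B' i - B i)))"
    by (rule P.finite_measure_mono) (use B J Um in \<open>auto simp: U_def\<close>)
  also have "\<dots> \<le> P.prob (?U - U n) + P.prob (\<Union>i<n. (B i - B' i) \<union> (B' i - B i))"
    by (rule measure_Un_le) (use B J Um in auto)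
  also have "P.prob (?U - U n) = P.prob ?U - P.prob (U n)"
    by (rule P.finite_measure_Diff) (use Us Um in \<open>auto simp: U_def\<close>)
  also have "P.prob (\<Union>i<n. (B i - B' i) \<union> (B' i - B i)) \<le> (\<Sum>i<n. P.prob ((B i - B' i) \<union> (B' i - B i)))"
    by (rule P.finite_measure_subadditive_finite) (use B J in auto)
  also have "\<dots> \<le> (\<Sum>i<n. d)"
    by (rule sum_mono) (use J(5) less_imp_le in blast)
  also have "\<dots> \<le> \<epsilon> / 2"
    using eps by (simp add: d_def field_simps)
  finally have "P.prob ((?U - ?B) \<union> (?B - ?U)) < \<epsilon>"
    using n by simp
  moreover have "depends_on ?J (space (PiM I M)) ?B"
    by (rule depends_on_UN, rule depends_on_mono[OF J(4)]) auto
  moreover have "finite ?J" "?J \<subseteq> I" "?B \<in> sets (PiM I M)"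
    using J by auto
  ultimately show "\<exists>J B'. finite J \<and> J \<subseteq> I \<and> B' \<in> sets (PiM I M) \<and>
     depends_on J (space (PiM I M)) B' \<and> P.prob ((?U - B') \<union> (B' - ?U)) < \<epsilon>"
    by blast
qed

lemma finitely_approximable_self:
  assumes "finite J" "J \<subseteq> I" "B \<in> sets (PiM I M)" "depends_on J (space (PiM I M)) B"
  shows "finitely_approximable B"
  unfolding finitely_approximable_def using assms
  by (auto intro!: exI[of _ J] exI[of _ B])

text \<open>The approximable events contain the one-coordinate generators and are closed under
  complements and countable unions. Membership in the sigma-algebra is carried through the induction
  because both closure steps need measurable events.\<close>

lemma finitely_approximable:
  assumes "B \<in> sets (PiM I M)"
  shows "finitely_approximable B"
proof -
  let ?G = "{{f \<in> (\<Pi>\<^sub>E i\<in>I. space (M i)). f i \<in> A} | i A. i \<in> I \<and> A \<in> sets (M i)}"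
  have eq: "sets (PiM I M) = sigma_sets (\<Pi>\<^sub>E i\<in>I. space (M i)) ?G"
    by (rule sets_PiM_single)
  have "B \<in> sigma_sets (\<Pi>\<^sub>E i\<in>I. space (M i)) ?G"
    using assms eq by simp
  then have "B \<in> sigma_sets (\<Pi>\<^sub>E i\<in>I. space (M i)) ?G \<and> finitely_approximable B"
  proof (induction rule: sigma_sets.induct)
    case (Basic a)
    then obtain i A where a: "a = {f \<in> (\<Pi>\<^sub>E i\<in>I. space (M i)). f i \<in> A}" "i \<in> I" "A \<in> sets (M i)"
      by auto
    have "a \<in> sets (PiM I M)"
      using Basic eq by (simp add: sigma_sets.Basic)
    moreover have "depends_on {i} (space (PiM I M)) a"
      unfolding depends_on_def a(1) by (auto simp: space_PiM)
    ultimately show ?case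
      using Basic a(2) by (auto intro!: finitely_approximable_self[of "{i}"] sigma_sets.Basic)
  next
    case Empty
    show ?case
      by (auto intro!: finitely_approximable_self[of "{}"] sigma_sets.Empty simp: depends_on_def)
  next
    case (Compl a)
    then show ?case
      using finitely_approximable_compl[of a] eq by (auto simp: space_PiM intro: sigma_sets.Compl)
  next
    case (Union a)
    then show ?case
      using finitely_approximable_UN[of a] eq by (auto intro: sigma_sets.Union)
  qed
  then show ?thesis by simp
qed

end

section \<open>Gaussian random walks\<close>

lemma (in prob_space) normal_prob:
  assumes "distributed M lborel X (normal_density \<mu> \<sigma>)" "A \<in> sets borel"
  shows "prob {x \<in> space M. X x \<in> A} = measure (density lborel (normal_density \<mu> \<sigma>)) A"
proof -
  have X: "X \<in> borel_measurable M"
    using distributed_measurable[OF assms(1)] by simp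
  have "measure (density lborel (normal_density \<mu> \<sigma>)) A = measure (distr M lborel X) A"
    using distributed_distr_eq_density[OF assms(1)] by simp
  also have "\<dots> = prob (X -` A \<inter> space M)"
    using X assms(2) by (intro measure_distr) auto
  also have "X -` A \<inter> space M = {x \<in> space M. X x \<in> A}"
    by auto
  finally show ?thesis by simp
qed

text \<open>The density is positive everywhere, so a null half-line would be Lebesgue null, although
  it contains an interval of length 1.\<close>

lemma normal_lower_tail_pos:
  assumes "\<sigma> > 0"
  shows "measure (density lborel (normal_density \<mu> \<sigma>)) {..a} > 0"
proof -
  interpret prob_space "density lborel (normal_density \<mu> \<sigma>)"
    by (rule prob_space_normal_density) fact
  have "\<not> {..a} \<in> null_sets (density lborel (\<lambda>x. ennreal (normal_density \<mu> \<sigma> x)))"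
  proof
    assume "{..a} \<in> null_sets (density lborel (\<lambda>x. ennreal (normal_density \<mu> \<sigma> x)))"
    then have "AE x\<in>{..a} in lborel. ennreal (normal_density \<mu> \<sigma> x) = 0"
      by (subst (asm) null_sets_density_iff) auto
    then have "AE x in lborel. x \<notin> {..a}"
    proof eventually_elim
      case (elim x)
      then show ?case
        using normal_density_pos[OF assms, of \<mu> x] by (auto simp: ennreal_eq_0_iff)
    qed
    then have "emeasure lborel {..a} = 0"
      by (subst (asm) AE_iff_measurable[of "{..a}"]) auto
    moreover have "emeasure lborel {a - 1..a} \<le> emeasure lborel {..a}"
      by (rule emeasure_mono) auto
    ultimately show False by simp
  qed
  then show ?thesis
    by (simp add: null_sets_def emeasure_eq_measure measure_nonneg less_le)
qed

text \<open>\<open>X\<close> and \<open>- X\<close> have the same law, and the events that one or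
  the other is nonnegative cover the space.\<close>

lemma (in prob_space) normal_nonneg_prob:
  assumes X: "distributed M lborel X (normal_density 0 \<sigma>)" and "\<sigma> > 0"
  shows "prob {x \<in> space M. 0 \<le> X x} \<ge> 1 / 2"
proof -
  have [measurable]: "X \<in> borel_measurable M"
    using distributed_measurable[OF X] by simp
  have "distributed M lborel (\<lambda>x. - X x) (normal_density 0 \<sigma>)"
    using normal_density_affine[OF X \<open>\<sigma> > 0\<close>, of "-1" 0] by simp
  then have "prob {x \<in> space M. - X x \<in> {0..}} = prob {x \<in> space M. X x \<in> {0..}}"
    using normal_prob[OF X, of "{0..}"] normal_prob[of "\<lambda>x. - X x" 0 \<sigma> "{0..}"] by simp
  moreover have "1 = prob ({x \<in> space M. - X x \<in> {0..}} \<union> {x \<in> space M. X x \<in> {0..}})"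
    by (subst prob_space[symmetric], rule arg_cong[where f=prob]) auto
  moreover have "\<dots> \<le> prob {x \<in> space M. - X x \<in> {0..}} + prob {x \<in> space M. X x \<in> {0..}}"
    by (rule measure_Un_le) auto
  ultimately show ?thesis by simp
qed

lemma (in prob_space) normal_tail_bound:
  assumes X: "distributed M lborel X (normal_density 0 \<sigma>)" and "\<sigma> > 0" "c > 0"
  shows "prob {x \<in> space M. c \<le> \<bar>X x\<bar>} \<le> \<sigma>\<^sup>2 / c\<^sup>2"
proof -
  have [measurable]: "X \<in> borel_measurable M"
    using distributed_measurable[OF X] by simp
  have "integrable M (\<lambda>x. (X x)\<^sup>2)"
    using distributed_integrable[OF X, of "\<lambda>x. x\<^sup>2"] integrable_normal_moment[OF \<open>\<sigma> > 0\<close>, of 0 2] by simp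
  then have "prob {x \<in> space M. c \<le> \<bar>X x - expectation X\<bar>} \<le> variance X / c\<^sup>2"
    using \<open>c > 0\<close> by (intro Chebyshev_inequality) auto
  then show ?thesis
    using normal_distributed_variance[OF \<open>\<sigma> > 0\<close> X] normal_distributed_expectation[OF \<open>\<sigma> > 0\<close> X] by simp
qed

section \<open>Independent Gaussian noises indexed by replication and arm\<close>

definition noise_law :: "('a \<Rightarrow> real) \<Rightarrow> nat \<times> 'a \<Rightarrow> real measure" where
  "noise_law v i = density lborel (normal_density 0 (sqrt (v (snd i))))"

definition walk :: "(nat \<times> 'a \<Rightarrow> real) \<Rightarrow> 'a \<Rightarrow> nat \<Rightarrow> real" where
  "walk x a n = (\<Sum>j<n. x (j, a))"

text \<open>The variance is positive on the whole type so that every \<open>noise_law v i\<close> is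
  a probability measure, as the product locale demands of all indices.\<close>

locale gaussian_arms =
  fixes L :: "'a set" and v :: "'a \<Rightarrow> real"
  assumes finite_L: "finite L" and L_nonempty: "L \<noteq> {}" and v_pos: "v a > 0"

sublocale gaussian_arms \<subseteq> product_prob_space "noise_law v" "UNIV \<times> L"
proof -
  have "prob_space (noise_law v i)" for i
    unfolding noise_law_def by (rule prob_space_normal_density) (simp add: v_pos)
  then show "product_prob_space (noise_law v)"
    by (rule product_prob_spaceI)
qed

context gaussian_arms
begin

abbreviation Q where "Q \<equiv> PiM (UNIV \<times> L) (noise_law v)"

lemma index_nonempty: "UNIV \<times> L \<noteq> {}"
  using L_nonempty by auto

lemma sets_noise_law [simp, measurable_cong]: "sets (noise_law v i) = sets borel"
  by (simp add: noise_law_def)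

lemma space_noise_law [simp]: "space (noise_law v i) = UNIV"
  by (simp add: noise_law_def)

lemma measurable_coordinate: "a \<in> L \<Longrightarrow> (\<lambda>x. x (j, a)) \<in> borel_measurable Q"
  using measurable_component_singleton[of "(j, a)" "UNIV \<times> L" "noise_law v"]
  by (simp cong: measurable_cong_sets)

lemma measurable_walk [measurable]: "a \<in> L \<Longrightarrow> (\<lambda>x. walk x a n) \<in> borel_measurable Q"
  unfolding walk_def by (intro borel_measurable_sum measurable_coordinate)

lemma distributed_coordinate:
  assumes "i \<in> UNIV \<times> L"
  shows "distributed Q lborel (\<lambda>x. x i) (normal_density 0 (sqrt (v (snd i))))"
  unfolding distributed_def
proof (intro conjI)
  have "distr Q lborel (\<lambda>x. x i) = distr Q (noise_law v i) (\<lambda>x. x i)"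
    by (rule distr_cong) simp_all
  also have "\<dots> = noise_law v i"
    using assms by (rule PiM_component)
  finally show "distr Q lborel (\<lambda>x. x i) = density lborel (\<lambda>x. ennreal (normal_density 0 (sqrt (v (snd i))) x))"
    by (simp add: noise_law_def)
  show "(\<lambda>x. x i) \<in> measurable Q lborel"
    using assms measurable_coordinate by (cases i) auto
qed simp

lemma distributed_block:
  assumes "a \<in> L" "m < n"
  shows "distributed Q lborel (\<lambda>x. \<Sum>j\<in>{m..<n}. x (j, a)) (normal_density 0 (sqrt (real (n - m) * v a)))"
proof -
  let ?J = "{m..<n} \<times> {a}"
  have J: "?J \<subseteq> UNIV \<times> L" using assms by auto
  have "P.indep_vars (\<lambda>_. borel) (\<lambda>i x. x i) (UNIV \<times> L)"
    using P.indep_vars_compose2[OF indep_vars_coordinates[OF index_nonempty], of "\<lambda>_ x. x" "\<lambda>_. borel"]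
    by (simp add: measurable_ident_sets)
  then have "P.indep_vars (\<lambda>_. borel) (\<lambda>i x. x i) ?J"
    by (rule P.indep_vars_subset[OF _ J])
  then have "distributed Q lborel (\<lambda>x. \<Sum>i\<in>?J. x i)
      (normal_density (\<Sum>i\<in>?J. 0) (sqrt (\<Sum>i\<in>?J. (sqrt (v (snd i)))\<^sup>2)))"
    using assms J v_pos by (intro P.sum_indep_normal distributed_coordinate) auto
  moreover have "(\<Sum>i\<in>?J. f i) = (\<Sum>j\<in>{m..<n}. f (j, a))" for f :: "nat \<times> 'a \<Rightarrow> real"
    by (rule sum.reindex_bij_witness[of _ "\<lambda>j. (j, a)" fst]) auto
  ultimately show ?thesis
    using v_pos[of a] by (simp add: less_imp_le)
qed

lemma block_eq: "m \<le> n \<Longrightarrow> (\<Sum>j\<in>{m..<n}. x (j, a)) = walk x a n - walk x a m"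
  unfolding walk_def lessThan_atLeast0 by (simp add: sum_diff_nat_ivl)

text \<open>
  Levy's inequality: after the first passage above \<open>c\<close> the remaining increment is independent of
  the past and nonnegative with probability at least \<open>1/2\<close>.
\<close>

lemma Levy_one_sided:
  assumes a: "a \<in> L" and s: "s = 1 \<or> s = - 1"
  shows "P.prob {x \<in> space Q. \<exists>r\<le>N. c < s * walk x a r} \<le> 2 * P.prob {x \<in> space Q. c < s * walk x a N}"
proof -
  define T where "T r = {x \<in> space Q. c < s * walk x a r \<and> (\<forall>q<r. s * walk x a q \<le> c)}" for r
  define D where "D r = {x \<in> space Q. 0 \<le> s * (walk x a N - walk x a r)}" for r
  have Tm: "T r \<in> sets Q" for r
    unfolding T_def using a by measurable
  have Dm: "D r \<in> sets Q" for r
    unfolding D_def using a by measurable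
  have half: "P.prob (T r) \<le> 2 * P.prob (T r \<inter> D r)" if r: "r \<le> N" for r
  \<comment> \<open>For \<open>r = N\<close> the increment is identically zero and has no normal
    density; \<open>D r\<close> is then the whole space.\<close>
  proof (cases "r = N")
    case True
    then have "D r = space Q" by (auto simp: D_def)
    then have "T r \<inter> D r = T r" using sets.sets_into_space[OF Tm] by auto
    then show ?thesis by simp
  next
    case False
    with r have "r < N" by simp
    have X: "distributed Q lborel (\<lambda>x. \<Sum>j\<in>{r..<N}. x (j, a)) (normal_density 0 (sqrt (real (N - r) * v a)))"
      by (rule distributed_block) fact+
    have sp: "sqrt (real (N - r) * v a) > 0"
      using \<open>r < N\<close> v_pos by simp
    have "distributed Q lborel (\<lambda>x. s * (\<Sum>j\<in>{r..<N}. x (j, a))) (normal_density 0 (sqrt (real (N - r) * v a)))"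
      using s P.normal_density_affine[OF X sp, of s 0] by auto
    from P.normal_nonneg_prob[OF this sp]
    have "P.prob (D r) \<ge> 1 / 2"
      using \<open>r < N\<close> by (simp add: D_def block_eq)
    moreover have "P.prob (T r \<inter> D r) = P.prob (T r) * P.prob (D r)"
    proof (rule measure_Int_disjoint_coordinates[OF Tm _ Dm])
      show "depends_on ({..<r} \<times> {a}) (space Q) (T r)"
        unfolding T_def
      proof (rule depends_on_Collect)
        fix x y :: "nat \<times> 'a \<Rightarrow> real" assume "\<And>i. i \<in> {..<r} \<times> {a} \<Longrightarrow> x i = y i"
        then have "walk x a q = walk y a q" if "q \<le> r" for q
          using that unfolding walk_def by (intro sum.cong) auto
        then show "c < s * walk x a r \<and> (\<forall>q<r. s * walk x a q \<le> c) \<Longrightarrow>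
          c < s * walk y a r \<and> (\<forall>q<r. s * walk y a q \<le> c)" by simp
      qed
      show "depends_on ({r..<N} \<times> {a}) (space Q) (D r)"
        unfolding D_def block_eq[OF r, symmetric]
      proof (rule depends_on_Collect)
        fix x y :: "nat \<times> 'a \<Rightarrow> real" assume "\<And>i. i \<in> {r..<N} \<times> {a} \<Longrightarrow> x i = y i"
        then have "(\<Sum>j\<in>{r..<N}. x (j, a)) = (\<Sum>j\<in>{r..<N}. y (j, a))"
          by (intro sum.cong) auto
        then show "0 \<le> s * (\<Sum>j\<in>{r..<N}. x (j, a)) \<Longrightarrow> 0 \<le> s * (\<Sum>j\<in>{r..<N}. y (j, a))" by simp
      qed
    qed (use a index_nonempty in auto)
    moreover have "P.prob (T r) * (1 / 2) \<le> P.prob (T r) * P.prob (D r)"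
      by (rule mult_left_mono) (use calculation(1) in auto)
    ultimately show ?thesis by simp
  qed
  have disj: "disjoint_family_on T {..N}"
  proof -
    have "T r \<inter> T q = {}" if "r < q" for r q
      using that by (force simp: T_def)
    then show ?thesis
      unfolding disjoint_family_on_def by (metis Int_commute nat_neq_iff)
  qed
  have "{x \<in> space Q. \<exists>r\<le>N. c < s * walk x a r} = (\<Union>r\<in>{..N}. T r)"
  proof (intro equalityI subsetI)
    fix x assume "x \<in> {x \<in> space Q. \<exists>r\<le>N. c < s * walk x a r}"
    then obtain r where x: "x \<in> space Q" and r: "r \<le> N" "c < s * walk x a r" by auto
    define q where "q = (LEAST r. c < s * walk x a r)"
    have "c < s * walk x a q"
      unfolding q_def by (rule LeastI) (rule r)
    moreover have "q \<le> r"
      unfolding q_def by (rule Least_le) (rule r)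
    moreover have "s * walk x a p \<le> c" if "p < q" for p
      using not_less_Least[OF that[unfolded q_def]] by simp
    ultimately show "x \<in> (\<Union>r\<in>{..N}. T r)"
      using x r(1) by (auto simp: T_def intro!: bexI[of _ q])
  qed (auto simp: T_def)
  then have "P.prob {x \<in> space Q. \<exists>r\<le>N. c < s * walk x a r} = (\<Sum>r\<in>{..N}. P.prob (T r))"
    using P.finite_measure_finite_Union[of "{..N}" T] Tm disj by auto
  also have "\<dots> \<le> (\<Sum>r\<in>{..N}. 2 * P.prob (T r \<inter> D r))"
    by (rule sum_mono) (rule half, simp)
  also have "\<dots> = 2 * P.prob (\<Union>r\<in>{..N}. T r \<inter> D r)"
  proof -
    have "disjoint_family_on (\<lambda>r. T r \<inter> D r) {..N}"
      using disj by (rule disjoint_family_on_bisimulation) auto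
    then show ?thesis
      using P.finite_measure_finite_Union[of "{..N}" "\<lambda>r. T r \<inter> D r"] Tm Dm
      by (simp add: sum_distrib_left image_subset_iff sets.Int)
  qed
  \<comment> \<open>A nonnegative increment after the passage keeps the walk above \<open>c\<close>
    at time \<open>N\<close>.\<close>
  also have "P.prob (\<Union>r\<in>{..N}. T r \<inter> D r) \<le> P.prob {x \<in> space Q. c < s * walk x a N}"
  proof (rule P.finite_measure_mono)
    show "(\<Union>r\<in>{..N}. T r \<inter> D r) \<subseteq> {x \<in> space Q. c < s * walk x a N}"
      by (auto simp: T_def D_def right_diff_distrib)
    show "{x \<in> space Q. c < s * walk x a N} \<in> sets Q"
      using a by measurable
  qed
  finally show ?thesis by simp
qed

section \<open>Maximal inequality, excursion bound and strong law\<close>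

lemma maximal_inequality:
  assumes a: "a \<in> L" and c: "c > 0"
  shows "P.prob {x \<in> space Q. \<exists>r\<le>N. c < \<bar>walk x a r\<bar>} \<le> 4 * real N * v a / c\<^sup>2"
proof (cases "N = 0")
  case True
  then show ?thesis using c by (simp add: walk_def)
next
  case False
  let ?U = "\<lambda>s. {x \<in> space Q. \<exists>r\<le>N. c < s * walk x a r}"
  have "distributed Q lborel (\<lambda>x. walk x a N) (normal_density 0 (sqrt (real N * v a)))"
    using distributed_block[OF a, of 0 N] False by (simp add: walk_def atLeast0LessThan)
  from P.normal_tail_bound[OF this _ c]
  have tail: "P.prob {x \<in> space Q. c \<le> \<bar>walk x a N\<bar>} \<le> real N * v a / c\<^sup>2"
    using False v_pos[of a] by simp
  have one: "P.prob (?U s) \<le> 2 * (real N * v a / c\<^sup>2)" if s: "s = 1 \<or> s = - 1" for s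
  proof -
    have "P.prob {x \<in> space Q. c < s * walk x a N} \<le> P.prob {x \<in> space Q. c \<le> \<bar>walk x a N\<bar>}"
      by (rule P.finite_measure_mono) (use s a in auto)
    then show ?thesis
      using Levy_one_sided[OF a s, where c=c and N=N] tail by linarith
  qed
  have m: "?U s \<in> sets Q" for s
    using a by measurable
  have "P.prob {x \<in> space Q. \<exists>r\<le>N. c < \<bar>walk x a r\<bar>} \<le> P.prob (?U 1 \<union> ?U (- 1))"
  proof (rule P.finite_measure_mono)
    show "?U 1 \<union> ?U (- 1) \<in> sets Q"
      by (rule sets.Un[OF m m])
    show "{x \<in> space Q. \<exists>r\<le>N. c < \<bar>walk x a r\<bar>} \<subseteq> ?U 1 \<union> ?U (- 1)"
    proof
      fix x assume "x \<in> {x \<in> space Q. \<exists>r\<le>N. c < \<bar>walk x a r\<bar>}"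
      then obtain r where "x \<in> space Q" "r \<le> N" "c < walk x a r \<or> c < - walk x a r"
        by (auto simp: abs_if split: if_splits)
      then show "x \<in> ?U 1 \<union> ?U (- 1)" by auto
    qed
  qed
  also have "\<dots> \<le> P.prob (?U 1) + P.prob (?U (- 1))"
    by (rule measure_Un_le[OF m m])
  \<comment> \<open>The factor 4 is 2 from Levy's inequality times 2 for the two signs.\<close>
  also have "\<dots> \<le> 2 * (real N * v a / c\<^sup>2) + 2 * (real N * v a / c\<^sup>2)"
    by (rule add_mono; rule one) simp_all
  finally show ?thesis by (simp add: algebra_simps)
qed

lemma sets_walk_excursion:
  "a \<in> L \<Longrightarrow> {x \<in> space Q. \<exists>r\<ge>\<nu>. C * real r / sqrt (real \<nu>) < \<bar>walk x a r\<bar>} \<in> sets Q"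
  by measurable

text \<open>Peeling over dyadic ranges: for \<open>r\<close> between \<open>2 ^ i * \<nu>\<close>
  and \<open>2 ^ Suc i * \<nu>\<close> the boundary is at least \<open>c i\<close>, and the maximal
  inequality gives the bound \<open>8 * v a / C\<^sup>2\<close> times \<open>(1 / 2) ^ i\<close>;
  the geometric series doubles the 8. The result does not involve \<nu>, as the starvation argument
  requires.\<close>

lemma walk_excursion_prob:
  assumes a: "a \<in> L" and C: "C > 0" and \<nu>: "\<nu> > 0"
  shows "P.prob {x \<in> space Q. \<exists>r\<ge>\<nu>. C * real r / sqrt (real \<nu>) < \<bar>walk x a r\<bar>} \<le> 16 * v a / C\<^sup>2"
proof -
  define c where "c i = C * 2 ^ i * sqrt (real \<nu>)" for i :: nat
  define A where "A i = {x \<in> space Q. \<exists>r\<le>2 ^ Suc i * \<nu>. c i < \<bar>walk x a r\<bar>}" for i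
  have Am: "A i \<in> sets Q" for i
    unfolding A_def using a by measurable
  have cpos: "c i > 0" for i
    using C \<nu> by (simp add: c_def)
  have "P.prob (A i) \<le> 4 * real (2 ^ Suc i * \<nu>) * v a / (c i)\<^sup>2" for i
    unfolding A_def by (rule maximal_inequality[OF a cpos])
  also have "4 * real (2 ^ Suc i * \<nu>) * v a / (c i)\<^sup>2 = (8 * v a / C\<^sup>2) * (1 / 2) ^ i" for i
    using C \<nu> by (simp add: c_def power_mult_distrib field_simps power2_eq_square)
  finally have PA: "P.prob (A i) \<le> (8 * v a / C\<^sup>2) * (1 / 2) ^ i" for i .
  have sm: "summable (\<lambda>i. (8 * v a / C\<^sup>2) * (1 / 2) ^ i)"
    by (intro summable_mult summable_geometric) simp
  have sA: "summable (\<lambda>i. P.prob (A i))"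
    by (rule summable_comparison_test'[OF sm, of 0]) (use PA in auto)
  have "{x \<in> space Q. \<exists>r\<ge>\<nu>. C * real r / sqrt (real \<nu>) < \<bar>walk x a r\<bar>} \<subseteq> (\<Union>i. A i)"
  proof
    fix x assume "x \<in> {x \<in> space Q. \<exists>r\<ge>\<nu>. C * real r / sqrt (real \<nu>) < \<bar>walk x a r\<bar>}"
    then obtain r where x: "x \<in> space Q" and r: "r \<ge> \<nu>" "C * real r / sqrt (real \<nu>) < \<bar>walk x a r\<bar>"
      by auto
    define i where "i = (LEAST i. r \<le> 2 ^ Suc i * \<nu>)"
    have "r \<le> 2 ^ Suc r * \<nu>"
      using mult_le_mono[of r "2 ^ Suc r" 1 \<nu>] \<nu> less_exp[of r] by simp
    then have i: "r \<le> 2 ^ Suc i * \<nu>"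
      unfolding i_def by (rule LeastI)
    have lo: "2 ^ i * \<nu> \<le> r"
    proof (cases i)
      case 0 then show ?thesis using r by simp
    next
      case (Suc k)
      then have "\<not> r \<le> 2 ^ Suc k * \<nu>"
        using not_less_Least[of k "\<lambda>i. r \<le> 2 ^ Suc i * \<nu>"] by (simp add: i_def)
      then show ?thesis using Suc by simp
    qed
    have "c i = C * real (2 ^ i * \<nu>) / sqrt (real \<nu>)"
      using \<nu> by (simp add: c_def field_simps)
    also have "\<dots> \<le> C * real r / sqrt (real \<nu>)"
      using lo C by (intro divide_right_mono mult_left_mono) (simp_all only: of_nat_le_iff, simp_all)
    also have "\<dots> < \<bar>walk x a r\<bar>" by fact
    finally have "x \<in> A i" using x i by (auto simp: A_def)
    then show "x \<in> (\<Union>i. A i)" by blast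
  qed
  then have "P.prob {x \<in> space Q. \<exists>r\<ge>\<nu>. C * real r / sqrt (real \<nu>) < \<bar>walk x a r\<bar>} \<le> P.prob (\<Union>i. A i)"
    using Am by (intro P.finite_measure_mono) auto
  also have "\<dots> \<le> (\<Sum>i. P.prob (A i))"
    using Am sA by (intro P.finite_measure_subadditive_countably) auto
  also have "\<dots> \<le> (\<Sum>i. (8 * v a / C\<^sup>2) * (1 / 2) ^ i)"
    by (rule suminf_le[OF PA sA sm])
  also have "\<dots> = 16 * v a / C\<^sup>2"
    by (subst suminf_mult) (auto simp: suminf_geometric intro!: summable_geometric)
  finally show ?thesis .
qed

text \<open>With \<open>C = d * sqrt \<nu>\<close> the boundary of the excursion bound becomes the
  line \<open>d * r\<close>, and the probability of crossing it after \<nu> is of order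
  \<open>1 / \<nu>\<close>.\<close>

lemma AE_walk_le:
  assumes a: "a \<in> L" and d: "d > 0"
  shows "AE x in Q. \<exists>\<nu>. \<forall>r\<ge>\<nu>. \<bar>walk x a r\<bar> \<le> d * real r"
proof -
  define E where "E \<nu> = {x \<in> space Q. \<exists>r\<ge>\<nu>. d * real r < \<bar>walk x a r\<bar>}" for \<nu>
  have Em: "E \<nu> \<in> sets Q" for \<nu>
    unfolding E_def using a by measurable
  have PE: "P.prob (E \<nu>) \<le> (16 * v a / d\<^sup>2) / real \<nu>" if "\<nu> > 0" for \<nu>
    using walk_excursion_prob[OF a, of "d * sqrt (real \<nu>)" \<nu>] that d
    by (simp add: E_def power_mult_distrib)
  have le: "P.prob (\<Inter>\<nu>. E \<nu>) \<le> (16 * v a / d\<^sup>2) / real \<nu>" if "\<nu> > 0" for \<nu>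
    using P.finite_measure_mono[of "\<Inter>\<nu>. E \<nu>" "E \<nu>"] Em PE[OF that] by fastforce
  have "P.prob (\<Inter>\<nu>. E \<nu>) \<le> 0"
  proof (rule LIMSEQ_le_const)
    show "(\<lambda>\<nu>. (16 * v a / d\<^sup>2) / real \<nu>) \<longlonglongrightarrow> 0"
      by (rule lim_const_over_n)
    show "\<exists>N. \<forall>n\<ge>N. P.prob (\<Inter>\<nu>. E \<nu>) \<le> 16 * v a / d\<^sup>2 / real n"
      using le by (intro exI[of _ 1]) auto
  qed
  then have "(\<Inter>\<nu>. E \<nu>) \<in> null_sets Q"
    using Em by (auto simp: null_sets_def P.emeasure_eq_measure measure_le_0_iff)
  then have "AE x in Q. x \<notin> (\<Inter>\<nu>. E \<nu>)"
    by (rule AE_not_in)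
  then show ?thesis
    using AE_space by eventually_elim (auto simp: E_def not_less)
qed

theorem strong_law:
  assumes a: "a \<in> L"
  shows "AE x in Q. (\<lambda>n. walk x a n / real n) \<longlonglongrightarrow> 0"
proof -
  have "AE x in Q. \<forall>m. \<exists>\<nu>. \<forall>r\<ge>\<nu>. \<bar>walk x a r\<bar> \<le> (1 / real (Suc m)) * real r"
    by (subst AE_all_countable, intro allI AE_walk_le[OF a]) simp
  then show ?thesis
  proof eventually_elim
    case (elim x)
    show ?case
    proof (rule LIMSEQ_I)
      fix e :: real assume "e > 0"
      then obtain m where m: "1 / real (Suc m) < e"
        using nat_approx_posE by blast
      obtain \<nu> where \<nu>: "\<And>r. r \<ge> \<nu> \<Longrightarrow> \<bar>walk x a r\<bar> \<le> (1 / real (Suc m)) * real r"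
        using elim by blast
      have "norm (walk x a n / real n - 0) < e" if "n \<ge> max 1 \<nu>" for n
      proof -
        have "\<bar>walk x a n\<bar> / real n \<le> 1 / real (Suc m)"
          using \<nu>[of n] that by (simp add: field_simps)
        then show ?thesis using m by simp
      qed
      then show "\<exists>no. \<forall>n\<ge>no. norm (walk x a n / real n - 0) < e" by blast
    qed
  qed
qed

end

section \<open>Adaptive sampling of tied arms\<close>

text \<open>
  All arms in \<open>I\<close> are sampled infinitely often, but from time \<open>n1\<close> on an arm of \<open>I\<close> is sampled only
  while its noise average is at most \<open>G / sqrt \<nu>\<close> below that of every other arm of \<open>I\<close>, \<open>\<nu>\<close> being any
  lower bound on the sample counts. This is how the policy would have to behave among tied
  alternatives if another pair were starved.
\<close>

definition competitive :: "((nat \<times> 'a \<Rightarrow> real) \<Rightarrow> nat \<Rightarrow> 'a \<Rightarrow> nat) \<Rightarrow> 'a set \<Rightarrow> real \<Rightarrow> nat \<Rightarrow> (nat \<times> 'a \<Rightarrow> real) \<Rightarrow> bool" where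
  "competitive cnt I G n1 x \<longleftrightarrow>
     (\<forall>a\<in>I. \<forall>m. \<exists>n. m \<le> cnt x n a) \<and>
     (\<forall>n\<ge>n1. \<forall>s\<in>I. cnt x (Suc n) s \<noteq> cnt x n s \<longrightarrow>
        (\<forall>k\<in>I. \<forall>\<nu>\<ge>1. (\<forall>i\<in>I. \<nu> \<le> cnt x n i) \<longrightarrow>
           walk x k (cnt x n k) / real (cnt x n k) - G / sqrt (real \<nu>)
             \<le> walk x s (cnt x n s) / real (cnt x n s)))"

lemma competitiveD:
  assumes "competitive cnt I G n1 x" "n1 \<le> n" "s \<in> I" "cnt x (Suc n) s \<noteq> cnt x n s"
    "k \<in> I" "1 \<le> \<nu>" "\<forall>i\<in>I. \<nu> \<le> cnt x n i"
  shows "walk x k (cnt x n k) / real (cnt x n k) - G / sqrt (real \<nu>)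
           \<le> walk x s (cnt x n s) / real (cnt x n s)"
  using assms unfolding competitive_def by blast

text \<open>\<open>nonanticipating\<close>: as long as \<open>a\<close> has at most \<nu> samples,
  its noises with index \<nu> or higher are unobserved (indices start at 0) and cannot influence any
  count. This is what makes a block of future noises independent of an allocation event.\<close>

locale adaptive_sampling = gaussian_arms L v for L :: "'a set" and v +
  fixes cnt :: "(nat \<times> 'a \<Rightarrow> real) \<Rightarrow> nat \<Rightarrow> 'a \<Rightarrow> nat"
  assumes cnt_0: "cnt x 0 a = 0"
    and cnt_Suc: "cnt x (Suc n) a = cnt x n a \<or> cnt x (Suc n) a = Suc (cnt x n a)"
    and measurable_cnt: "a \<in> L \<Longrightarrow> (\<lambda>x. cnt x n a) \<in> measurable Q (count_space UNIV)"
    and nonanticipating: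
      "\<lbrakk>a \<in> L; \<And>j b. b \<in> L \<Longrightarrow> b \<noteq> a \<or> j < \<nu> \<Longrightarrow> x (j, b) = y (j, b); x \<in> space Q; y \<in> space Q;
        cnt x n a \<le> \<nu>; b \<in> L\<rbrakk> \<Longrightarrow> cnt y n b = cnt x n b"
begin

lemma cnt_mono: "m \<le> n \<Longrightarrow> cnt x m a \<le> cnt x n a"
proof (rule lift_Suc_mono_le[of "\<lambda>n. cnt x n a"])
  show "cnt x k a \<le> cnt x (Suc k) a" for k
    using cnt_Suc[of x k a] by auto
qed

lemma cnt_le: "cnt x n a \<le> n"
proof (induction n)
  case (Suc n)
  then show ?case using cnt_Suc[of x n a] by auto
qed (simp add: cnt_0)

text \<open>Counts start at 0 and grow by unit steps, so every positive level is entered by a step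
  from exactly one below; that step is a moment at which \<open>a\<close> is sampled.\<close>

lemma cnt_passes:
  assumes "m \<le> cnt x n a" "m > 0"
  obtains n' where "n' < n" "cnt x n' a < m" "cnt x (Suc n') a = m" "cnt x n' a = m - 1"
proof -
  define q where "q = (LEAST n. m \<le> cnt x n a)"
  have q: "m \<le> cnt x q a"
    unfolding q_def by (rule LeastI) (rule assms)
  have qn: "q \<le> n"
    unfolding q_def by (rule Least_le) (rule assms)
  from q \<open>m > 0\<close> obtain n' where n': "q = Suc n'"
    by (cases q) (auto simp: cnt_0)
  have lt: "cnt x n' a < m"
    using not_less_Least[of n' "\<lambda>n. m \<le> cnt x n a"] n' by (simp add: q_def)
  then have "cnt x (Suc n') a = m"
    using q n' cnt_Suc[of x n' a] by auto
  moreover have "cnt x n' a = m - 1"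
    using lt calculation cnt_Suc[of x n' a] by auto
  moreover have "n' < n"
    using n' qn by simp
  ultimately show thesis
    using lt by (intro that[of n'])
qed

text \<open>
  If the average of \<open>s\<close> drops while \<open>s\<close> goes from \<open>\<nu>\<close> to \<open>2 * \<nu>\<close> samples and the average of \<open>k\<close> never
  leaves the order \<open>1 / sqrt \<nu>\<close> afterwards, then \<open>s\<close> is never sampled again.
\<close>

lemma falling_arm_starves:
  assumes comp: "competitive cnt I G n1 x"
    and sk: "s \<in> I" "k \<in> I" "s \<noteq> k" and \<nu>: "\<nu> \<ge> n1" "\<nu> \<ge> 1"
    and n: "cnt x n s = \<nu>" "\<forall>i\<in>I. \<nu> \<le> cnt x n i"
    and ws: "\<bar>walk x s \<nu>\<bar> \<le> C * sqrt (real \<nu>)"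
    and wk: "\<forall>r\<ge>\<nu>. \<bar>walk x k r\<bar> \<le> C * real r / sqrt (real \<nu>)"
    and fall: "walk x s (2 * \<nu>) - walk x s \<nu> \<le> - D * sqrt (real \<nu>)"
  shows "D \<le> 3 * C + 2 * G"
proof -
  \<comment> \<open>The arm is sampled again after \<open>2 * \<nu>\<close> samples; just before
    that step its average is taken over exactly \<open>2 * \<nu>\<close> noises, including the whole
    falling block.\<close>
  obtain m where "2 * \<nu> + 1 \<le> cnt x m s"
    using comp sk unfolding competitive_def by blast
  then obtain n' where n': "cnt x n' s < 2 * \<nu> + 1" "cnt x (Suc n') s = 2 * \<nu> + 1" "cnt x n' s = 2 * \<nu> + 1 - 1"
    by (rule cnt_passes) simp
  have nn: "n < n'"
  proof (rule ccontr)
    assume "\<not> n < n'"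
    then have "cnt x n' s \<le> cnt x n s" by (intro cnt_mono) simp
    then show False using n' n \<nu> by simp
  qed
  \<comment> \<open>A count never exceeds the time, so \<open>n\<close> is at least \<nu> and hence
    at least \<open>n1\<close>.\<close>
  have n1: "n1 \<le> n'" using cnt_le[of x n s] n \<nu> nn by simp
  have all: "\<forall>i\<in>I. \<nu> \<le> cnt x n' i"
  proof
    fix i assume "i \<in> I"
    then show "\<nu> \<le> cnt x n' i"
      using n(2) cnt_mono[of n n' x i] nn by fastforce
  qed
  have main: "walk x k (cnt x n' k) / real (cnt x n' k) - G / sqrt (real \<nu>)
      \<le> walk x s (2 * \<nu>) / real (2 * \<nu>)"
    using competitiveD[where cnt=cnt, OF comp n1 sk(1) _ sk(2) \<nu>(2) all] n' by simp
  define t where "t = sqrt (real \<nu>)"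
  have t: "t > 0" "real \<nu> = t * t"
    using \<nu> by (auto simp: t_def)
  define c where "c = real (cnt x n' k)"
  have c: "c > 0" using all sk \<nu> by (fastforce simp: c_def)
  have "\<bar>walk x k (cnt x n' k)\<bar> \<le> C * c / t"
    using wk all sk by (simp add: c_def t_def)
  then have "- (C * c / t) \<le> walk x k (cnt x n' k)" by simp
  then have lo: "- C / t \<le> walk x k (cnt x n' k) / c"
    using c t by (simp add: field_simps)
  \<comment> \<open>The average of \<open>s\<close> at \<open>2 * \<nu>\<close> is at most
    \<open>(C - D) / (2 * t)\<close>, that of \<open>k\<close> at least \<open>- C / t\<close>, and
    the tolerance is \<open>G / t\<close>; comparing them gives
    \<open>3 * C + 2 * G\<close>.\<close>
  have "walk x s (2 * \<nu>) \<le> (C - D) * t"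
    using fall ws by (simp add: t_def algebra_simps)
  then have "walk x s (2 * \<nu>) / real (2 * \<nu>) \<le> (C - D) * t / real (2 * \<nu>)"
    by (rule divide_right_mono) simp
  also have "\<dots> = (C - D) / (2 * t)"
    using t by (simp add: field_simps)
  finally have "- C / t - G / t \<le> (C - D) / (2 * t)"
    using main lo by (simp add: t_def c_def)
  then have "D * t \<le> (3 * C + 2 * G) * t"
    using t by (simp add: field_simps)
  then show ?thesis
    using t by simp
qed

text \<open>At the first time at which every arm of \<open>I\<close> has \<nu> samples, an arm that
  was still below the level one step earlier has exactly \<nu>.\<close>

lemma last_arm_at_level:
  assumes I: "finite I" "I \<noteq> {}" and unb: "\<forall>a\<in>I. \<exists>n. \<nu> \<le> cnt x n a" and "\<nu> \<ge> 1"
  obtains n s where "s \<in> I" "cnt x n s = \<nu>" "\<forall>i\<in>I. \<nu> \<le> cnt x n i"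
proof -
  obtain f where f: "\<And>a. a \<in> I \<Longrightarrow> \<nu> \<le> cnt x (f a) a"
    using unb by metis
  have ex: "\<forall>a\<in>I. \<nu> \<le> cnt x (Max (f ` I)) a"
  proof
    fix a assume a: "a \<in> I"
    then have "f a \<le> Max (f ` I)" using I by simp
    then show "\<nu> \<le> cnt x (Max (f ` I)) a"
      using f[OF a] cnt_mono[of "f a" "Max (f ` I)" x a] by simp
  qed
  define n where "n = (LEAST n. \<forall>a\<in>I. \<nu> \<le> cnt x n a)"
  have n: "\<forall>a\<in>I. \<nu> \<le> cnt x n a"
    unfolding n_def by (rule LeastI) (rule ex)
  with I \<open>\<nu> \<ge> 1\<close> obtain m where m: "n = Suc m"
    by (cases n) (fastforce simp: cnt_0)+
  then have "\<not> (\<forall>a\<in>I. \<nu> \<le> cnt x m a)"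
    using not_less_Least[of m "\<lambda>n. \<forall>a\<in>I. \<nu> \<le> cnt x n a"] by (simp add: n_def)
  then obtain s where s: "s \<in> I" "cnt x m s < \<nu>"
    by auto
  then have "cnt x n s = \<nu>"
    using n m cnt_Suc[of x m s] by fastforce
  with s n show thesis by (rule_tac that)
qed

section \<open>Measurability of the counts and of \<open>competitive\<close>\<close>

lemma measurable_walk_cnt:
  "a \<in> L \<Longrightarrow> (\<lambda>x. walk x a (cnt x n a)) \<in> borel_measurable Q"
  by (rule measurable_compose_countable[of "\<lambda>i x. walk x a i" _ _ "\<lambda>x. cnt x n a"])
    (auto intro: measurable_walk measurable_cnt)

lemma measurable_real_cnt: "a \<in> L \<Longrightarrow> (\<lambda>x. real (cnt x n a)) \<in> borel_measurable Q"
  by (rule measurable_compose[OF measurable_cnt]) simp_all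

lemma pred_cnt:
  assumes "a \<in> L" "b \<in> L"
  shows "Measurable.pred Q (\<lambda>x. R (cnt x n a) (cnt x m b))"
proof (rule measurable_compose_countable[where g="\<lambda>x. cnt x n a" and f="\<lambda>i x. R i (cnt x m b)"])
  show "Measurable.pred Q (\<lambda>x. R i (cnt x m b))" for i
    by (rule measurable_compose[OF measurable_cnt[OF assms(2)]]) simp
qed (rule measurable_cnt[OF assms(1)])

lemma sets_competitive:
  assumes "I \<subseteq> L"
  shows "{x \<in> space Q. competitive cnt I G n1 x} \<in> sets Q"
proof -
  have [measurable]: "finite I"
    using assms finite_L finite_subset by blast
  have [measurable]: "Measurable.pred Q (\<lambda>x. cnt x (Suc n) s \<noteq> cnt x n s)"
      "Measurable.pred Q (\<lambda>x. m \<le> cnt x n s)"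
      "Measurable.pred Q (\<lambda>x. walk x k (cnt x n k) / real (cnt x n k) - G / sqrt (real m)
             \<le> walk x s (cnt x n s) / real (cnt x n s))" if "s \<in> I" "k \<in> I" for s k n m
  proof -
    have sk: "s \<in> L" "k \<in> L" using that assms by auto
    show "Measurable.pred Q (\<lambda>x. cnt x (Suc n) s \<noteq> cnt x n s)"
      by (rule pred_cnt[OF sk(1) sk(1), where R="(\<noteq>)"])
    show "Measurable.pred Q (\<lambda>x. m \<le> cnt x n s)"
      by (rule pred_cnt[OF sk(1) sk(1), where R="\<lambda>i _. m \<le> i"])
    have "(\<lambda>x. walk x a (cnt x n a) / real (cnt x n a)) \<in> borel_measurable Q" if "a \<in> L" for a
      by (intro borel_measurable_divide measurable_walk_cnt measurable_real_cnt that)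
    then have "{x \<in> space Q. walk x k (cnt x n k) / real (cnt x n k) - G / sqrt (real m)
             \<le> walk x s (cnt x n s) / real (cnt x n s)} \<in> sets Q"
      using sk by (intro borel_measurable_le borel_measurable_diff borel_measurable_const)
    then show "Measurable.pred Q (\<lambda>x. walk x k (cnt x n k) / real (cnt x n k) - G / sqrt (real m)
             \<le> walk x s (cnt x n s) / real (cnt x n s))"
      by (simp add: pred_def)
  qed
  show ?thesis
    unfolding competitive_def by measurable
qed

text \<open>After division by \<open>sqrt \<nu>\<close> the block is normal with variance
  \<open>v a\<close>, so its drop probability is the same for every \<nu>.\<close>

lemma block_tail_prob:
  assumes a: "a \<in> L" and \<nu>: "\<nu> \<ge> 1"
  shows "P.prob {x \<in> space Q. (\<Sum>j\<in>{\<nu>..<2*\<nu>}. x (j, a)) \<le> - D * sqrt (real \<nu>)}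
     = measure (density lborel (normal_density 0 (sqrt (v a)))) {..- D}"
proof -
  have "distributed Q lborel (\<lambda>x. \<Sum>j\<in>{\<nu>..<2*\<nu>}. x (j, a)) (normal_density 0 (sqrt (real (2*\<nu> - \<nu>) * v a)))"
    by (rule distributed_block[OF a]) (use \<nu> in simp)
  then have X: "distributed Q lborel (\<lambda>x. \<Sum>j\<in>{\<nu>..<2*\<nu>}. x (j, a)) (normal_density 0 (sqrt (real \<nu> * v a)))"
    by simp
  have "distributed Q lborel (\<lambda>x. 0 + (1 / sqrt (real \<nu>)) * (\<Sum>j\<in>{\<nu>..<2*\<nu>}. x (j, a)))
      (normal_density (0 + (1 / sqrt (real \<nu>)) * 0) (\<bar>1 / sqrt (real \<nu>)\<bar> * sqrt (real \<nu> * v a)))"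
    by (rule P.normal_density_affine[OF X]) (use \<nu> v_pos[of a] in auto)
  moreover have "\<bar>1 / sqrt (real \<nu>)\<bar> * sqrt (real \<nu> * v a) = sqrt (v a)"
    using \<nu> by (simp add: real_sqrt_mult)
  ultimately have "distributed Q lborel (\<lambda>x. (\<Sum>j\<in>{\<nu>..<2*\<nu>}. x (j, a)) / sqrt (real \<nu>)) (normal_density 0 (sqrt (v a)))"
    by simp
  from P.normal_prob[OF this, of "{..- D}"]
  have "P.prob {x \<in> space Q. (\<Sum>j\<in>{\<nu>..<2*\<nu>}. x (j, a)) / sqrt (real \<nu>) \<le> - D}
     = measure (density lborel (normal_density 0 (sqrt (v a)))) {..- D}"
    by simp
  moreover have "b / sqrt (real \<nu>) \<le> - D \<longleftrightarrow> b \<le> - D * sqrt (real \<nu>)" for b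
    using \<nu> by (simp add: divide_le_eq)
  ultimately show ?thesis by simp
qed

text \<open>
  The conditional probability that the last arm to reach level \<open>\<nu>\<close> drops over its next \<open>\<nu>\<close> samples
  is bounded below uniformly in \<open>\<nu>\<close>. Approximating the event \<open>B\<close> by an event \<open>B'\<close> that
  depends on finitely many noises makes that drop independent of \<open>B'\<close> once \<open>\<nu>\<close> is large, whereas on
  \<open>B\<close> itself the drop is impossible.
\<close>

lemma prob_competitive_eq_0:
  assumes I: "I \<subseteq> L" "card I \<ge> 2" and "G \<ge> 0"
  shows "P.prob {x \<in> space Q. competitive cnt I G n1 x} = 0"
proof (rule ccontr)
  define B where "B = {x \<in> space Q. competitive cnt I G n1 x}"
  define q where "q = P.prob B"
  assume "P.prob {x \<in> space Q. competitive cnt I G n1 x} \<noteq> 0"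
  then have q: "q > 0"
    by (simp add: q_def B_def measure_nonneg less_le)
  have Bm: "B \<in> sets Q"
    unfolding B_def by (rule sets_competitive[OF I(1)])
  have finI: "finite I" and Ine: "I \<noteq> {}"
    using I finite_L finite_subset by auto
  define V where "V = (\<Sum>a\<in>I. v a)"
  have V: "V > 0"
    unfolding V_def using finI Ine v_pos by (intro sum_pos) auto
  \<comment> \<open>Makes the excursion bounds add up to
    \<open>16 * V / C\<^sup>2 = q / 4\<close>.\<close>
  define C where "C = sqrt (64 * V / q)"
  have C: "C > 0" "C\<^sup>2 = 64 * V / q"
    using V q by (auto simp: C_def)
  \<comment> \<open>One more than the drop that \<open>falling_arm_starves\<close> permits.\<close>
  define D where "D = 3 * C + 2 * G + 1"
  define p where "p a = measure (density lborel (normal_density 0 (sqrt (v a)))) {..- D}" for a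
  define p0 where "p0 = Min (p ` I)"
  have p0: "p0 > 0"
    unfolding p0_def using finI Ine v_pos by (subst Min_gr_iff) (auto simp: p_def intro!: normal_lower_tail_pos)
  have p0_le: "p0 \<le> p a" if "a \<in> I" for a
    unfolding p0_def using finI that by auto
  define m where "m = real (card I)"
  have m: "m > 0" using I by (simp add: m_def)
  \<comment> \<open>The approximation error must be at most \<open>q / 4\<close> by itself, and
    again after division by the drop probability \<open>p0\<close> and summation over the
    arms.\<close>
  define \<epsilon> where "\<epsilon> = min (q / 4) (q * p0 / (4 * m))"
  have eps: "\<epsilon> > 0" "\<epsilon> \<le> q / 4" "m * (\<epsilon> / p0) \<le> q / 4"
  proof -
    show "\<epsilon> > 0" "\<epsilon> \<le> q / 4" using q p0 m by (auto simp: \<epsilon>_def)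
    have "\<epsilon> \<le> q * p0 / (4 * m)" by (simp add: \<epsilon>_def)
    then show "m * (\<epsilon> / p0) \<le> q / 4" using p0 m by (simp add: field_simps)
  qed
  obtain J B' where J: "finite J" "J \<subseteq> UNIV \<times> L" "B' \<in> sets Q" "depends_on J (space Q) B'"
     "P.prob ((B - B') \<union> (B' - B)) < \<epsilon>"
    using finitely_approximable[OF Bm] eps(1) unfolding finitely_approximable_def by meson
  \<comment> \<open>Beyond all replication indices in \<open>J\<close>, so that no block starting at
    \<nu> meets \<open>J\<close>, and at least \<open>n1\<close>, as the starvation lemma
    requires.\<close>
  define \<nu> where "\<nu> = Suc (Max (insert n1 (fst ` J)))"
  have J\<nu>: "fst i < \<nu>" if "i \<in> J" for i
    unfolding \<nu>_def using J(1) that by (intro le_imp_less_Suc Max_ge) auto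
  have "n1 \<le> Max (insert n1 (fst ` J))"
    using J(1) by (intro Max_ge) auto
  then have \<nu>: "\<nu> \<ge> 1" "\<nu> \<ge> n1"
    unfolding \<nu>_def by linarith+
  define W where "W a = {x \<in> space Q. \<exists>r\<ge>\<nu>. C * real r / sqrt (real \<nu>) < \<bar>walk x a r\<bar>}" for a
  define H where "H s = {x \<in> space Q. \<exists>n. cnt x n s = \<nu> \<and> (\<forall>i\<in>I. \<nu> \<le> cnt x n i)}" for s
  \<comment> \<open>For arm \<open>s\<close> only the walk at \<nu> is restricted, since the event
    must not read the block of \<open>s\<close>; the other arms may be restricted forever.\<close>
  define A where "A s = {x \<in> space Q. \<bar>walk x s \<nu>\<bar> \<le> C * sqrt (real \<nu>) \<and>
     (\<forall>k\<in>I - {s}. \<forall>r\<ge>\<nu>. \<bar>walk x k r\<bar> \<le> C * real r / sqrt (real \<nu>))}" for s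
  define X where "X s = B' \<inter> H s \<inter> A s" for s
  define Fl where "Fl s = {x \<in> space Q. (\<Sum>j\<in>{\<nu>..<2*\<nu>}. x (j, s)) \<le> - D * sqrt (real \<nu>)}" for s
  have Wm: "W a \<in> sets Q" if "a \<in> I" for a
    unfolding W_def using that I by (intro sets_walk_excursion) auto
  have Hm: "H s \<in> sets Q" if "s \<in> I" for s
  proof -
    have [measurable]: "Measurable.pred Q (\<lambda>x. cnt x n a = \<nu>)" "Measurable.pred Q (\<lambda>x. \<nu> \<le> cnt x n a)" if "a \<in> I" for a n
    proof -
      have a: "a \<in> L" using that I by auto
      show "Measurable.pred Q (\<lambda>x. cnt x n a = \<nu>)"
        by (rule pred_cnt[OF a a, where R="\<lambda>i _. i = \<nu>"])
      show "Measurable.pred Q (\<lambda>x. \<nu> \<le> cnt x n a)"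
        by (rule pred_cnt[OF a a, where R="\<lambda>i _. \<nu> \<le> i"])
    qed
    show ?thesis
      unfolding H_def using that finI by measurable
  qed
  have Am: "A s \<in> sets Q" if "s \<in> I" for s
  proof -
    have [measurable]: "Measurable.pred Q (\<lambda>x. \<bar>walk x a r\<bar> \<le> c)" if "a \<in> I - {s}" for a r c
    proof -
      have [measurable]: "a \<in> L" using that I by auto
      show ?thesis by measurable
    qed
    have [measurable]: "s \<in> L" "finite (I - {s})" using that I finI by auto
    show ?thesis
      unfolding A_def by measurable
  qed
  have Flm: "Fl s \<in> sets Q" if "s \<in> I" for s
  proof -
    have "s \<in> L" using that I by auto
    then show ?thesis
      unfolding Fl_def by (intro borel_measurable_le borel_measurable_sum measurable_coordinate borel_measurable_const)
  qed
  have Xm: "X s \<in> sets Q" if "s \<in> I" for s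
    unfolding X_def using J(3) Hm[OF that] Am[OF that] by auto

  \<comment> \<open>\<open>X s\<close> reads nothing of the block and is therefore independent of
    the drop \<open>Fl s\<close>. By starvation their intersection misses \<open>B\<close> while
    lying in \<open>B'\<close>, so it is part of the approximation error.\<close>
  have XF: "P.prob (X s) * p0 \<le> \<epsilon>" if s: "s \<in> I" for s
  proof -
    let ?blk = "{\<nu>..<2*\<nu>} \<times> {s}"
    let ?A = "UNIV \<times> L - ?blk"
    have sL: "s \<in> L" using s I by auto
    have "depends_on ?A (space Q) B'"
      by (rule depends_on_mono[OF J(4)]) (use J(2) J\<nu> in \<open>force\<close>)
    moreover have "depends_on ?A (space Q) (H s)"
      unfolding H_def
    proof (rule depends_on_Collect)
      fix x y assume xy: "x \<in> space Q" "y \<in> space Q" "\<And>i. i \<in> ?A \<Longrightarrow> x i = y i"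
      assume "\<exists>n. cnt x n s = \<nu> \<and> (\<forall>i\<in>I. \<nu> \<le> cnt x n i)"
      then obtain n where n: "cnt x n s = \<nu>" "\<forall>i\<in>I. \<nu> \<le> cnt x n i" by blast
      \<comment> \<open>When \<open>s\<close> has exactly \<nu> samples, none of its noises in the
        block has been observed, so altering the block leaves the counts at that time
        unchanged.\<close>
      have eq: "cnt y n b = cnt x n b" if "b \<in> L" for b
        by (rule nonanticipating[where a=s and \<nu>=\<nu>]) (use sL xy n that in auto)
      have "cnt y n s = \<nu> \<and> (\<forall>i\<in>I. \<nu> \<le> cnt y n i)"
        using n eq I sL by auto
      then show "\<exists>n. cnt y n s = \<nu> \<and> (\<forall>i\<in>I. \<nu> \<le> cnt y n i)" by blast
    qed
    moreover have "depends_on ?A (space Q) (A s)"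
      unfolding A_def
    proof (rule depends_on_Collect)
      fix x y :: "nat \<times> 'a \<Rightarrow> real" assume xy: "\<And>i. i \<in> ?A \<Longrightarrow> x i = y i"
      have "walk x s \<nu> = walk y s \<nu>"
        unfolding walk_def by (rule sum.cong) (use xy sL in auto)
      moreover have "walk x k r = walk y k r" if "k \<in> I - {s}" for k r
        unfolding walk_def by (rule sum.cong) (use xy that I in auto)
      ultimately show "\<bar>walk x s \<nu>\<bar> \<le> C * sqrt (real \<nu>) \<and>
        (\<forall>k\<in>I - {s}. \<forall>r\<ge>\<nu>. \<bar>walk x k r\<bar> \<le> C * real r / sqrt (real \<nu>)) \<Longrightarrow>
        \<bar>walk y s \<nu>\<bar> \<le> C * sqrt (real \<nu>) \<and>
        (\<forall>k\<in>I - {s}. \<forall>r\<ge>\<nu>. \<bar>walk y k r\<bar> \<le> C * real r / sqrt (real \<nu>))"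
        by simp
    qed
    ultimately have "depends_on ?A (space Q) (X s)"
      unfolding X_def by (intro depends_on_Int)
    moreover have "depends_on ?blk (space Q) (Fl s)"
      unfolding Fl_def
    proof (rule depends_on_Collect)
      fix x y :: "nat \<times> 'a \<Rightarrow> real" assume "\<And>i. i \<in> ?blk \<Longrightarrow> x i = y i"
      then have "(\<Sum>j\<in>{\<nu>..<2*\<nu>}. x (j, s)) = (\<Sum>j\<in>{\<nu>..<2*\<nu>}. y (j, s))"
        by (intro sum.cong) auto
      then show "(\<Sum>j\<in>{\<nu>..<2*\<nu>}. x (j, s)) \<le> - D * sqrt (real \<nu>) \<Longrightarrow>
         (\<Sum>j\<in>{\<nu>..<2*\<nu>}. y (j, s)) \<le> - D * sqrt (real \<nu>)" by simp
    qed
    ultimately have "P.prob (X s \<inter> Fl s) = P.prob (X s) * P.prob (Fl s)"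
      by (intro measure_Int_disjoint_coordinates[OF Xm[OF s] _ Flm[OF s]]) (use sL index_nonempty in auto)
    moreover have "P.prob (Fl s) = p s"
      unfolding Fl_def p_def by (rule block_tail_prob) fact+
    moreover have "P.prob (X s) * p0 \<le> P.prob (X s) * p s"
      by (rule mult_left_mono[OF p0_le[OF s]]) simp
    moreover have "P.prob (X s \<inter> Fl s) \<le> P.prob ((B - B') \<union> (B' - B))"
    proof (rule P.finite_measure_mono)
      show "(B - B') \<union> (B' - B) \<in> sets Q" using Bm J(3) by auto
      show "X s \<inter> Fl s \<subseteq> (B - B') \<union> (B' - B)"
      proof
        fix x assume x: "x \<in> X s \<inter> Fl s"
        have "x \<notin> B"
        proof
          assume "x \<in> B"
          then have comp: "competitive cnt I G n1 x" by (simp add: B_def)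
          have "\<not> I \<subseteq> {s}"
            using I(2) card_mono[of "{s}" I] by auto
          then obtain k where k: "k \<in> I" "s \<noteq> k" by auto
          from x obtain n where n: "cnt x n s = \<nu>" "\<forall>i\<in>I. \<nu> \<le> cnt x n i"
            by (auto simp: X_def H_def)
          have "D \<le> 3 * C + 2 * G"
            by (rule falling_arm_starves[OF comp s k \<nu>(2,1) n])
              (use x k in \<open>auto simp: X_def A_def Fl_def block_eq\<close>)
          then show False by (simp add: D_def)
        qed
        then show "x \<in> (B - B') \<union> (B' - B)" using x by (auto simp: X_def)
      qed
    qed
    ultimately show ?thesis using J(5) by simp
  qed
  have "P.prob (\<Union>a\<in>I. W a) \<le> (\<Sum>a\<in>I. P.prob (W a))"
    using Wm finI by (intro P.finite_measure_subadditive_finite) auto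
  also have "\<dots> \<le> (\<Sum>a\<in>I. 16 * v a / C\<^sup>2)"
    unfolding W_def using I C \<nu> by (intro sum_mono walk_excursion_prob) auto
  also have "\<dots> = 16 * V / C\<^sup>2"
    by (simp add: V_def sum_distrib_left sum_divide_distrib)
  also have "\<dots> = q / 4"
    using C V q by (simp add: field_simps)
  finally have PW: "P.prob (\<Union>a\<in>I. W a) \<le> q / 4" .
  have "P.prob (\<Union>s\<in>I. X s) \<le> (\<Sum>s\<in>I. P.prob (X s))"
    using Xm finI by (intro P.finite_measure_subadditive_finite) auto
  also have "\<dots> \<le> (\<Sum>s\<in>I. \<epsilon> / p0)"
    using XF p0 by (intro sum_mono) (simp add: field_simps)
  also have "\<dots> = m * (\<epsilon> / p0)"
    by (simp add: m_def)
  finally have PX: "P.prob (\<Union>s\<in>I. X s) \<le> q / 4"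
    using eps(3) by linarith
  \<comment> \<open>The last arm to reach level \<nu> supplies the \<open>s\<close>. The three parts
    of the cover have probability at most \<open>q / 4\<close> each, which contradicts
    \<open>q > 0\<close>.\<close>
  have cover: "B \<subseteq> ((B - B') \<union> (B' - B)) \<union> ((\<Union>a\<in>I. W a) \<union> (\<Union>s\<in>I. X s))"
  proof
    fix x assume x: "x \<in> B"
    then have xs: "x \<in> space Q" and "competitive cnt I G n1 x" by (auto simp: B_def)
    then have "\<forall>a\<in>I. \<exists>n. \<nu> \<le> cnt x n a"
      by (simp add: competitive_def)
    from last_arm_at_level[OF finI Ine this \<nu>(1)]
    obtain n s where s: "s \<in> I" "cnt x n s = \<nu>" "\<forall>i\<in>I. \<nu> \<le> cnt x n i" .
    show "x \<in> ((B - B') \<union> (B' - B)) \<union> ((\<Union>a\<in>I. W a) \<union> (\<Union>s\<in>I. X s))"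
    proof (cases "x \<in> B' \<and> x \<notin> (\<Union>a\<in>I. W a)")
      case True
      then have w: "\<bar>walk x a r\<bar> \<le> C * real r / sqrt (real \<nu>)" if "a \<in> I" "r \<ge> \<nu>" for a r
        using xs that by (force simp: W_def not_less)
      have "\<bar>walk x s \<nu>\<bar> \<le> C * real \<nu> / sqrt (real \<nu>)"
        by (rule w) (use s in auto)
      then have "\<bar>walk x s \<nu>\<bar> \<le> C * sqrt (real \<nu>)"
        by (simp add: real_div_sqrt flip: times_divide_eq_right)
      then have "x \<in> X s"
        using True xs s w by (auto simp: X_def H_def A_def)
      then show ?thesis using s by blast
    next
      case False
      then show ?thesis using x by auto
    qed
  qed
  have m1: "(B - B') \<union> (B' - B) \<in> sets Q" using Bm J(3) by auto
  have m2: "(\<Union>a\<in>I. W a) \<in> sets Q" "(\<Union>s\<in>I. X s) \<in> sets Q"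
    using Wm Xm finI by auto
  have "q \<le> P.prob (((B - B') \<union> (B' - B)) \<union> ((\<Union>a\<in>I. W a) \<union> (\<Union>s\<in>I. X s)))"
    unfolding q_def by (rule P.finite_measure_mono[OF cover]) (use m1 m2 in auto)
  also have "\<dots> \<le> P.prob ((B - B') \<union> (B' - B)) + P.prob ((\<Union>a\<in>I. W a) \<union> (\<Union>s\<in>I. X s))"
    by (rule measure_Un_le) (use m1 m2 in auto)
  also have "P.prob ((\<Union>a\<in>I. W a) \<union> (\<Union>s\<in>I. X s)) \<le> P.prob (\<Union>a\<in>I. W a) + P.prob (\<Union>s\<in>I. X s)"
    by (rule measure_Un_le) (use m2 in auto)
  finally have "q \<le> 3 / 4 * q"
    using PW PX J(5) eps(2) by linarith
  then show False using q by simp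
qed

text \<open>There are finitely many \<open>I\<close> and countably many \<open>n1\<close>. A larger
  \<open>G\<close> only weakens \<open>competitive\<close>, so natural numbers suffice for
  \<open>G\<close> and the exceptional sets form a countable union.\<close>

theorem AE_not_competitive:
  "AE x in Q. \<forall>I G n1. I \<subseteq> L \<and> card I \<ge> 2 \<longrightarrow> \<not> competitive cnt I G n1 x"
proof -
  have one: "AE x in Q. \<not> competitive cnt I (real G) n1 x" if "I \<subseteq> L" "card I \<ge> 2" for I G n1
  proof -
    have "AE x in Q. x \<notin> {x \<in> space Q. competitive cnt I (real G) n1 x}"
      using prob_competitive_eq_0[OF that, of "real G" n1] sets_competitive[OF that(1)]
      by (intro AE_not_in) (auto simp: null_sets_def P.emeasure_eq_measure)
    then show ?thesis using AE_space by eventually_elim auto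
  qed
  have "AE x in Q. \<forall>I\<in>{I. I \<subseteq> L \<and> card I \<ge> 2}. \<forall>G n1. \<not> competitive cnt I (real G) n1 x"
  proof (rule AE_finite_allI)
    show "finite {I. I \<subseteq> L \<and> card I \<ge> 2}"
      by (rule finite_subset[of _ "Pow L"]) (use finite_L in auto)
    show "AE x in Q. \<forall>G n1. \<not> competitive cnt I (real G) n1 x" if "I \<in> {I. I \<subseteq> L \<and> card I \<ge> 2}" for I
      using one that by (simp add: AE_all_countable)
  qed
  then show ?thesis
  proof eventually_elim
    case (elim x)
    show ?case
    proof (intro allI impI notI)
      fix I G n1 assume I: "I \<subseteq> L \<and> card I \<ge> 2" and comp: "competitive cnt I G n1 x"
      obtain G' :: nat where "G \<le> real G'" using real_arch_simple by blast
      then have "G / sqrt (real \<nu>) \<le> real G' / sqrt (real \<nu>)" for \<nu>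
        by (intro divide_right_mono) auto
      then have "a - G / sqrt (real \<nu>) \<le> b \<Longrightarrow> a - real G' / sqrt (real \<nu>) \<le> b" for a b \<nu>
        by (rule order_trans[OF diff_left_mono])
      then have "competitive cnt I (real G') n1 x"
        using comp competitiveD[OF comp] unfolding competitive_def[of _ _ "real G'"]
        by (auto simp: competitive_def[of _ _ G])
      then show False using elim I by blast
    qed
  qed
qed

end

section \<open>Bounds on the Gaussian process posterior\<close>

definition quad :: "'c set \<Rightarrow> ('c \<Rightarrow> 'c \<Rightarrow> real) \<Rightarrow> ('c \<Rightarrow> real) \<Rightarrow> real" where
  "quad C S u = (\<Sum>c\<in>C. \<Sum>c'\<in>C. u c * S c c' * u c')"

text \<open>The transpose of the incidence matrix between positions of \<open>D\<close> and
  contexts, applied to \<open>x\<close>. It carries the linear algebra from lists of varying length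
  to the fixed set of contexts.\<close>

definition list_agg :: "'c list \<Rightarrow> (nat \<Rightarrow> real) \<Rightarrow> 'c \<Rightarrow> real" where
  "list_agg D x c = (\<Sum>i<length D. if D ! i = c then x i else 0)"

lemma sum_list_agg:
  assumes "finite C" "set D \<subseteq> C"
  shows "(\<Sum>i<length D. f (D ! i) * x i) = (\<Sum>c\<in>C. f c * list_agg D x c)"
proof -
  have "(\<Sum>c\<in>C. f c * list_agg D x c) = (\<Sum>c\<in>C. \<Sum>i<length D. if D ! i = c then f c * x i else 0)"
    unfolding list_agg_def sum_distrib_left by (intro sum.cong refl) auto
  also have "\<dots> = (\<Sum>i<length D. \<Sum>c\<in>C. if D ! i = c then f c * x i else 0)"
    by (rule sum.swap)
  also have "\<dots> = (\<Sum>i<length D. f (D ! i) * x i)"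
    using assms by (intro sum.cong refl) (auto simp: subset_iff)
  finally show ?thesis by simp
qed

lemma list_agg_const: "list_agg D (\<lambda>_. a) c = real (count_list D c) * a"
proof -
  have "list_agg D (\<lambda>_. a) c = real (card {i. i < length D \<and> D ! i = c}) * a"
    unfolding list_agg_def by (simp add: sum.If_cases Int_def lessThan_def)
  also have "card {i. i < length D \<and> D ! i = c} = count_list D c"
    by (simp add: count_list_eq_length_filter length_filter_conv_card eq_commute)
  finally show ?thesis .
qed

lemma list_agg_linear:
  "list_agg D (\<lambda>i. x i - f (D ! i)) c = list_agg D x c - real (count_list D c) * f c"
proof -
  have "list_agg D (\<lambda>i. x i - f (D ! i)) c = list_agg D x c - list_agg D (\<lambda>_. f c) c"
    unfolding list_agg_def sum_subtractf[symmetric] by (intro sum.cong) auto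
  then show ?thesis by (simp add: list_agg_const)
qed

lemma quad_list_agg:
  assumes "finite C" "set D \<subseteq> C"
  shows "(\<Sum>i<length D. \<Sum>j<length D. x i * S (D ! i) (D ! j) * x j) = quad C S (list_agg D x)"
proof -
  have "(\<Sum>i<length D. \<Sum>j<length D. x i * S (D ! i) (D ! j) * x j)
     = (\<Sum>i<length D. (\<Sum>c'\<in>C. S (D ! i) c' * list_agg D x c') * x i)"
    unfolding sum_list_agg[OF assms, symmetric] by (simp add: sum_distrib_left mult_ac)
  also have "\<dots> = (\<Sum>c\<in>C. (\<Sum>c'\<in>C. S c c' * list_agg D x c') * list_agg D x c)"
    by (rule sum_list_agg[OF assms])
  also have "\<dots> = quad C S (list_agg D x)"
    by (simp add: quad_def sum_distrib_left sum_distrib_right mult_ac)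
  finally show ?thesis .
qed

lemma quad_eq: "quad C S u = (\<Sum>c\<in>C. u c * (\<Sum>c'\<in>C. S c c' * u c'))"
  by (simp add: quad_def sum_distrib_left mult_ac)

lemma quad_pos: "strictly_pos_def_on C S \<Longrightarrow> c \<in> C \<Longrightarrow> u c \<noteq> 0 \<Longrightarrow> 0 < quad C S u"
  unfolding strictly_pos_def_on_def quad_def by blast

lemma quad_nonneg:
  assumes "strictly_pos_def_on C S"
  shows "0 \<le> quad C S u"
proof (cases "\<exists>c\<in>C. u c \<noteq> 0")
  case True
  then show ?thesis using quad_pos[OF assms] less_imp_le by blast
next
  case False
  then show ?thesis by (simp add: quad_def)
qed

section \<open>The linear system behind the posterior\<close>

lemma mat_inverse_pos_def:
  fixes A :: "real mat"
  assumes A: "A \<in> carrier_mat n n"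
    and pos: "\<And>x. x \<in> carrier_vec n \<Longrightarrow> x \<noteq> 0\<^sub>v n \<Longrightarrow> x \<bullet> (A *\<^sub>v x) \<noteq> 0"
  obtains B where "mat_inverse A = Some B" "B \<in> carrier_mat n n" "A * B = 1\<^sub>m n"
proof -
  have "det A \<noteq> 0"
  proof
    assume "det A = 0"
    then obtain x where x: "x \<in> carrier_vec n" "x \<noteq> 0\<^sub>v n" "A *\<^sub>v x = 0\<^sub>v n"
      using det_0_iff_vec_prod_zero[OF A] by blast
    then show False using pos[OF x(1,2)] by simp
  qed
  then have "A \<in> Units (ring_mat TYPE(real) n n)"
    by (rule det_non_zero_imp_unit[OF A])
  then obtain B where "mat_inverse A = Some B"
    using mat_inverse(1)[OF A, of n] by fastforce
  with mat_inverse(2)[OF A this] show thesis by (intro that) auto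
qed

text \<open>Positivity of the whole form makes the matrix invertible, so that
  \<open>mat_inverse\<close> returns a genuine inverse. It is assumed directly, not derived from
  positive \<open>v\<close>, because the lemma is also applied with zero noise to a list without
  repetitions.\<close>

lemma gp_noisy_cov_inv_solves:
  assumes pos: "\<And>x. \<exists>i<length D. x i \<noteq> 0 \<Longrightarrow>
      0 < (\<Sum>i<length D. \<Sum>j<length D. x i * S (D ! i) (D ! j) * x j) + (\<Sum>i<length D. v (D ! i) * (x i)\<^sup>2)"
  obtains \<beta> where "gp_noisy_cov_inv S v D *\<^sub>v vec (length D) y = vec (length D) \<beta>"
    "\<And>i. i < length D \<Longrightarrow> (\<Sum>j<length D. S (D ! i) (D ! j) * \<beta> j) + v (D ! i) * \<beta> i = y i"
proof -
  let ?n = "length D"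
  let ?A = "gp_noisy_cov S v D"
  have A: "?A \<in> carrier_mat ?n ?n" by (simp add: gp_noisy_cov_def)
  have Ax: "(?A *\<^sub>v x) $ i = (\<Sum>j<?n. S (D ! i) (D ! j) * x $ j) + v (D ! i) * x $ i"
    if x: "x \<in> carrier_vec ?n" and i: "i < ?n" for x i
  proof -
    have "(?A *\<^sub>v x) $ i = (\<Sum>j<?n. (S (D ! i) (D ! j) + (if i = j then v (D ! i) else 0)) * x $ j)"
      using x i by (simp add: gp_noisy_cov_def scalar_prod_def lessThan_atLeast0)
    also have "\<dots> = (\<Sum>j<?n. S (D ! i) (D ! j) * x $ j + (if i = j then v (D ! i) * x $ j else 0))"
      by (intro sum.cong) (auto simp: algebra_simps)
    also have "\<dots> = (\<Sum>j<?n. S (D ! i) (D ! j) * x $ j) + v (D ! i) * x $ i"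
      using i by (simp add: sum.distrib)
    finally show ?thesis .
  qed
  have "x \<bullet> (?A *\<^sub>v x) \<noteq> 0" if x: "x \<in> carrier_vec ?n" "x \<noteq> 0\<^sub>v ?n" for x
  proof -
    obtain i where i: "i < ?n" "x $ i \<noteq> 0"
      using x by (auto simp: vec_eq_iff)
    have "dim_vec (?A *\<^sub>v x) = ?n" using A by simp
    then have "x \<bullet> (?A *\<^sub>v x) = (\<Sum>i<?n. x $ i * (?A *\<^sub>v x) $ i)"
      by (simp add: scalar_prod_def lessThan_atLeast0)
    also have "\<dots> = (\<Sum>i<?n. x $ i * ((\<Sum>j<?n. S (D ! i) (D ! j) * x $ j) + v (D ! i) * x $ i))"
      by (intro sum.cong refl) (simp add: Ax[OF x(1)])
    also have "\<dots> = (\<Sum>i<?n. \<Sum>j<?n. x $ i * S (D ! i) (D ! j) * x $ j) + (\<Sum>i<?n. v (D ! i) * (x $ i)\<^sup>2)"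
      by (simp add: distrib_left sum.distrib sum_distrib_left power2_eq_square mult_ac)
    also have "\<dots> > 0"
      by (rule pos[of "\<lambda>i. x $ i"]) (use i in auto)
    finally show ?thesis by simp
  qed
  then obtain B where B: "mat_inverse ?A = Some B" "B \<in> carrier_mat ?n ?n" "?A * B = 1\<^sub>m ?n"
    by (rule mat_inverse_pos_def[OF A])
  let ?b = "B *\<^sub>v vec ?n y"
  have b: "?b \<in> carrier_vec ?n" using B(2) by simp
  have "?A *\<^sub>v ?b = (?A * B) *\<^sub>v vec ?n y"
    by (rule assoc_mult_mat_vec[symmetric, OF A B(2)]) simp
  then have Ab: "?A *\<^sub>v ?b = vec ?n y" using B(3) by simp
  show thesis
  proof
    show "gp_noisy_cov_inv S v D *\<^sub>v vec ?n y = vec ?n (\<lambda>i. ?b $ i)"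
      by (rule eq_vecI) (use b B(2) in \<open>auto simp: gp_noisy_cov_inv_def B(1)\<close>)
    fix i assume i: "i < ?n"
    then show "(\<Sum>j<?n. S (D ! i) (D ! j) * ?b $ j) + v (D ! i) * ?b $ i = y i"
      using Ax[OF b i] Ab by simp
  qed
qed

text \<open>
  The vector \<open>A\<inverse>y\<close> enters the posterior only through its sums over the repetitions of a context,
  so the posterior reduces to a linear system indexed by the finite set of contexts.
\<close>

lemma gp_reduction:
  assumes C: "finite C" "set D \<subseteq> C" and S: "strictly_pos_def_on C S" and v: "\<And>c. c \<in> C \<Longrightarrow> v c > 0"
  obtains \<alpha> where
    "\<And>c. vec (length D) (\<lambda>i. S c (D ! i)) \<bullet> (gp_noisy_cov_inv S v D *\<^sub>v vec (length D) y)
       = (\<Sum>c'\<in>C. S c c' * \<alpha> c')"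
    "\<And>c. c \<in> C \<Longrightarrow> v c * \<alpha> c = list_agg D y c - real (count_list D c) * (\<Sum>c'\<in>C. S c c' * \<alpha> c')"
proof -
  have D: "D ! i \<in> C" if "i < length D" for i using C that by auto
  have pos: "0 < (\<Sum>i<length D. \<Sum>j<length D. x i * S (D ! i) (D ! j) * x j) + (\<Sum>i<length D. v (D ! i) * (x i)\<^sup>2)"
    if nz: "\<exists>i<length D. x i \<noteq> 0" for x
  proof -
    obtain i where i: "i < length D" "x i \<noteq> 0" using nz by blast
    have "0 < (\<Sum>i<length D. v (D ! i) * (x i)\<^sup>2)"
      by (rule sum_pos2[of _ i]) (use i v[OF D] in \<open>auto intro!: mult_nonneg_nonneg simp: less_imp_le\<close>)
    then show ?thesis
      using quad_nonneg[OF S, of "list_agg D x"] by (simp add: quad_list_agg[OF C])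
  qed
  obtain \<beta> where b: "gp_noisy_cov_inv S v D *\<^sub>v vec (length D) y = vec (length D) \<beta>"
    "\<And>i. i < length D \<Longrightarrow> (\<Sum>j<length D. S (D ! i) (D ! j) * \<beta> j) + v (D ! i) * \<beta> i = y i"
    using gp_noisy_cov_inv_solves[where D=D and S=S and v=v and y=y, OF pos] by blast
  define g where "g = list_agg D \<beta>"
  have sp: "(\<Sum>j<length D. S c (D ! j) * \<beta> j) = (\<Sum>c'\<in>C. S c c' * g c')" for c
    unfolding g_def by (rule sum_list_agg[OF C])
  show thesis
  proof (rule that[of g])
    show "vec (length D) (\<lambda>i. S c (D ! i)) \<bullet> (gp_noisy_cov_inv S v D *\<^sub>v vec (length D) y)
       = (\<Sum>c'\<in>C. S c c' * g c')" for c
      unfolding b(1) sp[symmetric] by (simp add: scalar_prod_def lessThan_atLeast0)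
    fix c assume c: "c \<in> C"
    have "v c * g c = (\<Sum>i<length D. if D ! i = c then v (D ! i) * \<beta> i else 0)"
      unfolding g_def list_agg_def sum_distrib_left by (intro sum.cong) auto
    also have "\<dots> = list_agg D (\<lambda>i. y i - (\<Sum>c'\<in>C. S (D ! i) c' * g c')) c"
      unfolding list_agg_def
    proof (rule sum.cong[OF refl])
      fix i assume "i \<in> {..<length D}"
      then have "v (D ! i) * \<beta> i = y i - (\<Sum>c'\<in>C. S (D ! i) c' * g c')"
        using b(2)[of i] by (simp add: sp)
      then show "(if D ! i = c then v (D ! i) * \<beta> i else 0)
         = (if D ! i = c then y i - (\<Sum>c'\<in>C. S (D ! i) c' * g c') else 0)"
        by auto
    qed
    finally show "v c * g c = list_agg D y c - real (count_list D c) * (\<Sum>c'\<in>C. S c c' * g c')"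
      by (simp add: list_agg_linear[where f="\<lambda>d. \<Sum>c'\<in>C. S d c' * g c'"])
  qed
qed

text \<open>Unfolds the matrix and vector products into finite sums in which the observations have
  constant coefficients; measurability in the noise is read off from this form.\<close>

lemma gp_post_mean_sum:
  "gp_post_mean m S v D Y c = m c + (\<Sum>i<dim_row (gp_noisy_cov_inv S v D).
     vec_index (vec (length D) (\<lambda>i. S c (D ! i))) i *
     (\<Sum>j<length D. vec_index (row (gp_noisy_cov_inv S v D) i) j * (Y ! j - m (D ! j))))"
  by (simp add: gp_post_mean_def scalar_prod_def lessThan_atLeast0)

text \<open>Column \<open>c\<close> of the inverse of S(C, C), called \<open>g\<close> below,
  represents evaluation at \<open>c\<close> in the inner product given by \<open>S\<close>.
  Cauchy-Schwarz then yields \<open>(u c)\<^sup>2 \<le> g c * quad C S u\<close>, with an explicit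
  constant and no compactness argument.\<close>

lemma strictly_pos_def_coercive_at:
  assumes C: "finite C" "c \<in> C" and S: "strictly_pos_def_on C S"
  obtains \<kappa> where "\<kappa> > 0" "\<And>u. \<kappa> * (u c)\<^sup>2 \<le> quad C S u"
proof -
  obtain D where D: "set D = C" "distinct D"
    using finite_distinct_list[OF C(1)] by blast
  have DC: "set D \<subseteq> C" using D by simp
  have agg: "list_agg D x (D ! i) = x i" if "i < length D" for x i
  proof -
    have "list_agg D x (D ! i) = (\<Sum>j<length D. if i = j then x j else 0)"
      unfolding list_agg_def using D(2) that by (intro sum.cong) (auto simp: nth_eq_iff_index_eq)
    then show ?thesis using that by simp
  qed
  have pos: "0 < (\<Sum>i<length D. \<Sum>j<length D. x i * S (D ! i) (D ! j) * x j) + (\<Sum>i<length D. 0 * (x i)\<^sup>2)"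
    if nz: "\<exists>i<length D. x i \<noteq> 0" for x
  proof -
    obtain i where i: "i < length D" "x i \<noteq> 0" using nz by blast
    have "0 < quad C S (list_agg D x)"
      using D i by (intro quad_pos[OF S, of "D ! i"]) (auto simp: agg)
    then show ?thesis
      by (simp add: quad_list_agg[OF C(1) DC])
  qed
  \<comment> \<open>For zero noise and distinct contexts the noisy covariance is the prior
    covariance matrix itself.\<close>
  obtain \<beta> where b: "\<And>i. i < length D \<Longrightarrow>
      (\<Sum>j<length D. S (D ! i) (D ! j) * \<beta> j) + 0 * \<beta> i = (if D ! i = c then 1 else 0)"
    using gp_noisy_cov_inv_solves[where D=D and S=S and v="\<lambda>_. 0" and y="\<lambda>i. if D ! i = c then 1 else 0", OF pos]
    by blast
  define g where "g = list_agg D \<beta>"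
  have Sg: "(\<Sum>d\<in>C. S x d * g d) = (if x = c then 1 else 0)" if "x \<in> C" for x
  proof -
    have "x \<in> set D" using that D by simp
    then obtain i where i: "i < length D" "D ! i = x"
      by (auto simp: in_set_conv_nth)
    have "(\<Sum>d\<in>C. S x d * g d) = (\<Sum>j<length D. S x (D ! j) * \<beta> j)"
      unfolding g_def by (rule sum_list_agg[OF C(1) DC, symmetric])
    then show ?thesis using b[OF i(1)] i(2) by simp
  qed
  have sym: "S x y = S y x" if "x \<in> C" "y \<in> C" for x y
    using S that unfolding strictly_pos_def_on_def by blast
  have cross: "(\<Sum>x\<in>C. u x * (\<Sum>y\<in>C. S x y * g y)) = u c" for u
  proof -
    have "(\<Sum>x\<in>C. u x * (\<Sum>y\<in>C. S x y * g y)) = (\<Sum>x\<in>C. if x = c then u x else 0)"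
      by (intro sum.cong) (auto simp: Sg)
    then show ?thesis using C by simp
  qed
  have cross': "(\<Sum>x\<in>C. g x * (\<Sum>y\<in>C. S x y * u y)) = u c" for u
  proof -
    have "(\<Sum>x\<in>C. g x * (\<Sum>y\<in>C. S x y * u y)) = (\<Sum>x\<in>C. \<Sum>y\<in>C. u y * (S y x * g x))"
      unfolding sum_distrib_left by (intro sum.cong refl) (simp add: sym mult_ac)
    also have "\<dots> = (\<Sum>y\<in>C. u y * (\<Sum>x\<in>C. S y x * g x))"
      by (subst sum.swap) (simp add: sum_distrib_left)
    finally show ?thesis by (simp add: cross)
  qed
  have quad_g: "quad C S g = g c"
    unfolding quad_eq by (rule cross)
  have "\<exists>x\<in>C. g x \<noteq> 0"
  proof (rule ccontr)
    assume "\<not> (\<exists>x\<in>C. g x \<noteq> 0)"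
    then have "(\<Sum>d\<in>C. S c d * g d) = 0" by simp
    then show False using Sg[OF C(2)] by simp
  qed
  then obtain x where "x \<in> C" "g x \<noteq> 0" by blast
  from quad_pos[where u=g, OF S this] have gc: "g c > 0"
    by (simp add: quad_g)
  have "(1 / g c) * (u c)\<^sup>2 \<le> quad C S u" for u
  proof -
    \<comment> \<open>\<open>t * g\<close> is the orthogonal projection of \<open>u\<close> onto
      \<open>g\<close>, which makes the form of the difference minimal.\<close>
    define t where "t = u c / g c"
    have "0 \<le> quad C S (\<lambda>x. u x - t * g x)"
      by (rule quad_nonneg[OF S])
    also have "\<dots> = quad C S u - t * (\<Sum>x\<in>C. u x * (\<Sum>y\<in>C. S x y * g y))
        - t * (\<Sum>x\<in>C. g x * (\<Sum>y\<in>C. S x y * u y)) + t * t * quad C S g"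
      unfolding quad_eq by (simp add: algebra_simps sum_subtractf sum.distrib sum_distrib_left)
    also have "\<dots> = quad C S u - t * u c - t * u c + t * t * g c"
      by (simp only: cross cross' quad_g)
    also have "\<dots> = quad C S u - (1 / g c) * (u c)\<^sup>2"
      using gc by (simp add: t_def field_simps power2_eq_square)
    finally show ?thesis by simp
  qed
  then show thesis using gc by (intro that[of "1 / g c"]) auto
qed

lemma strictly_pos_def_coercive:
  assumes C: "finite C" and S: "strictly_pos_def_on C S"
  obtains \<kappa> where "\<kappa> > 0" "\<And>u c. c \<in> C \<Longrightarrow> \<kappa> * (u c)\<^sup>2 \<le> quad C S u"
proof -
  have "\<forall>c\<in>C. \<exists>\<kappa>>0. \<forall>u. \<kappa> * (u c)\<^sup>2 \<le> quad C S u"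
    using strictly_pos_def_coercive_at[OF C _ S] by metis
  then obtain l where l: "\<And>c. c \<in> C \<Longrightarrow> l c > 0" "\<And>c u. c \<in> C \<Longrightarrow> l c * (u c)\<^sup>2 \<le> quad C S u"
    by metis
  show thesis
  proof
    show "Min (insert 1 (l ` C)) > 0"
      using C l by (subst Min_gr_iff) auto
    fix u c assume c: "c \<in> C"
    have "Min (insert 1 (l ` C)) * (u c)\<^sup>2 \<le> l c * (u c)\<^sup>2"
      using C c by (intro mult_right_mono Min_le) auto
    then show "Min (insert 1 (l ` C)) * (u c)\<^sup>2 \<le> quad C S u"
      using l(2)[OF c, of u] by linarith
  qed
qed

text \<open>An energy estimate. The form of \<open>S\<close> at \<alpha> is the sum of \<alpha>
  times the shift of the posterior mean from the prior mean, and the linear system bounds each term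
  by \<open>R * \<bar>\<alpha> c\<bar>\<close>; coercivity then bounds \<alpha> regardless of the
  number of data. As \<open>v c * \<alpha> c\<close> is the sum of the residuals at
  \<open>c\<close>, the posterior mean is within \<open>O(1 / n)\<close> of the sample mean.\<close>

lemma gp_post_mean_bounds:
  assumes C: "finite C" and S: "strictly_pos_def_on C S" and v: "\<And>c. c \<in> C \<Longrightarrow> v c > 0" and R: "R \<ge> 0"
  obtains A where "A \<ge> 0"
    "\<And>D Y c. \<lbrakk>set D \<subseteq> C; \<And>c. c \<in> C \<Longrightarrow>
        \<bar>list_agg D (\<lambda>i. Y ! i) c - real (count_list D c) * m c\<bar> \<le> R * real (count_list D c); c \<in> C\<rbrakk> \<Longrightarrow>
      \<bar>gp_post_mean m S v D Y c\<bar> \<le> A \<and>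
      \<bar>list_agg D (\<lambda>i. Y ! i) c - real (count_list D c) * gp_post_mean m S v D Y c\<bar> \<le> A"
proof -
  obtain \<kappa> where k: "\<kappa> > 0" "\<And>u c. c \<in> C \<Longrightarrow> \<kappa> * (u c)\<^sup>2 \<le> quad C S u"
    using strictly_pos_def_coercive[OF C S] by blast
  define a0 where "a0 = R * real (card C) / \<kappa>"
  have a0: "a0 \<ge> 0" using R k by (simp add: a0_def)
  define T where "T c = v c * a0 + \<bar>m c\<bar> + (\<Sum>c'\<in>C. \<bar>S c c'\<bar>) * a0" for c
  have T0: "T c \<ge> 0" if "c \<in> C" for c
    using v[OF that] a0 by (auto simp: T_def intro!: add_nonneg_nonneg mult_nonneg_nonneg sum_nonneg)
  show thesis
  proof (rule that[of "\<Sum>c\<in>C. T c"])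
    show "(\<Sum>c\<in>C. T c) \<ge> 0" using T0 by (rule sum_nonneg)
    fix D Y c
    assume D: "set D \<subseteq> C" and c: "c \<in> C" and bnd: "\<And>c. c \<in> C \<Longrightarrow>
        \<bar>list_agg D (\<lambda>i. Y ! i) c - real (count_list D c) * m c\<bar> \<le> R * real (count_list D c)"
    let ?\<mu> = "gp_post_mean m S v D Y"
    let ?n = "\<lambda>c. real (count_list D c)"
    let ?s = "list_agg D (\<lambda>i. Y ! i)"
    obtain \<alpha> where \<alpha>:
      "\<And>c. vec (length D) (\<lambda>i. S c (D ! i)) \<bullet> (gp_noisy_cov_inv S v D *\<^sub>v vec (length D) (\<lambda>i. Y ! i - m (D ! i)))
         = (\<Sum>c'\<in>C. S c c' * \<alpha> c')"
      "\<And>c. c \<in> C \<Longrightarrow> v c * \<alpha> c = list_agg D (\<lambda>i. Y ! i - m (D ! i)) c - ?n c * (\<Sum>c'\<in>C. S c c' * \<alpha> c')"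
      using gp_reduction[where v=v and y="\<lambda>i. Y ! i - m (D ! i)", OF C D S v] by blast
    have mu: "?\<mu> c = m c + (\<Sum>c'\<in>C. S c c' * \<alpha> c')" for c
      unfolding gp_post_mean_def \<alpha>(1) by simp
    have va: "v c * \<alpha> c = ?s c - ?n c * ?\<mu> c" if "c \<in> C" for c
      using \<alpha>(2)[OF that] by (simp add: mu list_agg_linear algebra_simps)
    have term_le: "\<alpha> c * (?\<mu> c - m c) \<le> R * \<bar>\<alpha> c\<bar>" if c: "c \<in> C" for c
    \<comment> \<open>An unsampled context has \<open>\<alpha> c = 0\<close>; otherwise the
      inequality is multiplied by the count and the term \<open>- v c * (\<alpha> c)\<^sup>2\<close>
      is dropped.\<close>
    proof (cases "count_list D c = 0")
      case True
      then have "v c * \<alpha> c = 0" using va[OF c] bnd[OF c] by simp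
      then show ?thesis using v[OF c] by simp
    next
      case False
      then have n: "?n c > 0" by simp
      have "?n c * (\<alpha> c * (?\<mu> c - m c)) = \<alpha> c * (?s c - ?n c * m c) - v c * (\<alpha> c)\<^sup>2"
      proof -
        have "?s c - ?n c * m c = v c * \<alpha> c + ?n c * (?\<mu> c - m c)"
          using va[OF c] by (simp add: algebra_simps)
        then show ?thesis
          by (simp only:) (simp add: power2_eq_square algebra_simps)
      qed
      also have "\<dots> \<le> \<alpha> c * (?s c - ?n c * m c)"
        using v[OF c] by simp
      also have "\<dots> \<le> \<bar>\<alpha> c\<bar> * \<bar>?s c - ?n c * m c\<bar>"
        by (simp add: abs_mult[symmetric])
      also have "\<dots> \<le> \<bar>\<alpha> c\<bar> * (R * ?n c)"
        by (rule mult_left_mono[OF bnd[OF c]]) simp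
      also have "\<dots> = ?n c * (R * \<bar>\<alpha> c\<bar>)"
        by simp
      finally show ?thesis using n by simp
    qed
    have qa: "quad C S \<alpha> \<le> R * (\<Sum>c\<in>C. \<bar>\<alpha> c\<bar>)"
      unfolding quad_eq sum_distrib_left[of R] using term_le by (intro sum_mono) (simp add: mu)
    have a_le: "\<bar>\<alpha> x\<bar> \<le> a0" if x: "x \<in> C" for x
    proof -
      \<comment> \<open>Coercivity is used at a context where \<bar>\<alpha>\<bar> is largest:
        \<open>\<kappa> * z\<^sup>2 \<le> R * card C * z\<close>, hence
        \<open>z \<le> a0\<close>.\<close>
      define z where "z = Max ((\<lambda>c. \<bar>\<alpha> c\<bar>) ` C)"
      have "z \<in> (\<lambda>c. \<bar>\<alpha> c\<bar>) ` C"
        unfolding z_def using C x by (intro Max_in) auto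
      then obtain y where y: "y \<in> C" "z = \<bar>\<alpha> y\<bar>" by auto
      have le: "\<bar>\<alpha> c\<bar> \<le> z" if "c \<in> C" for c
        unfolding z_def using C that by (intro Max_ge) auto
      have "\<kappa> * z\<^sup>2 \<le> R * (\<Sum>c\<in>C. \<bar>\<alpha> c\<bar>)"
        using k(2)[OF y(1), of \<alpha>] qa y(2) by simp
      also have "\<dots> \<le> R * (\<Sum>c\<in>C. z)"
        using le R by (intro mult_left_mono sum_mono) auto
      also have "\<dots> = \<kappa> * (a0 * z)"
        using k by (simp add: a0_def)
      finally have "z * z \<le> a0 * z"
        using k(1) by (simp add: power2_eq_square)
      moreover have "0 \<le> z" using y(2) by simp
      ultimately have "z \<le> a0"
        using a0 by (cases "z = 0") (auto simp: mult_le_cancel_right)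
      then show ?thesis using le[OF x] by simp
    qed
    have "\<bar>\<Sum>c'\<in>C. S c c' * \<alpha> c'\<bar> \<le> (\<Sum>c'\<in>C. \<bar>S c c'\<bar> * a0)"
      by (rule order_trans[OF sum_abs], rule sum_mono) (simp add: abs_mult mult_left_mono a_le)
    then have Sa: "\<bar>\<Sum>c'\<in>C. S c c' * \<alpha> c'\<bar> \<le> (\<Sum>c'\<in>C. \<bar>S c c'\<bar>) * a0"
      by (simp add: sum_distrib_right)
    have Sa0: "0 \<le> (\<Sum>c'\<in>C. \<bar>S c c'\<bar>) * a0"
      using a0 by (intro mult_nonneg_nonneg sum_nonneg) auto
    have va0: "0 \<le> v c * a0" using v[OF c] a0 by simp
    have TT: "T c \<le> (\<Sum>c\<in>C. T c)"
      by (rule member_le_sum[OF c _ C]) (use T0 in auto)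
    have "\<bar>?\<mu> c\<bar> \<le> T c"
      unfolding mu T_def using Sa va0 by linarith
    moreover have "\<bar>?s c - ?n c * ?\<mu> c\<bar> \<le> T c"
    proof -
      have "\<bar>?s c - ?n c * ?\<mu> c\<bar> = v c * \<bar>\<alpha> c\<bar>"
        using va[OF c] v[OF c] by (simp add: abs_mult flip: va[OF c])
      also have "\<dots> \<le> v c * a0"
        using v[OF c] a_le[OF c] by simp
      finally show ?thesis unfolding T_def using Sa0 by linarith
    qed
    ultimately show "\<bar>?\<mu> c\<bar> \<le> (\<Sum>c\<in>C. T c) \<and> \<bar>?s c - ?n c * ?\<mu> c\<bar> \<le> (\<Sum>c\<in>C. T c)"
      using TT by linarith
  qed
qed

text \<open>The fact \<open>quad\<close> in the proof writes the posterior variance as a sum of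
  nonnegative terms. Keeping only the term of \<open>c\<close> in the weighted sum of squares gives
  the upper bound; the lower bound adds coercivity of the form at \<open>c\<close>.\<close>

lemma gp_post_var_bounds:
  assumes C: "finite C" and S: "strictly_pos_def_on C S" and v: "\<And>c. c \<in> C \<Longrightarrow> v c > 0"
  obtains l where "l > 0"
    "\<And>D c. set D \<subseteq> C \<Longrightarrow> c \<in> C \<Longrightarrow> l / (real (count_list D c) + 1) \<le> gp_post_cov S v D c c"
    "\<And>D c. set D \<subseteq> C \<Longrightarrow> c \<in> C \<Longrightarrow> count_list D c > 0 \<Longrightarrow>
       gp_post_cov S v D c c \<le> v c / real (count_list D c)"
proof -
  obtain \<kappa> where k: "\<kappa> > 0" "\<And>u c. c \<in> C \<Longrightarrow> \<kappa> * (u c)\<^sup>2 \<le> quad C S u"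
    using strictly_pos_def_coercive[OF C S] by blast
  define l where "l = Min (insert (\<kappa> / 4) ((\<lambda>c. v c / 2) ` C))"
  have l: "l > 0"
    unfolding l_def using C k v by (subst Min_gr_iff) auto
  have lk: "l \<le> \<kappa> / 4" unfolding l_def using C by (intro Min_le) auto
  have lv: "l \<le> v c / 2" if "c \<in> C" for c
    unfolding l_def using C that by (intro Min_le) auto
  have main: "l / (real (count_list D c) + 1) \<le> gp_post_cov S v D c c \<and>
     (count_list D c > 0 \<longrightarrow> gp_post_cov S v D c c \<le> v c / real (count_list D c))"
    if D: "set D \<subseteq> C" and c: "c \<in> C" for D c
  proof -
    let ?n = "\<lambda>x. real (count_list D x)"
    obtain w where w:
      "\<And>x. vec (length D) (\<lambda>i. S x (D ! i)) \<bullet> (gp_noisy_cov_inv S v D *\<^sub>v vec (length D) (\<lambda>i. S (D ! i) c))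
         = (\<Sum>c'\<in>C. S x c' * w c')"
      "\<And>x. x \<in> C \<Longrightarrow> v x * w x = list_agg D (\<lambda>i. S (D ! i) c) x - ?n x * (\<Sum>c'\<in>C. S x c' * w c')"
      using gp_reduction[where v=v and y="\<lambda>i. S (D ! i) c", OF C D S v] by blast
    define \<tau> where "\<tau> x = gp_post_cov S v D x c" for x
    have tau: "\<tau> x = S x c - (\<Sum>c'\<in>C. S x c' * w c')" for x
      unfolding \<tau>_def gp_post_cov_def w(1) by simp
    have agg: "list_agg D (\<lambda>i. S (D ! i) c) x = ?n x * S x c" for x
      using list_agg_linear[of D "\<lambda>_. 0" "\<lambda>d. - S d c" x] list_agg_const[of D 0 x] by simp
    have vw: "w x = ?n x * \<tau> x / v x" if "x \<in> C" for x
      using w(2)[OF that] v[OF that] by (simp add: agg tau field_simps)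
    define u where "u x = (if x = c then 1 else 0) - w x" for x
    have Su: "(\<Sum>c'\<in>C. S x c' * u c') = \<tau> x" for x
    proof -
      have "(\<Sum>c'\<in>C. S x c' * u c') = (\<Sum>c'\<in>C. (if c' = c then S x c' else 0) - S x c' * w c')"
        unfolding u_def by (intro sum.cong) (auto simp: algebra_simps)
      then show ?thesis using C c by (simp add: sum_subtractf tau)
    qed
    have "quad C S u = (\<Sum>x\<in>C. u x * \<tau> x)"
      unfolding quad_eq Su ..
    also have "\<dots> = (\<Sum>x\<in>C. (if x = c then \<tau> x else 0) - ?n x * (\<tau> x)\<^sup>2 / v x)"
      unfolding u_def by (intro sum.cong) (auto simp: vw algebra_simps power2_eq_square)
    also have "\<dots> = \<tau> c - (\<Sum>x\<in>C. ?n x * (\<tau> x)\<^sup>2 / v x)"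
      using C c by (simp add: sum_subtractf)
    finally have quad: "\<tau> c = quad C S u + (\<Sum>x\<in>C. ?n x * (\<tau> x)\<^sup>2 / v x)"
      by simp
    have "?n c * (\<tau> c)\<^sup>2 / v c \<le> (\<Sum>x\<in>C. ?n x * (\<tau> x)\<^sup>2 / v x)"
      by (rule member_le_sum[OF c _ C]) (use v in \<open>auto simp: less_imp_le\<close>)
    with quad have ge: "\<tau> c \<ge> quad C S u + ?n c * (\<tau> c)\<^sup>2 / v c"
      by simp
    have q0: "quad C S u \<ge> 0" by (rule quad_nonneg[OF S])
    have t0: "\<tau> c \<ge> 0"
      using ge q0 v[OF c] by (smt (verit) divide_nonneg_pos mult_nonneg_nonneg of_nat_0_le_iff zero_le_power2)
    \<comment> \<open>The ratio of the posterior variance to its upper bound (0 for an unsampled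
      context); moreover \<open>u c = 1 - r\<close>.\<close>
    define r where "r = ?n c * \<tau> c / v c"
    have r0: "r \<ge> 0" using t0 v[OF c] by (simp add: r_def)
    have "\<kappa> * (1 - r)\<^sup>2 \<le> quad C S u"
      using k(2)[OF c, of u] by (simp add: u_def vw[OF c] r_def)
    then have ge2: "\<tau> c \<ge> \<kappa> * (1 - r)\<^sup>2 + r * \<tau> c"
      using ge by (simp add: r_def power2_eq_square)
    have "l / (?n c + 1) \<le> \<tau> c"
    \<comment> \<open>Either the variance is at least half its upper bound, which accounts for
      \<open>v c / 2\<close> in \<open>l\<close>, or \<open>(1 - r)\<^sup>2\<close> is at least
      \<open>1 / 4\<close>, which accounts for \<open>\<kappa> / 4\<close>.\<close>
    proof (cases "r \<ge> 1 / 2")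
      case True
      then have n: "?n c > 0"
        by (cases "count_list D c = 0") (auto simp: r_def)
      have "v c / 2 \<le> ?n c * \<tau> c"
        using True v[OF c] by (simp add: r_def field_simps)
      also have "\<dots> \<le> (?n c + 1) * \<tau> c"
        using t0 by (simp add: algebra_simps)
      finally have "l \<le> (?n c + 1) * \<tau> c"
        using lv[OF c] by simp
      then show ?thesis by (simp add: divide_le_eq mult.commute add_nonneg_pos)
    next
      case False
      then have "(1 / 2)\<^sup>2 \<le> (1 - r)\<^sup>2"
        by (intro power_mono) auto
      then have "\<kappa> * (1 / 2)\<^sup>2 \<le> \<kappa> * (1 - r)\<^sup>2"
        using k(1) by (intro mult_left_mono) auto
      then have "\<kappa> / 4 \<le> \<kappa> * (1 - r)\<^sup>2"
        by (simp add: power2_eq_square)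
      moreover have "0 \<le> r * \<tau> c" using r0 t0 by simp
      ultimately have "l \<le> \<tau> c" using ge2 lk by linarith
      moreover have "l / (?n c + 1) \<le> l"
        using l by (simp add: divide_le_eq algebra_simps)
      ultimately show ?thesis by simp
    qed
    moreover have "\<tau> c \<le> v c / ?n c" if n: "count_list D c > 0"
    proof (cases "\<tau> c = 0")
      case True
      then show ?thesis using v[OF c] by (simp add: less_imp_le)
    next
      case False
      with t0 have tp: "\<tau> c > 0" by simp
      have "r * \<tau> c \<le> 1 * \<tau> c"
        using ge q0 by (simp add: r_def power2_eq_square)
      then have "r \<le> 1" using tp by simp
      then show ?thesis
        using n v[OF c] by (simp add: r_def field_simps)
    qed
    ultimately show ?thesis by (simp add: \<tau>_def)
  qed
  show thesis
    by (rule that[OF l]) (use main in blast)+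
qed

section \<open>The sample path of the policy\<close>

lemma list_agg_map:
  "list_agg (map fst zs) (\<lambda>i. map snd zs ! i) c = sum_list (map snd (filter (\<lambda>z. fst z = c) zs))"
proof (induction zs rule: rev_induct)
  case (snoc z zs)
  have "list_agg (map fst (zs @ [z])) (\<lambda>i. map snd (zs @ [z]) ! i) c
      = list_agg (map fst zs) (\<lambda>i. map snd zs ! i) c + (if fst z = c then snd z else 0)"
    unfolding list_agg_def by (auto simp: nth_append intro!: sum.cong)
  then show ?case using snoc by simp
qed (simp add: list_agg_def)

locale gp_c_ocba_setting = gp_c_ocba K C F s2 mu0 S0 N0 init tie_alt tie_pair
  for K :: "'k set" and C :: "'c set" and F s2 mu0 :: "'k \<Rightarrow> 'c \<Rightarrow> real"
    and S0 :: "'k \<Rightarrow> 'c \<Rightarrow> 'c \<Rightarrow> real" and N0 and init and tie_alt and tie_pair +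
  assumes finite_K: "finite K" and card_K: "card K \<ge> 2"
    and finite_C: "finite C" and C_nonempty: "C \<noteq> {}"
    and s2_pos: "\<And>k c. k \<in> K \<Longrightarrow> c \<in> C \<Longrightarrow> s2 k c > 0"
    and init_in: "\<And>n. n < N0 \<Longrightarrow> init n \<in> K \<times> C"
    and tie_alt_in: "\<And>n c A. A \<noteq> {} \<Longrightarrow> tie_alt n c A \<in> A"
    and tie_pair_in: "\<And>n A. A \<noteq> {} \<Longrightarrow> tie_pair n A \<in> A"
    and S0_pos_def: "\<And>k. k \<in> K \<Longrightarrow> strictly_pos_def_on C (S0 k)"
begin

definition obs :: "(nat \<times> 'k \<times> 'c \<Rightarrow> real) \<Rightarrow> nat \<Rightarrow> ('k, 'c) history" where
  "obs x n = history (\<lambda>j k c. x (j, k, c)) n"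

definition cnt :: "(nat \<times> 'k \<times> 'c \<Rightarrow> real) \<Rightarrow> nat \<Rightarrow> 'k \<times> 'c \<Rightarrow> nat" where
  "cnt x n a = num_samples (obs x n) (fst a) (snd a)"

definition decide :: "nat \<Rightarrow> ('k, 'c) history \<Rightarrow> 'k \<times> 'c" where
  "decide n h = (if n < N0 then init n else next_sample h)"

definition pick :: "(nat \<times> 'k \<times> 'c \<Rightarrow> real) \<Rightarrow> nat \<Rightarrow> 'k \<times> 'c" where
  "pick x n = decide n (obs x n)"

lemma K_nonempty: "K \<noteq> {}"
  using card_K by auto

lemma obs_0 [simp]: "obs x 0 = []"
  by (simp add: obs_def)

lemma obs_Suc:
  "obs x (Suc n) = obs x n @ [(pick x n, F (fst (pick x n)) (snd (pick x n)) + x (cnt x n (pick x n), pick x n))]"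
  by (simp add: obs_def pick_def decide_def cnt_def Let_def split: prod.split)

lemma length_obs [simp]: "length (obs x n) = n"
  by (induction n) (auto simp: obs_Suc)

lemma cnt_Suc: "cnt x (Suc n) a = cnt x n a + (if pick x n = a then 1 else 0)"
  by (cases a) (simp add: cnt_def obs_Suc num_samples_def)

lemma cnt_0: "cnt x 0 a = 0"
  by (simp add: cnt_def num_samples_def)

lemma predicted_best_max:
  "predicted_best h c \<in> K" "k \<in> K \<Longrightarrow> post_mean h k c \<le> post_mean h (predicted_best h c) c"
proof -
  let ?A = "{k. is_arg_max (\<lambda>k. post_mean h k c) (\<lambda>k. k \<in> K) k}"
  have "Max ((\<lambda>k. post_mean h k c) ` K) \<in> (\<lambda>k. post_mean h k c) ` K"
    using finite_K K_nonempty by (intro Max_in) auto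
  then obtain b where b: "b \<in> K" "post_mean h b c = Max ((\<lambda>k. post_mean h k c) ` K)"
    by auto
  then have "post_mean h k c \<le> post_mean h b c" if "k \<in> K" for k
    using finite_K that by simp
  then have "b \<in> ?A"
    using b by (auto simp: is_arg_max_def not_less)
  then have "predicted_best h c \<in> ?A"
    unfolding predicted_best_def by (intro tie_alt_in) auto
  then show "predicted_best h c \<in> K" "k \<in> K \<Longrightarrow> post_mean h k c \<le> post_mean h (predicted_best h c) c"
    by (auto simp: is_arg_max_def not_less)
qed

text \<open>Since \<open>K\<close> has two elements, the set of candidate pairs is finite and
  nonempty, so the tie rule returns a true minimiser of \<zeta>. The pathwise arguments see the
  sampling rule only through these alternatives.\<close>

lemma next_sample_cases:
  assumes "next_sample h = (k, c)"
  shows "c \<in> C" "k \<in> K"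
    "k = predicted_best h c \<and> psi1 h c < psi2 h c \<or>
     k \<noteq> predicted_best h c \<and> \<not> psi1 h c < psi2 h c \<and>
       (\<forall>k'\<in>K. \<forall>c'\<in>C. k' \<noteq> predicted_best h c' \<longrightarrow> zeta h k c \<le> zeta h k' c')"
proof -
  let ?P = "\<lambda>(k, c). c \<in> C \<and> k \<in> K \<and> k \<noteq> predicted_best h c"
  let ?f = "\<lambda>(k, c). zeta h k c"
  have fin: "finite {p. ?P p}"
    by (rule finite_subset[of _ "K \<times> C"]) (use finite_K finite_C in auto)
  have "\<exists>p. ?P p"
  proof -
    obtain c0 where "c0 \<in> C" using C_nonempty by blast
    have "\<not> K \<subseteq> {predicted_best h c0}"
      using card_K card_mono[of "{predicted_best h c0}" K] by auto
    then show ?thesis using \<open>c0 \<in> C\<close> by auto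
  qed
  then have ne: "{p. ?P p} \<noteq> {}" by auto
  have "Min (?f ` {p. ?P p}) \<in> ?f ` {p. ?P p}"
    using fin ne by (intro Min_in) auto
  then obtain p where p: "?P p" "?f p = Min (?f ` {p. ?P p})"
    by auto
  have "?f p \<le> ?f q" if "?P q" for q
    unfolding p(2) by (rule Min_le) (use fin that in auto)
  then have "is_arg_min ?f ?P p"
    using p(1) unfolding is_arg_min_def not_less by (auto simp: not_less)
  then have "tie_pair (length h) {p. is_arg_min ?f ?P p} \<in> {p. is_arg_min ?f ?P p}"
    by (intro tie_pair_in) blast
  moreover obtain k0 c0 where t: "tie_pair (length h) {p. is_arg_min ?f ?P p} = (k0, c0)"
    by fastforce
  ultimately have a: "is_arg_min ?f ?P (k0, c0)" by simp
  then have a1: "c0 \<in> C" "k0 \<in> K" "k0 \<noteq> predicted_best h c0"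
    by (auto simp: is_arg_min_def)
  have a2: "zeta h k0 c0 \<le> zeta h k' c'" if "k' \<in> K" "c' \<in> C" "k' \<noteq> predicted_best h c'" for k' c'
  proof -
    have "?P (k', c')" using that by simp
    then have "\<not> ?f (k', c') < ?f (k0, c0)" using a unfolding is_arg_min_def by blast
    then show ?thesis by simp
  qed
  have ns: "next_sample h = (if psi1 h c0 < psi2 h c0 then (predicted_best h c0, c0) else (k0, c0))"
    unfolding next_sample_def t by simp
  show "c \<in> C" "k \<in> K" "k = predicted_best h c \<and> psi1 h c < psi2 h c \<or>
     k \<noteq> predicted_best h c \<and> \<not> psi1 h c < psi2 h c \<and>
       (\<forall>k'\<in>K. \<forall>c'\<in>C. k' \<noteq> predicted_best h c' \<longrightarrow> zeta h k c \<le> zeta h k' c')"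
    using assms ns a1 a2 predicted_best_max(1)[of h c0] by (auto split: if_splits)
qed

lemma decide_in: "decide n h \<in> K \<times> C"
  using init_in[of n] next_sample_cases(1,2)[of h] by (cases "next_sample h") (auto simp: decide_def)

lemma pick_in: "pick x n \<in> K \<times> C"
  by (simp add: pick_def decide_in)

lemma set_obs: "fst ` set (obs x n) \<subseteq> K \<times> C"
  by (induction n) (use pick_in in \<open>auto simp: obs_Suc\<close>)

lemma cnt_mono: "m \<le> n \<Longrightarrow> cnt x m a \<le> cnt x n a"
  by (rule lift_Suc_mono_le[of "\<lambda>n. cnt x n a"]) (simp add: cnt_Suc)

lemma count_list_contexts:
  "count_list (map (snd \<circ> fst) (samples_of h k)) c = num_samples h k c"
  unfolding samples_of_def num_samples_def by (induction h) auto

text \<open>Because noise is indexed by replication, the observations of a pair use exactly its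
  first \<open>cnt\<close> noises, whatever the times of sampling.\<close>

lemma list_agg_obs:
  "list_agg (map (snd \<circ> fst) (samples_of (obs x n) k)) (\<lambda>i. map snd (samples_of (obs x n) k) ! i) c
     = real (cnt x n (k, c)) * F k c + walk x (k, c) (cnt x n (k, c))"
proof -
  have agg: "list_agg (map (snd \<circ> fst) (samples_of h k)) (\<lambda>i. map snd (samples_of h k) ! i) c
     = sum_list (map snd (filter (\<lambda>s. fst s = (k, c)) h))" for h
  proof -
    have "list_agg (map (snd \<circ> fst) (samples_of h k)) (\<lambda>i. map snd (samples_of h k) ! i) c
        = sum_list (map snd (filter (\<lambda>z. fst z = c) (map (\<lambda>s. (snd (fst s), snd s)) (samples_of h k))))"
      using list_agg_map[of "map (\<lambda>s. (snd (fst s), snd s)) (samples_of h k)" c]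
      by (simp add: comp_def)
    also have "\<dots> = sum_list (map snd (filter (\<lambda>s. fst s = (k, c)) h))"
      unfolding samples_of_def by (induction h) auto
    finally show ?thesis .
  qed
  show ?thesis unfolding agg
    by (induction n) (auto simp: obs_Suc cnt_Suc cnt_0 walk_def algebra_simps)
qed

lemma psi_less_iff:
  assumes "n > 0"
  shows "psi1 (obs x n) c < psi2 (obs x n) c \<longleftrightarrow>
    real (cnt x n (predicted_best (obs x n) c, c)) / post_var (obs x n) (predicted_best (obs x n) c) c
      < (\<Sum>k\<in>K - {predicted_best (obs x n) c}. real (cnt x n (k, c)) / post_var (obs x n) k c)"
proof -
  have e2: "psi2 (obs x n) c = (\<Sum>k\<in>K - {predicted_best (obs x n) c}. real (cnt x n (k, c)) / post_var (obs x n) k c) / real n"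
    by (simp add: psi2_def frac_samples_def cnt_def sum_divide_distrib mult.commute)
  have e1: "psi1 (obs x n) c
     = real (cnt x n (predicted_best (obs x n) c, c)) / post_var (obs x n) (predicted_best (obs x n) c) c / real n"
    by (simp add: psi1_def frac_samples_def cnt_def mult.commute)
  show ?thesis unfolding e1 e2 by (subst divide_less_cancel) (use assms in simp)
qed

lemma unbounded_iff_picked:
  "(\<forall>m. \<exists>n. m \<le> cnt x n a) \<longleftrightarrow> (\<forall>N. \<exists>n\<ge>N. pick x n = a)"
proof (intro iffI allI)
  fix N assume unb: "\<forall>m. \<exists>n. m \<le> cnt x n a"
  show "\<exists>n\<ge>N. pick x n = a"
  proof (rule ccontr)
    assume no: "\<not> (\<exists>n\<ge>N. pick x n = a)"
    have "cnt x (N + d) a = cnt x N a" for d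
      by (induction d) (use no in \<open>auto simp: cnt_Suc\<close>)
    then have "cnt x n a \<le> cnt x N a" for n
      using cnt_mono[of n "N + n" x a] by simp
    then show False using unb by (metis not_less_eq_eq)
  qed
next
  fix m assume pk: "\<forall>N. \<exists>n\<ge>N. pick x n = a"
  show "\<exists>n. m \<le> cnt x n a"
  proof (induction m)
    case (Suc m)
    then obtain n where "m \<le> cnt x n a" by blast
    moreover obtain n' where "n' \<ge> n" "pick x n' = a" using pk by blast
    ultimately have "Suc m \<le> cnt x (Suc n') a"
      using cnt_mono[of n n' x a] by (simp add: cnt_Suc)
    then show ?case by blast
  qed simp
qed

section \<open>Posterior bounds along a sample path\<close>

definition posterior_bounds :: "(nat \<times> 'k \<times> 'c \<Rightarrow> real) \<Rightarrow> real \<Rightarrow> real \<Rightarrow> real \<Rightarrow> bool" where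
  "posterior_bounds x A l V \<longleftrightarrow> A \<ge> 0 \<and> l > 0 \<and> V > 0 \<and> (\<forall>n. \<forall>k\<in>K. \<forall>c\<in>C.
     \<bar>post_mean (obs x n) k c\<bar> \<le> A \<and>
     l / (real (cnt x n (k, c)) + 1) \<le> post_var (obs x n) k c \<and>
     (cnt x n (k, c) > 0 \<longrightarrow>
        \<bar>F k c + walk x (k, c) (cnt x n (k, c)) / real (cnt x n (k, c)) - post_mean (obs x n) k c\<bar>
          \<le> A / real (cnt x n (k, c)) \<and>
        post_var (obs x n) k c \<le> V / real (cnt x n (k, c))))"

text \<open>Convergence of the noise averages is used for their boundedness; with the gap between
  \<open>F\<close> and the prior mean it gives the data hypothesis of
  \<open>gp_post_mean_bounds\<close> for all \<open>n\<close> at once, for starved pairs as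
  well.\<close>

lemma posterior_bounds_exist:
  assumes slln: "\<And>a. a \<in> K \<times> C \<Longrightarrow> (\<lambda>n. walk x a n / real n) \<longlonglongrightarrow> 0"
  obtains A l V where "posterior_bounds x A l V"
proof -
  have "\<exists>A l. A \<ge> 0 \<and> l > 0 \<and> (\<forall>n. \<forall>c\<in>C.
     \<bar>post_mean (obs x n) k c\<bar> \<le> A \<and>
     l / (real (cnt x n (k, c)) + 1) \<le> post_var (obs x n) k c \<and>
     (cnt x n (k, c) > 0 \<longrightarrow>
        \<bar>F k c + walk x (k, c) (cnt x n (k, c)) / real (cnt x n (k, c)) - post_mean (obs x n) k c\<bar>
          \<le> A / real (cnt x n (k, c)) \<and>
        post_var (obs x n) k c \<le> s2 k c / real (cnt x n (k, c))))" if k: "k \<in> K" for k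
  proof -
    have "\<exists>R. \<forall>c\<in>C. \<forall>n. \<bar>walk x (k, c) n / real n\<bar> \<le> R"
    proof -
      have "\<exists>R. \<forall>n. \<bar>walk x (k, c) n / real n\<bar> \<le> R" if "c \<in> C" for c
      proof -
        have "Bseq (\<lambda>n. walk x (k, c) n / real n)"
          using slln[of "(k, c)"] k that by (intro convergent_imp_Bseq convergentI) auto
        then show ?thesis unfolding Bseq_def by auto
      qed
      then obtain r where r: "\<And>c n. c \<in> C \<Longrightarrow> \<bar>walk x (k, c) n / real n\<bar> \<le> r c" by metis
      have "r c \<le> Max (r ` C)" if "c \<in> C" for c using finite_C that by simp
      then show ?thesis using r by (intro exI[of _ "Max (r ` C)"]) (auto intro: order_trans)
    qed
    then obtain R where R: "\<And>c n. c \<in> C \<Longrightarrow> \<bar>walk x (k, c) n / real n\<bar> \<le> R" by blast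
    define R1 where "R1 = \<bar>R\<bar> + (\<Sum>c\<in>C. \<bar>F k c - mu0 k c\<bar>)"
    have R1: "R1 \<ge> 0" by (simp add: R1_def sum_nonneg)
    let ?D = "\<lambda>n. map (snd \<circ> fst) (samples_of (obs x n) k)"
    let ?Y = "\<lambda>n. map snd (samples_of (obs x n) k)"
    have setD: "set (?D n) \<subseteq> C" for n
      using set_obs[of x n] by (force simp: samples_of_def)
    have cl: "count_list (?D n) c = cnt x n (k, c)" for n c
      using count_list_contexts[of "obs x n" k c] by (simp add: cnt_def)
    have agg: "\<bar>list_agg (?D n) (\<lambda>i. ?Y n ! i) c - real (count_list (?D n) c) * mu0 k c\<bar>
        \<le> R1 * real (count_list (?D n) c)" if c: "c \<in> C" for n c
    proof -
      let ?q = "cnt x n (k, c)"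
      have w: "\<bar>walk x (k, c) ?q\<bar> \<le> R * real ?q"
        using R[OF c, of ?q] by (cases "?q = 0") (auto simp: walk_def field_simps)
      also have "\<dots> \<le> \<bar>R\<bar> * real ?q" by (rule mult_right_mono) auto
      finally have w: "\<bar>walk x (k, c) ?q\<bar> \<le> \<bar>R\<bar> * real ?q" .
      have "\<bar>F k c - mu0 k c\<bar> \<le> (\<Sum>c\<in>C. \<bar>F k c - mu0 k c\<bar>)"
        by (rule member_le_sum[OF c _ finite_C]) auto
      then have "\<bar>F k c - mu0 k c\<bar> * real ?q \<le> (\<Sum>c\<in>C. \<bar>F k c - mu0 k c\<bar>) * real ?q"
        by (rule mult_right_mono) auto
      moreover have "\<bar>(F k c - mu0 k c) * real ?q\<bar> = \<bar>F k c - mu0 k c\<bar> * real ?q"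
        by (simp add: abs_mult)
      moreover have "list_agg (?D n) (\<lambda>i. ?Y n ! i) c - real (count_list (?D n) c) * mu0 k c
         = (F k c - mu0 k c) * real ?q + walk x (k, c) ?q"
        unfolding list_agg_obs cl by (simp add: algebra_simps)
      ultimately show ?thesis
        unfolding cl R1_def using w by (simp add: distrib_right)
    qed
    obtain A where A: "A \<ge> 0"
      "\<And>D Y c. \<lbrakk>set D \<subseteq> C; \<And>c. c \<in> C \<Longrightarrow>
        \<bar>list_agg D (\<lambda>i. Y ! i) c - real (count_list D c) * mu0 k c\<bar> \<le> R1 * real (count_list D c); c \<in> C\<rbrakk> \<Longrightarrow>
      \<bar>gp_post_mean (mu0 k) (S0 k) (s2 k) D Y c\<bar> \<le> A \<and>
      \<bar>list_agg D (\<lambda>i. Y ! i) c - real (count_list D c) * gp_post_mean (mu0 k) (S0 k) (s2 k) D Y c\<bar> \<le> A"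
      using gp_post_mean_bounds[where v="s2 k" and m="mu0 k", OF finite_C S0_pos_def[OF k] s2_pos[OF k] R1] by blast
    obtain l where l: "l > 0"
      "\<And>D c. set D \<subseteq> C \<Longrightarrow> c \<in> C \<Longrightarrow> l / (real (count_list D c) + 1) \<le> gp_post_cov (S0 k) (s2 k) D c c"
      "\<And>D c. set D \<subseteq> C \<Longrightarrow> c \<in> C \<Longrightarrow> count_list D c > 0 \<Longrightarrow>
         gp_post_cov (S0 k) (s2 k) D c c \<le> s2 k c / real (count_list D c)"
      using gp_post_var_bounds[where v="s2 k", OF finite_C S0_pos_def[OF k] s2_pos[OF k]] by blast
    show ?thesis
    proof (rule exI[of _ A], rule exI[of _ l], intro conjI allI ballI impI A(1) l(1))
      fix n c assume c: "c \<in> C"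
      show "\<bar>post_mean (obs x n) k c\<bar> \<le> A"
        using A(2)[OF setD agg c] by (simp add: post_mean_def)
      show "l / (real (cnt x n (k, c)) + 1) \<le> post_var (obs x n) k c"
        using l(2)[OF setD[of n] c] by (simp add: cl post_var_def)
      assume q: "cnt x n (k, c) > 0"
      show "post_var (obs x n) k c \<le> s2 k c / real (cnt x n (k, c))"
        using l(3)[OF setD[of n] c] q by (simp add: cl post_var_def)
      have "\<bar>real (cnt x n (k, c)) * F k c + walk x (k, c) (cnt x n (k, c))
          - real (cnt x n (k, c)) * post_mean (obs x n) k c\<bar> \<le> A"
        using A(2)[OF setD agg c, of n] unfolding list_agg_obs cl post_mean_def by blast
      moreover have "F k c + walk x (k, c) (cnt x n (k, c)) / real (cnt x n (k, c)) - post_mean (obs x n) k c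
          = (real (cnt x n (k, c)) * F k c + walk x (k, c) (cnt x n (k, c))
          - real (cnt x n (k, c)) * post_mean (obs x n) k c) / real (cnt x n (k, c))"
        using q by (simp add: field_simps)
      ultimately show "\<bar>F k c + walk x (k, c) (cnt x n (k, c)) / real (cnt x n (k, c)) - post_mean (obs x n) k c\<bar>
          \<le> A / real (cnt x n (k, c))"
        using q by (simp add: abs_divide divide_right_mono)
    qed
  qed
  then obtain A l where Al: "\<And>k. k \<in> K \<Longrightarrow> A k \<ge> 0 \<and> l k > 0 \<and> (\<forall>n. \<forall>c\<in>C.
     \<bar>post_mean (obs x n) k c\<bar> \<le> A k \<and>
     l k / (real (cnt x n (k, c)) + 1) \<le> post_var (obs x n) k c \<and>
     (cnt x n (k, c) > 0 \<longrightarrow>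
        \<bar>F k c + walk x (k, c) (cnt x n (k, c)) / real (cnt x n (k, c)) - post_mean (obs x n) k c\<bar>
          \<le> A k / real (cnt x n (k, c)) \<and>
        post_var (obs x n) k c \<le> s2 k c / real (cnt x n (k, c))))"
    by metis
  define A' where "A' = Max (A ` K)"
  define l' where "l' = Min (l ` K)"
  define V' where "V' = Max ((\<lambda>(k, c). s2 k c) ` (K \<times> C))"
  have A': "A k \<le> A'" if "k \<in> K" for k
    unfolding A'_def using finite_K that by simp
  have l': "l' \<le> l k" if "k \<in> K" for k
    unfolding l'_def using finite_K that by simp
  have V': "s2 k c \<le> V'" if "k \<in> K" "c \<in> C" for k c
    unfolding V'_def using finite_K finite_C that by (intro Max_ge) auto
  obtain k0 c0 where kc0: "k0 \<in> K" "c0 \<in> C" using K_nonempty C_nonempty by blast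
  have "posterior_bounds x A' l' V'"
    unfolding posterior_bounds_def
  proof (intro conjI allI ballI impI)
    show "A' \<ge> 0" using A'[OF kc0(1)] Al[OF kc0(1)] by linarith
    show "l' > 0" unfolding l'_def using finite_K K_nonempty Al by (subst Min_gr_iff) auto
    show "V' > 0" using V'[OF kc0] s2_pos[OF kc0] by linarith
    fix n k c assume k: "k \<in> K" and c: "c \<in> C"
    note b = Al[OF k, THEN conjunct2, THEN conjunct2, rule_format, OF c, of n]
    show "\<bar>post_mean (obs x n) k c\<bar> \<le> A'"
      using b A'[OF k] by linarith
    have "l' / (real (cnt x n (k, c)) + 1) \<le> l k / (real (cnt x n (k, c)) + 1)"
      by (rule divide_right_mono[OF l'[OF k]]) simp
    then show "l' / (real (cnt x n (k, c)) + 1) \<le> post_var (obs x n) k c"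
      using b by linarith
    assume q: "cnt x n (k, c) > 0"
    have "A k / real (cnt x n (k, c)) \<le> A' / real (cnt x n (k, c))"
      by (rule divide_right_mono[OF A'[OF k]]) simp
    then show "\<bar>F k c + walk x (k, c) (cnt x n (k, c)) / real (cnt x n (k, c)) - post_mean (obs x n) k c\<bar>
          \<le> A' / real (cnt x n (k, c))"
      using b q by linarith
    have "s2 k c / real (cnt x n (k, c)) \<le> V' / real (cnt x n (k, c))"
      by (rule divide_right_mono[OF V'[OF k c]]) simp
    then show "post_var (obs x n) k c \<le> V' / real (cnt x n (k, c))"
      using b q by linarith
  qed
  then show thesis by (rule that)
qed

lemma posterior_boundsD:
  assumes "posterior_bounds x A l V" "k \<in> K" "c \<in> C"
  shows "\<bar>post_mean (obs x n) k c\<bar> \<le> A"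
    "l / (real (cnt x n (k, c)) + 1) \<le> post_var (obs x n) k c"
    "post_var (obs x n) k c > 0"
    "\<nu> > 0 \<Longrightarrow> \<nu> \<le> cnt x n (k, c) \<Longrightarrow>
        \<bar>F k c + walk x (k, c) (cnt x n (k, c)) / real (cnt x n (k, c)) - post_mean (obs x n) k c\<bar> \<le> A / real \<nu>"
    "\<nu> > 0 \<Longrightarrow> \<nu> \<le> cnt x n (k, c) \<Longrightarrow> post_var (obs x n) k c \<le> V / real \<nu>"
proof -
  have nn: "A \<ge> 0" "l > 0" "V > 0" using assms(1) by (auto simp: posterior_bounds_def)
  have b: "\<bar>post_mean (obs x n) k c\<bar> \<le> A \<and>
     l / (real (cnt x n (k, c)) + 1) \<le> post_var (obs x n) k c \<and>
     (cnt x n (k, c) > 0 \<longrightarrow>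
        \<bar>F k c + walk x (k, c) (cnt x n (k, c)) / real (cnt x n (k, c)) - post_mean (obs x n) k c\<bar>
          \<le> A / real (cnt x n (k, c)) \<and>
        post_var (obs x n) k c \<le> V / real (cnt x n (k, c)))"
    using assms unfolding posterior_bounds_def by blast
  then show "\<bar>post_mean (obs x n) k c\<bar> \<le> A"
    and lo: "l / (real (cnt x n (k, c)) + 1) \<le> post_var (obs x n) k c" by blast+
  have "0 < l / (real (cnt x n (k, c)) + 1)"
    using nn by (intro divide_pos_pos) auto
  then show "post_var (obs x n) k c > 0" using lo by linarith
  assume \<nu>: "\<nu> > 0" "\<nu> \<le> cnt x n (k, c)"
  then have "T / real (cnt x n (k, c)) \<le> T / real \<nu>" if "T \<ge> 0" for T
    using that by (intro divide_left_mono) auto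
  from this[of A] this[of V]
  show "\<bar>F k c + walk x (k, c) (cnt x n (k, c)) / real (cnt x n (k, c)) - post_mean (obs x n) k c\<bar> \<le> A / real \<nu>"
    "post_var (obs x n) k c \<le> V / real \<nu>"
    using b \<nu> nn by (auto intro: order_trans)
qed

section \<open>Excluding starved pairs\<close>

lemma eventually_cnt_ge:
  assumes "\<forall>m. \<exists>n. m \<le> cnt x n a"
  shows "\<forall>\<^sub>F n in sequentially. m \<le> cnt x n a"
proof -
  obtain n where "m \<le> cnt x n a" using assms by blast
  then have "m \<le> cnt x n' a" if "n' \<ge> n" for n'
    using cnt_mono[OF that, of x a] by simp
  then show ?thesis by (auto simp: eventually_sequentially)
qed

text \<open>
  A pair that is sampled only finitely often keeps its posterior variance, and hence some value of
  \<open>\<zeta>\<close>, bounded; so the minimum of \<open>\<zeta>\<close> stays bounded.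
\<close>

lemma zeta_bounded_if_starved:
  assumes pb: "posterior_bounds x A l V" and k1: "k1 \<in> K" and c1: "c1 \<in> C"
    and starved: "\<And>n. cnt x n (k1, c1) \<le> m"
  obtains Z where "Z \<ge> 0" "\<And>n. \<exists>k\<in>K. k \<noteq> predicted_best (obs x n) c1 \<and> zeta (obs x n) k c1 \<le> Z"
proof
  define l1 where "l1 = l / (real m + 1)"
  have l: "l > 0" using pb by (simp add: posterior_bounds_def)
  then have l1: "l1 > 0" by (simp add: l1_def add_nonneg_pos)
  show "(2 * A)\<^sup>2 / l1 \<ge> 0" using l1 by simp
  fix n
  let ?b = "predicted_best (obs x n) c1"
  have bK: "?b \<in> K" by (rule predicted_best_max)
  have v1: "post_var (obs x n) k1 c1 \<ge> l1"
  proof -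
    have "l1 \<le> l / (real (cnt x n (k1, c1)) + 1)"
      unfolding l1_def using l starved[of n] by (intro divide_left_mono) auto
    then show ?thesis using posterior_boundsD(2)[OF pb k1 c1, of n] by linarith
  qed
  have "\<not> K \<subseteq> {?b}"
    using card_K card_mono[of "{?b}" K] by auto
  \<comment> \<open>One of the two compared alternatives must be \<open>k1\<close>: it is
    \<open>k\<close> itself unless it is the predicted best, in which case any other
    \<open>k\<close> serves.\<close>
  then obtain k where k: "k \<in> K" "k \<noteq> ?b" "?b = k1 \<or> k = k1"
    using k1 by (cases "?b = k1") auto
  have "\<bar>post_mean (obs x n) ?b c1 - post_mean (obs x n) k c1\<bar> \<le> \<bar>2 * A\<bar>"
    using posterior_boundsD(1)[OF pb bK c1, of n] posterior_boundsD(1)[OF pb k(1) c1, of n] by linarith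
  then have num: "(post_mean (obs x n) ?b c1 - post_mean (obs x n) k c1)\<^sup>2 \<le> (2 * A)\<^sup>2"
    by (simp only: abs_le_square_iff)
  have den: "l1 \<le> post_var (obs x n) ?b c1 + post_var (obs x n) k c1"
    using k(3) v1 posterior_boundsD(3)[OF pb bK c1, of n] posterior_boundsD(3)[OF pb k(1) c1, of n]
    by (elim disjE) auto
  have "zeta (obs x n) k c1 \<le> (2 * A)\<^sup>2 / l1"
    unfolding zeta_def using num den l1 by (intro frac_le) auto
  then show "\<exists>k\<in>K. k \<noteq> ?b \<and> zeta (obs x n) k c1 \<le> (2 * A)\<^sup>2 / l1"
    using k by blast
qed

text \<open>Counts divided by variances stay bounded outside \<open>I\<close> and exceed that bound
  inside \<open>I\<close> at late times. Through the comparison of the two \<psi> this puts the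
  predicted best into \<open>I\<close> and forces a second element into \<open>I\<close>.\<close>

lemma all_pairs_sampled:
  assumes pb: "posterior_bounds x A l V"
    and slln: "\<And>a. a \<in> K \<times> C \<Longrightarrow> (\<lambda>n. walk x a n / real n) \<longlonglongrightarrow> 0"
    and nc: "\<And>I G n1. I \<subseteq> K \<times> C \<Longrightarrow> card I \<ge> 2 \<Longrightarrow> \<not> competitive cnt I G n1 x"
    and kc1: "(k1, c1) \<in> K \<times> C"
  shows "\<forall>m. \<exists>n. m \<le> cnt x n (k1, c1)"
proof (rule ccontr)
  assume "\<not> (\<forall>m. \<exists>n. m \<le> cnt x n (k1, c1))"
  then obtain m1 where m1: "\<And>n. cnt x n (k1, c1) \<le> m1"
    by (metis nat_le_linear)
  have A: "A \<ge> 0" and l: "l > 0" and V: "V > 0"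
    using pb by (auto simp: posterior_bounds_def)
  obtain Z where Z: "Z \<ge> 0" "\<And>n. \<exists>k\<in>K. k \<noteq> predicted_best (obs x n) c1 \<and> zeta (obs x n) k c1 \<le> Z"
    using zeta_bounded_if_starved[OF pb _ _ m1] kc1 by blast
  define inf where "inf a \<longleftrightarrow> (\<forall>m. \<exists>n. m \<le> cnt x n a)" for a
  have fin_ev: "\<forall>\<^sub>F n in sequentially. pick x n \<noteq> a" if "\<not> inf a" for a
    using that unfolding inf_def unbounded_iff_picked eventually_sequentially by blast
  have finKC: "finite (K \<times> C)" using finite_K finite_C by simp
  have ev_inf: "\<forall>\<^sub>F n in sequentially. inf (pick x n)"
  proof -
    have "\<forall>\<^sub>F n in sequentially. \<forall>a\<in>{a\<in>K \<times> C. \<not> inf a}. pick x n \<noteq> a"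
      using finKC fin_ev by (intro eventually_ball_finite) auto
    then show ?thesis
      by eventually_elim (use pick_in in blast)
  qed
  then obtain n0 where "inf (pick x n0)" by (auto simp: eventually_sequentially)
  moreover obtain k0 c where kc: "pick x n0 = (k0, c)" by fastforce
  ultimately have k0: "inf (k0, c)" "k0 \<in> K" and c: "c \<in> C"
    using pick_in[of x n0] by auto
  define I where "I = {k\<in>K. inf (k, c)}"
  have k0I: "k0 \<in> I" and IK: "I \<subseteq> K" and finI: "finite I"
    using k0 finite_K by (auto simp: I_def)
  have I_ge: "\<forall>\<^sub>F n in sequentially. \<forall>k\<in>I. \<nu> \<le> cnt x n (k, c)" for \<nu>
    using finI eventually_cnt_ge by (intro eventually_ball_finite) (auto simp: I_def inf_def)
  \<comment> \<open>\<open>n\<close> times a summand of \<psi>; the common factor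
    \<open>1 / n\<close> does not affect the comparison.\<close>
  define q where "q n k = real (cnt x n (k, c)) / post_var (obs x n) k c" for n k
  have q0: "q n k \<ge> 0" if "k \<in> K" for n k
    unfolding q_def using posterior_boundsD(3)[OF pb that c, of n] by simp
  have "\<exists>B. \<forall>n. q n k \<le> B" if k: "k \<in> K - I" for k
  proof -
    from k have kK: "k \<in> K" and "\<not> inf (k, c)" by (auto simp: I_def)
    then obtain m where m: "\<And>n. cnt x n (k, c) \<le> m"
      unfolding inf_def by (metis nat_le_linear)
    have "q n k \<le> real m / (l / (real m + 1))" for n
    proof -
      have "l / (real m + 1) \<le> l / (real (cnt x n (k, c)) + 1)"
        using l m[of n] by (intro divide_left_mono) auto
      also have "\<dots> \<le> post_var (obs x n) k c"
        by (rule posterior_boundsD(2)[OF pb kK c])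
      finally show ?thesis
        unfolding q_def using m[of n] l by (intro frac_le divide_pos_pos) auto
    qed
    then show ?thesis by blast
  qed
  then obtain B0 where B0: "\<And>k n. k \<in> K - I \<Longrightarrow> q n k \<le> B0 k" by metis
  define B where "B = (\<Sum>k\<in>K - I. \<bar>B0 k\<bar>)"
  have B: "(\<Sum>k\<in>K - I. q n k) \<le> B" for n
    unfolding B_def using B0 by (intro sum_mono) (meson abs_ge_self order_trans)
  \<comment> \<open>A variance is at most \<open>V\<close> after one sample, so
    \<open>\<nu>0\<close> samples give \<open>q \<ge> \<nu>0 / V > B\<close>.\<close>
  obtain \<nu>0 :: nat where \<nu>0: "B * V < real \<nu>0" "\<nu>0 > 0"
  proof -
    obtain u :: nat where "B * V < real u" using reals_Archimedean2 by blast
    then show thesis by (intro that[of "Suc u"]) auto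
  qed
  have qI: "q n k > B" if "k \<in> I" "\<nu>0 \<le> cnt x n (k, c)" for n k
  proof -
    have kK: "k \<in> K" using that IK by auto
    have pv: "post_var (obs x n) k c > 0" by (rule posterior_boundsD(3)[OF pb kK c])
    have "post_var (obs x n) k c \<le> V / real 1"
      by (rule posterior_boundsD(5)[OF pb kK c]) (use that \<nu>0 in auto)
    then have "real \<nu>0 / V \<le> q n k"
      unfolding q_def using that pv \<nu>0 by (intro frac_le) auto
    moreover have "B < real \<nu>0 / V" using \<nu>0 V by (simp add: less_divide_eq)
    ultimately show ?thesis by linarith
  qed

  have "\<forall>\<^sub>F n in sequentially. inf (pick x n) \<and> (\<forall>k\<in>I. \<nu>0 \<le> cnt x n (k, c)) \<and> n \<ge> max 1 N0"
    by (intro eventually_conj ev_inf I_ge eventually_ge_at_top)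
  then obtain n1 where n1: "\<And>n. n \<ge> n1 \<Longrightarrow> inf (pick x n)"
     "\<And>n k. n \<ge> n1 \<Longrightarrow> k \<in> I \<Longrightarrow> \<nu>0 \<le> cnt x n (k, c)" "\<And>n. n \<ge> n1 \<Longrightarrow> n \<ge> max 1 N0"
    unfolding eventually_sequentially by blast

  have late: "s \<in> I \<and> predicted_best (obs x n) c \<in> I \<and>
      (s = predicted_best (obs x n) c \<and> q n s < (\<Sum>k\<in>K - {s}. q n k) \<or>
       s \<noteq> predicted_best (obs x n) c \<and> zeta (obs x n) s c \<le> Z)"
    if n: "n \<ge> n1" and pick: "pick x n = (s, c)" for n s
  proof -
    let ?b = "predicted_best (obs x n) c"
    have "n \<ge> N0" "n > 0" using n1(3)[OF n] by auto
    then have ns: "next_sample (obs x n) = (s, c)"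
      using pick by (simp add: pick_def decide_def)
    have sI: "s \<in> I"
      using n1(1)[OF n] pick next_sample_cases(2)[OF ns] by (simp add: I_def)
    have bK: "?b \<in> K" by (rule predicted_best_max)
    have psi: "psi1 (obs x n) c < psi2 (obs x n) c \<longleftrightarrow> q n ?b < (\<Sum>k\<in>K - {?b}. q n k)"
      unfolding q_def by (rule psi_less_iff) fact
    \<comment> \<open>A predicted best outside \<open>I\<close> would have \<open>psi1\<close> below
      \<open>psi2\<close>, so the policy would sample it, although late samples fall only on pairs
      that are sampled infinitely often.\<close>
    have bI: "?b \<in> I"
    proof (rule ccontr)
      assume nb: "?b \<notin> I"
      have "q n ?b \<le> (\<Sum>k\<in>K - I. q n k)"
        using bK nb finite_K q0 by (intro member_le_sum) auto
      also have "\<dots> \<le> B" by (rule B)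
      also have "B < q n k0" using qI[OF k0I] n1(2)[OF n k0I] by blast
      also have "q n k0 \<le> (\<Sum>k\<in>K - {?b}. q n k)"
        using k0 k0I nb finite_K q0 by (intro member_le_sum) auto
      finally have "psi1 (obs x n) c < psi2 (obs x n) c" using psi by simp
      then have "s = ?b" using next_sample_cases(3)[OF ns] by blast
      then show False using sI nb by simp
    qed
    show ?thesis
    proof (cases "s = ?b")
      case True
      then show ?thesis using sI bI next_sample_cases(3)[OF ns] psi by auto
    next
      case False
      then have min: "\<forall>k'\<in>K. \<forall>c'\<in>C. k' \<noteq> predicted_best (obs x n) c' \<longrightarrow> zeta (obs x n) s c \<le> zeta (obs x n) k' c'"
        using next_sample_cases(3)[OF ns] by blast
      obtain k where "k \<in> K" "k \<noteq> predicted_best (obs x n) c1" "zeta (obs x n) k c1 \<le> Z"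
        using Z(2) by blast
      then have "zeta (obs x n) s c \<le> Z" using min kc1 by (meson SigmaD2 order_trans)
      then show ?thesis using False sI bI by blast
    qed
  qed

  have picked: "\<exists>n\<ge>N. pick x n = (k, c)" if "k \<in> I" for k N
    using that unfolding I_def inf_def unbounded_iff_picked by blast

  \<comment> \<open>A sole element \<open>k0\<close> could be sampled only as predicted best with
    \<open>psi1\<close> below \<open>psi2\<close>, but by then \<open>q n k0\<close> exceeds the
    bound \<open>B\<close> on the sum over all others.\<close>
  have card_I: "card I \<ge> 2"
  proof (rule ccontr)
    assume "\<not> card I \<ge> 2"
    moreover have "card I > 0" using k0I finI by (auto simp: card_gt_0_iff)
    ultimately have "card I = 1" by linarith
    then have I1: "I = {k0}" using k0I by (metis card_1_singletonE singletonD)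
    obtain n where n: "n \<ge> n1" "pick x n = (k0, c)" using picked[OF k0I] by blast
    have "predicted_best (obs x n) c = k0" "q n k0 < (\<Sum>k\<in>K - {k0}. q n k)"
      using late[OF n] I1 by auto
    moreover have "(\<Sum>k\<in>K - {k0}. q n k) \<le> B" using B[of n] I1 by simp
    moreover have "B < q n k0" using qI[OF k0I] n1(2)[OF n(1) k0I] by blast
    ultimately show False by simp
  qed

  \<comment> \<open>Replacing posterior means by sample averages costs \<open>A / sqrt \<nu>\<close>
    for each of two arms; \<open>zeta \<le> Z\<close> with both variances at most
    \<open>V / \<nu>\<close> allows a gap of \<open>sqrt (2 * Z * V / \<nu>)\<close>.\<close>
  define G where "G = 2 * A + sqrt (2 * Z * V)"
  have G: "G \<ge> 0" using A Z V by (simp add: G_def)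
  have star: "F k c + walk x (k, c) (cnt x n (k, c)) / real (cnt x n (k, c)) - G / sqrt (real \<nu>)
      \<le> F s c + walk x (s, c) (cnt x n (s, c)) / real (cnt x n (s, c))"
    if n: "n \<ge> n1" and pick: "pick x n = (s, c)" and k: "k \<in> I" and \<nu>: "\<nu> \<ge> 1" "\<forall>i\<in>I. \<nu> \<le> cnt x n (i, c)"
    for n s k \<nu>
  proof -
    let ?b = "predicted_best (obs x n) c"
    let ?y = "\<lambda>k. F k c + walk x (k, c) (cnt x n (k, c)) / real (cnt x n (k, c))"
    let ?m = "\<lambda>k. post_mean (obs x n) k c"
    have sI: "s \<in> I" and bI: "?b \<in> I" using late[OF n pick] by auto
    have t: "sqrt (real \<nu>) > 0" "sqrt (real \<nu>) \<le> real \<nu>"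
      using \<nu> by (auto simp: real_sqrt_le_iff' intro!: real_le_lsqrt self_le_power simp: power2_eq_square)
    have close: "\<bar>?y i - ?m i\<bar> \<le> A / sqrt (real \<nu>)" if "i \<in> I" for i
    proof -
      have "\<bar>?y i - ?m i\<bar> \<le> A / real \<nu>"
        by (rule posterior_boundsD(4)[OF pb _ c]) (use that IK \<nu> in auto)
      also have "\<dots> \<le> A / sqrt (real \<nu>)"
        using t A \<nu> by (intro divide_left_mono) auto
      finally show ?thesis .
    qed
    have mk: "?m k \<le> ?m ?b" by (rule predicted_best_max) (use k IK in auto)
    have gap: "?m ?b - ?m s \<le> sqrt (2 * Z * V) / sqrt (real \<nu>)"
    proof (cases "s = ?b")
      case True
      then show ?thesis using Z V by (simp add: mult_nonneg_nonneg)
    next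
      case False
      then have z: "zeta (obs x n) s c \<le> Z" using late[OF n pick] by blast
      have var: "post_var (obs x n) i c > 0" "post_var (obs x n) i c \<le> V / real \<nu>" if "i \<in> I" for i
      proof -
        show "post_var (obs x n) i c > 0"
          by (rule posterior_boundsD(3)[OF pb _ c]) (use that IK in auto)
        show "post_var (obs x n) i c \<le> V / real \<nu>"
          by (rule posterior_boundsD(5)[OF pb _ c]) (use that IK \<nu> in auto)
      qed
      have "(?m ?b - ?m s)\<^sup>2 \<le> Z * (post_var (obs x n) ?b c + post_var (obs x n) s c)"
        using z var(1)[OF bI] var(1)[OF sI] by (simp add: zeta_def divide_le_eq add_pos_pos)
      also have "\<dots> \<le> Z * (V / real \<nu> + V / real \<nu>)"
        using var(2)[OF bI] var(2)[OF sI] Z by (intro mult_left_mono add_mono) auto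
      also have "\<dots> = 2 * Z * V / real \<nu>"
        by (simp add: algebra_simps)
      finally have "?m ?b - ?m s \<le> sqrt (2 * Z * V / real \<nu>)"
        by (rule real_le_rsqrt)
      then show ?thesis by (simp add: real_sqrt_divide)
    qed
    have "G / sqrt (real \<nu>) = A / sqrt (real \<nu>) + A / sqrt (real \<nu>) + sqrt (2 * Z * V) / sqrt (real \<nu>)"
      by (simp add: G_def add_divide_distrib)
    then show ?thesis
      using close[OF k] close[OF sI] mk gap by linarith
  qed

  \<comment> \<open>Late samples of \<open>s\<close> turn \<open>star\<close> into an inequality of
    rewards. A quarter of the gap is the right \<open>d\<close> because three errors below
    \<open>d\<close> occur: two noise averages and the tolerance.\<close>
  have F_eq: "F k c \<le> F s c" if k: "k \<in> I" and s: "s \<in> I" for k s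
  proof (rule ccontr)
    assume "\<not> F k c \<le> F s c"
    define d where "d = (F k c - F s c) / 4"
    have d: "d > 0" using \<open>\<not> F k c \<le> F s c\<close> by (simp add: d_def)
    have small: "\<forall>\<^sub>F r in sequentially. \<bar>walk x (i, c) r / real r\<bar> < d" if "i \<in> I" for i
      using slln[of "(i, c)"] that IK c d by (auto simp: tendsto_iff dist_real_def)
    have "(\<lambda>\<nu>. G / sqrt (real \<nu>)) \<longlonglongrightarrow> 0"
      by (rule real_tendsto_divide_at_top[OF tendsto_const])
        (rule filterlim_compose[OF sqrt_at_top filterlim_real_sequentially])
    then have "\<forall>\<^sub>F \<nu> in sequentially. G / sqrt (real \<nu>) < d"
      using d by (rule order_tendstoD(2))
    then have "\<forall>\<^sub>F \<nu> in sequentially. G / sqrt (real \<nu>) < d \<and> \<nu> \<ge> 1 \<and>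
        (\<forall>r\<ge>\<nu>. \<bar>walk x (k, c) r / real r\<bar> < d) \<and> (\<forall>r\<ge>\<nu>. \<bar>walk x (s, c) r / real r\<bar> < d)"
      using small[OF k] small[OF s]
      by (intro eventually_conj eventually_ge_at_top eventually_all_ge_at_top)
    then obtain \<nu> where \<nu>: "G / sqrt (real \<nu>) < d" "\<nu> \<ge> 1"
        "\<And>r. r \<ge> \<nu> \<Longrightarrow> \<bar>walk x (k, c) r / real r\<bar> < d" "\<And>r. r \<ge> \<nu> \<Longrightarrow> \<bar>walk x (s, c) r / real r\<bar> < d"
      by (auto simp: eventually_sequentially)
    obtain n2 where n2: "\<And>n. n \<ge> n2 \<Longrightarrow> \<forall>i\<in>I. \<nu> \<le> cnt x n (i, c)"
      using I_ge[of \<nu>] by (auto simp: eventually_sequentially)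
    obtain n where n: "n \<ge> max n1 n2" "pick x n = (s, c)" using picked[OF s] by blast
    then have all: "\<forall>i\<in>I. \<nu> \<le> cnt x n (i, c)" using n2 by simp
    have "F k c + walk x (k, c) (cnt x n (k, c)) / real (cnt x n (k, c)) - G / sqrt (real \<nu>)
      \<le> F s c + walk x (s, c) (cnt x n (s, c)) / real (cnt x n (s, c))"
      by (rule star[OF _ n(2) k \<nu>(2) all]) (use n in simp)
    moreover have "\<bar>walk x (k, c) (cnt x n (k, c)) / real (cnt x n (k, c))\<bar> < d"
      by (rule \<nu>(3)) (use all k in auto)
    moreover have "\<bar>walk x (s, c) (cnt x n (s, c)) / real (cnt x n (s, c))\<bar> < d"
      by (rule \<nu>(4)) (use all s in auto)
    moreover have "F k c = F s c + 4 * d" by (simp add: d_def field_simps)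
    ultimately show False using \<nu>(1) d by linarith
  qed

  \<comment> \<open>Equal rewards cancel in \<open>star\<close>, which leaves the condition on the
    noise averages.\<close>
  have "competitive cnt (I \<times> {c}) G n1 x"
    unfolding competitive_def
  proof (intro conjI ballI allI impI)
    fix a m assume "a \<in> I \<times> {c}"
    then show "\<exists>n. m \<le> cnt x n a" by (auto simp: I_def inf_def)
  next
    fix n s k \<nu> assume n: "n1 \<le> n" and s: "s \<in> I \<times> {c}" "cnt x (Suc n) s \<noteq> cnt x n s"
      and k: "k \<in> I \<times> {c}" and \<nu>: "1 \<le> \<nu>" "\<forall>i\<in>I \<times> {c}. \<nu> \<le> cnt x n i"
    from s(2) have "pick x n = s" by (auto simp: cnt_Suc split: if_splits)
    moreover obtain s' where s': "s = (s', c)" "s' \<in> I" using s by auto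
    moreover obtain k' where k': "k = (k', c)" "k' \<in> I" using k by auto
    moreover have "F k' c = F s' c"
      using F_eq[OF s'(2) k'(2)] F_eq[OF k'(2) s'(2)] by simp
    ultimately show "walk x k (cnt x n k) / real (cnt x n k) - G / sqrt (real \<nu>)
        \<le> walk x s (cnt x n s) / real (cnt x n s)"
      using star[OF n, of s' k' \<nu>] \<nu> by auto
  qed
  moreover have "I \<times> {c} \<subseteq> K \<times> C" using IK c by auto
  moreover have "card (I \<times> {c}) \<ge> 2" using card_I by (simp add: card_cartesian_product)
  ultimately show False using nc by blast
qed

section \<open>Convergence once every pair is sampled infinitely often\<close>

lemma predicted_best_converges:
  assumes uniq: "\<And>c. c \<in> C \<Longrightarrow> \<exists>!k. is_arg_max (\<lambda>k. F k c) (\<lambda>k. k \<in> K) k"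
    and slln: "\<And>a. a \<in> K \<times> C \<Longrightarrow> (\<lambda>n. walk x a n / real n) \<longlonglongrightarrow> 0"
    and nc: "\<And>I G n1. I \<subseteq> K \<times> C \<Longrightarrow> card I \<ge> 2 \<Longrightarrow> \<not> competitive cnt I G n1 x"
    and c: "c \<in> C"
  shows "\<forall>\<^sub>F n in sequentially. predicted_best (obs x n) c = arg_max_on (\<lambda>k. F k c) K"
proof -
  obtain A l V where pb: "posterior_bounds x A l V"
    using posterior_bounds_exist[OF slln] by blast
  have unb: "\<forall>m. \<exists>n. m \<le> cnt x n (k, c)" if "k \<in> K" for k
    by (rule all_pairs_sampled[OF pb slln nc]) (use that c in auto)
  define b where "b = arg_max_on (\<lambda>k. F k c) K"
  have "is_arg_max (\<lambda>k. F k c) (\<lambda>k. k \<in> K) b"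
    unfolding b_def arg_max_on_def arg_max_def using uniq[OF c] by (metis someI_ex)
  then have bK: "b \<in> K" and bmax: "\<And>k. k \<in> K \<Longrightarrow> F k c \<le> F b c"
    by (auto simp: is_arg_max_def not_less)
  \<comment> \<open>Uniqueness makes the maximum strict, so convergence of the posterior means
    decides the order at late times, whatever the tie rule.\<close>
  have strict: "F k c < F b c" if k: "k \<in> K" "k \<noteq> b" for k
  proof (rule ccontr)
    assume "\<not> F k c < F b c"
    then have "is_arg_max (\<lambda>k. F k c) (\<lambda>k. k \<in> K) k"
      using k bmax by (fastforce simp: is_arg_max_def not_less)
    then show False
      using uniq[OF c] k(2) \<open>is_arg_max (\<lambda>k. F k c) (\<lambda>k. k \<in> K) b\<close> by blast
  qed
  have lim: "(\<lambda>n. post_mean (obs x n) k c) \<longlonglongrightarrow> F k c" if k: "k \<in> K" for k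
  proof -
    have cn: "filterlim (\<lambda>n. cnt x n (k, c)) at_top sequentially"
      using eventually_cnt_ge[OF unb[OF k]] by (simp add: filterlim_at_top)
    have w: "(\<lambda>n. walk x (k, c) (cnt x n (k, c)) / real (cnt x n (k, c))) \<longlonglongrightarrow> 0"
      using filterlim_compose[OF slln[of "(k, c)"] cn] k c by simp
    have An: "(\<lambda>n. A / real (cnt x n (k, c))) \<longlonglongrightarrow> 0"
      by (rule filterlim_compose[OF lim_const_over_n cn])
    have "(\<lambda>n. F k c + walk x (k, c) (cnt x n (k, c)) / real (cnt x n (k, c)) - post_mean (obs x n) k c) \<longlonglongrightarrow> 0"
    proof (rule Lim_null_comparison[OF _ An])
      show "\<forall>\<^sub>F n in sequentially. norm (F k c + walk x (k, c) (cnt x n (k, c)) / real (cnt x n (k, c)) - post_mean (obs x n) k c)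
         \<le> A / real (cnt x n (k, c))"
        using eventually_cnt_ge[OF unb[OF k], of 1]
        by eventually_elim (use posterior_boundsD(4)[OF pb k c] in auto)
    qed
    from tendsto_diff[OF tendsto_add[OF tendsto_const[of "F k c"] w] this]
    show ?thesis by simp
  qed
  have "\<forall>\<^sub>F n in sequentially. \<forall>k\<in>K - {b}. post_mean (obs x n) k c < post_mean (obs x n) b c"
  proof (intro eventually_ball_finite ballI)
    show "finite (K - {b})" using finite_K by simp
    fix k assume "k \<in> K - {b}"
    then have k: "k \<in> K" "k \<noteq> b" by auto
    obtain z where z: "F k c < z" "z < F b c" using dense[OF strict[OF k]] by blast
    have "\<forall>\<^sub>F n in sequentially. post_mean (obs x n) k c < z" "\<forall>\<^sub>F n in sequentially. z < post_mean (obs x n) b c"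
      using order_tendstoD(2)[OF lim[OF k(1)] z(1)] order_tendstoD(1)[OF lim[OF bK] z(2)] .
    then show "\<forall>\<^sub>F n in sequentially. post_mean (obs x n) k c < post_mean (obs x n) b c"
      by eventually_elim simp
  qed
  then show ?thesis
  proof eventually_elim
    case (elim n)
    show ?case
    proof (rule ccontr)
      assume "predicted_best (obs x n) c \<noteq> arg_max_on (\<lambda>k. F k c) K"
      then have "predicted_best (obs x n) c \<in> K - {b}"
        using predicted_best_max(1) by (auto simp: b_def)
      then have "post_mean (obs x n) (predicted_best (obs x n) c) c < post_mean (obs x n) b c"
        using elim by blast
      then show False using predicted_best_max(2)[OF bK, of "obs x n" c] by simp
    qed
  qed
qed

end

section \<open>Measurability of the allocation\<close>

context gp_c_ocba_setting
begin

text \<open>As long as the histories agree so do the picks, and a sample of \<open>a\<close> that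
  keeps its count within \<nu> reads a noise of index below \<nu>. This is the source of
  \<open>nonanticipating\<close>.\<close>

lemma obs_agree:
  assumes a: "a \<in> K \<times> C" and eq: "\<And>j b. b \<in> K \<times> C \<Longrightarrow> b \<noteq> a \<or> j < \<nu> \<Longrightarrow> x (j, b) = y (j, b)"
    and "cnt x n a \<le> \<nu>"
  shows "obs y n = obs x n"
  using assms(3)
proof (induction n)
  case (Suc n)
  then have IH: "obs y n = obs x n"
    using cnt_mono[of n "Suc n" x a] by simp
  then have p: "pick y n = pick x n" by (simp add: pick_def)
  have "x (cnt x n (pick x n), pick x n) = y (cnt x n (pick x n), pick x n)"
    by (rule eq) (use pick_in Suc.prems in \<open>auto simp: cnt_Suc\<close>)
  then show ?case
    using IH p by (simp add: obs_Suc cnt_def)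
qed simp

lemma obs_cong:
  assumes "\<And>j b. b \<in> K \<times> C \<Longrightarrow> x (j, b) = y (j, b)"
  shows "obs y n = obs x n"
proof -
  obtain a where "a \<in> K \<times> C" using K_nonempty C_nonempty by blast
  then show ?thesis
    by (rule obs_agree[where \<nu>="cnt x n a"]) (use assms in auto)
qed

text \<open>
  The history with a prescribed sequence of sampled pairs; for fixed pairs everything the policy
  computes is a measurable function of the noise.
\<close>

definition replay :: "('k \<times> 'c) list \<Rightarrow> (nat \<times> 'k \<times> 'c \<Rightarrow> real) \<Rightarrow> ('k, 'c) history" where
  "replay ps x = map (\<lambda>i. (ps ! i, F (fst (ps ! i)) (snd (ps ! i)) + x (count_list (take i ps) (ps ! i), ps ! i)))
     [0..<length ps]"

lemma replay_snoc:
  "replay (ps @ [p]) x = replay ps x @ [(p, F (fst p) (snd p) + x (count_list ps p, p))]"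
  by (auto simp: replay_def nth_append)

lemma obs_eq_replay: "obs x n = replay (map fst (obs x n)) x"
proof (induction n)
  case (Suc n)
  then show ?case
    by (simp add: obs_Suc replay_snoc cnt_def num_samples_def)
qed (simp add: replay_def)

lemma map_fst_replay: "map fst (replay ps x) = ps"
  by (simp add: replay_def comp_def map_nth)

lemma samples_of_replay:
  "samples_of (replay ps x) k = map (\<lambda>i. (ps ! i, F (fst (ps ! i)) (snd (ps ! i)) + x (count_list (take i ps) (ps ! i), ps ! i)))
     (filter (\<lambda>i. fst (ps ! i) = k) [0..<length ps])"
  by (simp add: samples_of_def replay_def filter_map comp_def)

text \<open>Posterior variances involve the sampled contexts but not the observed values, so for
  fixed pairs they are constants in the noise.\<close>

lemma post_var_replay: "post_var (replay ps x) k c = post_var (replay ps (\<lambda>_. 0)) k c"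
  by (simp add: post_var_def samples_of_replay comp_def)

lemma frac_samples_replay: "frac_samples (replay ps x) k c = frac_samples (replay ps (\<lambda>_. 0)) k c"
  by (simp add: frac_samples_def num_samples_def map_fst_replay) (simp add: replay_def)

end

section \<open>Measurability for a prescribed sequence of pairs\<close>

locale gp_c_ocba_measurable = gp_c_ocba_setting +
  fixes M :: "(nat \<times> 'a \<times> 'b \<Rightarrow> real) measure"
  assumes coord: "\<And>j a. a \<in> K \<times> C \<Longrightarrow> (\<lambda>x. x (j, a)) \<in> borel_measurable M"
begin

lemma measurable_post_mean:
  assumes "set ps \<subseteq> K \<times> C"
  shows "(\<lambda>x. post_mean (replay ps x) k c) \<in> borel_measurable M"
proof -
  let ?idx = "filter (\<lambda>i. fst (ps ! i) = k) [0..<length ps]"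
  let ?D = "map (\<lambda>i. snd (ps ! i)) ?idx"
  let ?Y = "\<lambda>x. map (\<lambda>i. F (fst (ps ! i)) (snd (ps ! i)) + x (count_list (take i ps) (ps ! i), ps ! i)) ?idx"
  let ?B = "gp_noisy_cov_inv (S0 k) (s2 k) ?D"
  let ?n = "length ?D"
  have Y: "(\<lambda>x. ?Y x ! j) \<in> borel_measurable M" if "j < ?n" for j
  proof -
    have "?idx ! j \<in> set ?idx" using that by (intro nth_mem) simp
    then have "ps ! (?idx ! j) \<in> set ps" by (intro nth_mem) simp
    then have "ps ! (?idx ! j) \<in> K \<times> C" using assms by blast
    then have "(\<lambda>x. F (fst (ps ! (?idx ! j))) (snd (ps ! (?idx ! j)))
        + x (count_list (take (?idx ! j) ps) (ps ! (?idx ! j)), ps ! (?idx ! j))) \<in> borel_measurable M"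
      by (intro borel_measurable_add borel_measurable_const coord)
    then show ?thesis using that by simp
  qed
  have eq: "post_mean (replay ps x) k c = gp_post_mean (mu0 k) (S0 k) (s2 k) ?D (?Y x) c" for x
    by (simp add: post_mean_def samples_of_replay comp_def)
  show ?thesis
    unfolding eq gp_post_mean_sum
    by (intro borel_measurable_add borel_measurable_sum borel_measurable_times borel_measurable_diff
        borel_measurable_const Y) simp
qed

text \<open>The tie rules are arbitrary functions of the set of optimisers. That set ranges over a
  finite power set, and measurability into this discrete space lets any tie rule be composed with
  it.\<close>

lemma measurable_finite_set:
  assumes "finite A" "\<And>x. x \<in> space M \<Longrightarrow> T x \<subseteq> A"
    and "\<And>a. a \<in> A \<Longrightarrow> Measurable.pred M (\<lambda>x. a \<in> T x)"
  shows "T \<in> measurable M (count_space (Pow A))"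
proof (subst measurable_count_space_eq2)
  show "finite (Pow A)" using assms by simp
  have "T -` {B} \<inter> space M \<in> sets M" if "B \<subseteq> A" for B
  proof -
    have "T -` {B} \<inter> space M = {x \<in> space M. \<forall>a\<in>A. a \<in> T x \<longleftrightarrow> a \<in> B}"
      using assms(2) that by blast
    also have "\<dots> \<in> sets M"
    proof (rule sets.sets_Collect_finite_All)
      show "{x \<in> space M. a \<in> T x \<longleftrightarrow> a \<in> B} \<in> sets M" if "a \<in> A" for a
        using assms(3)[OF that] by measurable
    qed (use assms in auto)
    finally show ?thesis .
  qed
  then show "T \<in> space M \<rightarrow> Pow A \<and> (\<forall>a\<in>Pow A. T -` {a} \<inter> space M \<in> sets M)"
    using assms(2) by auto
qed

lemma measurable_predicted_best:
  assumes "set ps \<subseteq> K \<times> C"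
  shows "(\<lambda>x. predicted_best (replay ps x) c) \<in> measurable M (count_space K)"
proof -
  let ?T = "\<lambda>x. {k. is_arg_max (\<lambda>k. post_mean (replay ps x) k c) (\<lambda>k. k \<in> K) k}"
  note [measurable] = measurable_post_mean[OF assms]
  have T: "?T \<in> measurable M (count_space (Pow K))"
  proof (rule measurable_finite_set[OF finite_K])
    fix k assume k: "k \<in> K"
    have "{x \<in> space M. \<forall>k'\<in>K. post_mean (replay ps x) k' c \<le> post_mean (replay ps x) k c} \<in> sets M"
    proof (rule sets.sets_Collect_finite_All)
      show "{x \<in> space M. post_mean (replay ps x) k' c \<le> post_mean (replay ps x) k c} \<in> sets M" for k'
        by measurable
    qed (use finite_K in auto)
    then have "Measurable.pred M (\<lambda>x. \<forall>k'\<in>K. post_mean (replay ps x) k' c \<le> post_mean (replay ps x) k c)"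
      by (simp add: pred_def)
    moreover have "(k \<in> ?T x) = (\<forall>k'\<in>K. post_mean (replay ps x) k' c \<le> post_mean (replay ps x) k c)" for x
      using k by (auto simp: is_arg_max_def not_less)
    ultimately show "Measurable.pred M (\<lambda>x. k \<in> ?T x)" by simp
  qed (auto simp: is_arg_max_def)
  have "(\<lambda>x. tie_alt (length ps) c (?T x)) \<in> measurable M (count_space UNIV)"
    by (rule measurable_compose[OF T]) simp
  then have "(\<lambda>x. predicted_best (replay ps x) c) \<in> measurable M (count_space UNIV)"
    by (simp add: predicted_best_def replay_def)
  then show ?thesis
    using predicted_best_max(1) by (auto simp: measurable_def)
qed

lemma measurable_zeta:
  assumes "set ps \<subseteq> K \<times> C"
  shows "(\<lambda>x. zeta (replay ps x) k c) \<in> borel_measurable M"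
proof -
  note [measurable] = measurable_post_mean[OF assms]
  define f where "f b x = (post_mean (replay ps x) b c - post_mean (replay ps x) k c)\<^sup>2
       / (post_var (replay ps (\<lambda>_. 0)) b c + post_var (replay ps (\<lambda>_. 0)) k c)" for b x
  \<comment> \<open>The predicted best takes finitely many values, so it suffices to treat each
    fixed value \<open>b\<close>.\<close>
  have "(\<lambda>x. f (predicted_best (replay ps x) c) x) \<in> borel_measurable M"
  proof (rule measurable_compose_countable'[of K f, OF _ measurable_predicted_best[OF assms]])
    show "countable K" using finite_K by (rule countable_finite)
    show "(\<lambda>x. f b x) \<in> borel_measurable M" for b
      unfolding f_def by measurable
  qed
  moreover have "f (predicted_best (replay ps x) c) x = zeta (replay ps x) k c" for x
    unfolding zeta_def f_def post_var_replay[of ps x] ..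
  ultimately show ?thesis by simp
qed

lemma measurable_next_sample:
  assumes "set ps \<subseteq> K \<times> C"
  shows "(\<lambda>x. next_sample (replay ps x)) \<in> measurable M (count_space UNIV)"
proof -
  let ?P = "\<lambda>x (k, c). c \<in> C \<and> k \<in> K \<and> k \<noteq> predicted_best (replay ps x) c"
  let ?T = "\<lambda>x. {p. is_arg_min (\<lambda>(k, c). zeta (replay ps x) k c) (?P x) p}"
  have KC: "finite (K \<times> C)" "K \<times> C \<noteq> {}" using finite_K finite_C K_nonempty C_nonempty by auto
  have ne: "Measurable.pred M (\<lambda>x. k \<noteq> predicted_best (replay ps x) c)" for k c
    by (rule measurable_compose[OF measurable_predicted_best[OF assms]]) simp
  have T: "?T \<in> measurable M (count_space (Pow (K \<times> C)))"
  proof (rule measurable_finite_set[OF KC(1)])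
    fix p assume p: "p \<in> K \<times> C"
    have le: "{x \<in> space M. \<forall>q\<in>K \<times> C. fst q \<noteq> predicted_best (replay ps x) (snd q) \<longrightarrow>
        zeta (replay ps x) (fst p) (snd p) \<le> zeta (replay ps x) (fst q) (snd q)} \<in> sets M"
    proof (rule sets.sets_Collect_finite_All[OF _ KC(1)])
      fix q
      have "{x \<in> space M. zeta (replay ps x) (fst p) (snd p) \<le> zeta (replay ps x) (fst q) (snd q)} \<in> sets M"
        by (intro borel_measurable_le measurable_zeta assms)
      moreover have "{x \<in> space M. fst q \<noteq> predicted_best (replay ps x) (snd q)} \<in> sets M"
        using ne by (simp only: pred_def)
      ultimately show "{x \<in> space M. fst q \<noteq> predicted_best (replay ps x) (snd q) \<longrightarrow>
        zeta (replay ps x) (fst p) (snd p) \<le> zeta (replay ps x) (fst q) (snd q)} \<in> sets M"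
        by (intro sets.sets_Collect_imp)
    qed
    have "Measurable.pred M (\<lambda>x. fst p \<noteq> predicted_best (replay ps x) (snd p) \<and>
       (\<forall>q\<in>K \<times> C. fst q \<noteq> predicted_best (replay ps x) (snd q) \<longrightarrow>
        zeta (replay ps x) (fst p) (snd p) \<le> zeta (replay ps x) (fst q) (snd q)))"
      using le by (intro pred_intros_logic ne) (simp add: pred_def)
    moreover have "(p \<in> ?T x) = (fst p \<noteq> predicted_best (replay ps x) (snd p) \<and>
       (\<forall>q\<in>K \<times> C. fst q \<noteq> predicted_best (replay ps x) (snd q) \<longrightarrow>
        zeta (replay ps x) (fst p) (snd p) \<le> zeta (replay ps x) (fst q) (snd q)))" for x
      using p by (cases p) (simp add: is_arg_min_def not_less, blast)
    ultimately show "Measurable.pred M (\<lambda>x. p \<in> ?T x)" by simp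
  qed (auto simp: is_arg_min_def)
  \<comment> \<open>On the empty set the tie rule is unconstrained and may return a pair outside
    \<open>K \<times> C\<close>; its image of the power set is finite all the same.\<close>
  define R where "R = tie_pair (length ps) ` Pow (K \<times> C)"
  have TR: "(\<lambda>x. tie_pair (length ps) (?T x)) \<in> measurable M (count_space R)"
    by (rule measurable_compose[OF T]) (auto simp: R_def)
  define psi where "psi c b \<longleftrightarrow> frac_samples (replay ps (\<lambda>_. 0)) b c / post_var (replay ps (\<lambda>_. 0)) b c
      < (\<Sum>k\<in>K - {b}. frac_samples (replay ps (\<lambda>_. 0)) k c / post_var (replay ps (\<lambda>_. 0)) k c)" for c b
  define f where "f p x = (if psi (snd p) (predicted_best (replay ps x) (snd p))
      then (predicted_best (replay ps x) (snd p), snd p) else p)" for p x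
  have "(\<lambda>x. f (tie_pair (length ps) (?T x)) x) \<in> measurable M (count_space UNIV)"
  proof (rule measurable_compose_countable'[of R f, OF _ TR])
    show "countable R" unfolding R_def using KC by (intro countable_finite finite_imageI) auto
    show "(\<lambda>x. f p x) \<in> measurable M (count_space UNIV)" for p
      unfolding f_def by (rule measurable_compose[OF measurable_predicted_best[OF assms, of "snd p"]]) simp
  qed
  moreover have "next_sample (replay ps x) = f (tie_pair (length ps) (?T x)) x" for x
  proof -
    have len: "length (replay ps x) = length ps" by (simp add: replay_def)
    have "psi1 (replay ps x) c < psi2 (replay ps x) c \<longleftrightarrow> psi c (predicted_best (replay ps x) c)" for c
      unfolding psi_def psi1_def psi2_def post_var_replay[of ps x] frac_samples_replay[of ps x] ..
    then show ?thesis
      unfolding next_sample_def len Let_def f_def by (simp add: case_prod_beta)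
  qed
  ultimately show ?thesis by simp
qed

text \<open>By induction the sequence of sampled pairs is measurable with values in a countable set
  of lists; on each value the history is a \<open>replay\<close>, so the next decision is
  measurable.\<close>

lemma measurable_cnt: "(\<lambda>x. cnt x n a) \<in> measurable M (count_space UNIV)"
proof -
  define LN where "LN n = {ps. set ps \<subseteq> K \<times> C \<and> length ps = n}" for n :: nat
  have cLN: "countable (LN n)" for n
    unfolding LN_def using finite_K finite_C by (intro countable_finite finite_lists_length_eq) auto
  have "(\<lambda>x. map fst (obs x n)) \<in> measurable M (count_space (LN n))"
  proof (induction n)
    case 0
    then show ?case by (simp add: LN_def)
  next
    case (Suc n)
    define f where "f ps x = ps @ [decide n (replay ps x)]" for ps x
    have "(\<lambda>x. f (map fst (obs x n)) x) \<in> measurable M (count_space UNIV)"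
    proof (rule measurable_compose_countable'[of "LN n" f, OF _ Suc cLN])
      fix ps assume "ps \<in> LN n"
      then have ps: "set ps \<subseteq> K \<times> C" by (simp add: LN_def)
      have "(\<lambda>x. decide n (replay ps x)) \<in> measurable M (count_space UNIV)"
        unfolding decide_def using measurable_next_sample[OF ps] by (cases "n < N0") simp_all
      then show "(\<lambda>x. f ps x) \<in> measurable M (count_space UNIV)"
        unfolding f_def by (rule measurable_compose) simp
    qed
    moreover have "map fst (obs x (Suc n)) = f (map fst (obs x n)) x" for x
      by (simp add: f_def obs_Suc pick_def flip: obs_eq_replay)
    ultimately have "(\<lambda>x. map fst (obs x (Suc n))) \<in> measurable M (count_space UNIV)"
      by simp
    moreover have "map fst (obs x (Suc n)) \<in> LN (Suc n)" for x
      using set_obs[of x "Suc n"] by (simp add: LN_def)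
    ultimately show ?case by (auto simp: measurable_def)
  qed
  then have "(\<lambda>x. count_list (map fst (obs x n)) a) \<in> measurable M (count_space UNIV)"
    by (rule measurable_compose) simp
  then show ?thesis by (simp add: cnt_def num_samples_def)
qed

end

section \<open>Strong consistency\<close>

theorem corollary6p7:
  fixes K :: "'k set" and C :: "(real ^ 'd) set"
    and F s2 mu0 :: "'k \<Rightarrow> real ^ 'd \<Rightarrow> real"
    and S0 :: "'k \<Rightarrow> real ^ 'd \<Rightarrow> real ^ 'd \<Rightarrow> real"
    and N0 :: nat and init :: "nat \<Rightarrow> 'k \<times> (real ^ 'd)"
    and tie_alt :: "nat \<Rightarrow> real ^ 'd \<Rightarrow> 'k set \<Rightarrow> 'k"
    and tie_pair :: "nat \<Rightarrow> ('k \<times> (real ^ 'd)) set \<Rightarrow> 'k \<times> (real ^ 'd)"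
    and M :: "'w measure" and eps :: "nat \<Rightarrow> 'k \<Rightarrow> real ^ 'd \<Rightarrow> 'w \<Rightarrow> real"
  assumes "finite K" and "card K \<ge> 2"
    and "finite C" and "C \<noteq> {}"
    and "\<And>k c. k \<in> K \<Longrightarrow> c \<in> C \<Longrightarrow> s2 k c > 0"
    and "\<And>n. n < N0 \<Longrightarrow> init n \<in> K \<times> C"
    and "\<And>n c A. A \<noteq> {} \<Longrightarrow> tie_alt n c A \<in> A"
    and "\<And>n A. A \<noteq> {} \<Longrightarrow> tie_pair n A \<in> A"
    and "prob_space M"
    and "\<And>c. c \<in> C \<Longrightarrow> \<exists>!k. is_arg_max (\<lambda>k. F k c) (\<lambda>k. k \<in> K) k"
    and "\<And>n k c. k \<in> K \<Longrightarrow> c \<in> C \<Longrightarrow>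
           distributed M lborel (eps n k c) (normal_density 0 (sqrt (s2 k c)))"
    and "prob_space.indep_vars M (\<lambda>_. borel) (\<lambda>(n, k, c). eps n k c) (UNIV \<times> K \<times> C)"
    and "\<And>k. k \<in> K \<Longrightarrow> strictly_pos_def_on C (S0 k)"
  shows "AE w in M. \<forall>c\<in>C. \<forall>\<^sub>F B in sequentially.
           gp_c_ocba.predicted_best K s2 mu0 S0 tie_alt
             (gp_c_ocba.history K C F s2 mu0 S0 N0 init tie_alt tie_pair (\<lambda>n k c. eps n k c w) B) c
           = arg_max_on (\<lambda>k. F k c) K"
proof -
  interpret W: prob_space M by fact
  interpret gp_c_ocba_setting K C F s2 mu0 S0 N0 init tie_alt tie_pair
    by unfold_locales (fact assms)+
  let ?L = "K \<times> C" and ?J = "(UNIV :: nat set) \<times> K \<times> C"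
  \<comment> \<open>The value 1 off \<open>?L\<close> meets the demand for positive variances on the
    whole type; the product runs over \<open>?L\<close> only.\<close>
  define v where "v a = (if a \<in> ?L then s2 (fst a) (snd a) else 1)" for a
  interpret gaussian_arms ?L v
    by unfold_locales (use assms finite_K finite_C K_nonempty C_nonempty s2_pos in \<open>auto simp: v_def\<close>)
  interpret gp_c_ocba_measurable K C F s2 mu0 S0 N0 init tie_alt tie_pair Q
    by unfold_locales (rule measurable_coordinate)
  interpret adaptive_sampling ?L v cnt
  proof
    show "cnt x 0 a = 0" for x a by (rule cnt_0)
    show "cnt x (Suc n) a = cnt x n a \<or> cnt x (Suc n) a = Suc (cnt x n a)" for x n a
      by (simp add: cnt_Suc)
    show "(\<lambda>x. cnt x n a) \<in> measurable Q (count_space UNIV)" for n a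
      by (rule measurable_cnt)
    fix a b \<nu> n and x y :: "nat \<times> 'k \<times> (real ^ 'd) \<Rightarrow> real"
    assume "a \<in> ?L" "\<And>j b. b \<in> ?L \<Longrightarrow> b \<noteq> a \<or> j < \<nu> \<Longrightarrow> x (j, b) = y (j, b)" "cnt x n a \<le> \<nu>"
    then have "obs y n = obs x n" by (rule obs_agree)
    then show "cnt y n b = cnt x n b" by (simp add: cnt_def)
  qed
  define X where "X i = (case i of (n, k, c) \<Rightarrow> eps n k c)" for i
  have X_dist: "distributed M lborel (X i) (normal_density 0 (sqrt (v (snd i))))" if "i \<in> ?J" for i
    using that assms(11) by (auto simp: X_def v_def)
  have X_meas: "X i \<in> borel_measurable M" if "i \<in> ?J" for i
    using distributed_measurable[OF X_dist[OF that]] by simp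
  have "W.indep_vars (\<lambda>_. borel) X (?J)"
    using assms(12) unfolding X_def .
  then have law: "distr M (PiM (?J) (\<lambda>_. borel)) (\<lambda>w. \<lambda>i\<in>?J. X i w)
      = PiM (?J) (\<lambda>i. distr M borel (X i))"
    using W.indep_vars_iff_distr_eq_PiM'[OF index_nonempty, of X "\<lambda>_. borel"] X_meas by blast
  \<comment> \<open>Collects the noises of one outcome into a point of the product space. Its law
    under \<open>M\<close> is \<open>Q\<close>, so almost sure statements about \<open>Q\<close>
    pull back to \<open>M\<close>.\<close>
  define T where "T w = (\<lambda>i\<in>?J. X i w)" for w
  have sets_Q: "sets Q = sets (PiM (?J) (\<lambda>_. borel :: real measure))"
    by (rule sets_PiM_cong) simp_all
  have T_meas: "T \<in> measurable M Q"
    unfolding T_def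
    by (rule measurable_restrict) (use X_meas in \<open>simp cong: measurable_cong_sets\<close>)
  have "distr M Q T = distr M (PiM (?J) (\<lambda>_. borel)) T"
    by (rule distr_cong) (simp_all add: sets_Q)
  also have "\<dots> = PiM (?J) (\<lambda>i. distr M borel (X i))"
    unfolding T_def by (rule law)
  also have "\<dots> = Q"
  proof (rule PiM_cong[OF refl])
    fix i assume "i \<in> ?J"
    have "distr M borel (X i) = distr M lborel (X i)"
      by (rule distr_cong) simp_all
    also have "\<dots> = noise_law v i"
      unfolding noise_law_def by (rule distributed_distr_eq_density[OF X_dist]) fact
    finally show "distr M borel (X i) = noise_law v i" .
  qed
  finally have distr_T: "distr M Q T = Q" .
  have slln: "AE x in Q. \<forall>a\<in>?L. (\<lambda>n. walk x a n / real n) \<longlonglongrightarrow> 0"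
    by (rule AE_finite_allI[OF finite_L strong_law])
  have "AE x in Q. \<forall>c\<in>C. \<forall>\<^sub>F n in sequentially. predicted_best (obs x n) c = arg_max_on (\<lambda>k. F k c) K"
    using slln AE_not_competitive
  proof eventually_elim
    case (elim x)
    show ?case
    proof
      fix c assume "c \<in> C"
      show "\<forall>\<^sub>F n in sequentially. predicted_best (obs x n) c = arg_max_on (\<lambda>k. F k c) K"
        by (rule predicted_best_converges[OF assms(10) _ _ \<open>c \<in> C\<close>]) (use elim in blast)+
    qed
  qed
  then have "AE x in distr M Q T. \<forall>c\<in>C. \<forall>\<^sub>F n in sequentially. predicted_best (obs x n) c = arg_max_on (\<lambda>k. F k c) K"
    by (simp only: distr_T)
  from AE_distrD[OF T_meas this]
  show ?thesis
  proof eventually_elim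
    case (elim w)
    have "obs (T w) n = history (\<lambda>n k c. eps n k c w) n" for n
    proof -
      \<comment> \<open>\<open>T w\<close> is restricted to \<open>?J\<close>, and the policy reads
        no noise outside it.\<close>
      have "obs (T w) n = obs (\<lambda>i. X i w) n"
        by (rule obs_cong) (simp add: T_def)
      then show ?thesis by (simp add: obs_def X_def)
    qed
    then show ?case using elim by simp
  qed
qed

end
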